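(* Let $(X_t,V_t)_{t\ge0}$ be the solution of the SDE system of the context with friction parameter $\mu>0$. Let $L,\sigma>0$ and let $\mathcal D\subset\mathbb R^d$ be an open set. Set $T:=\inf\{t\ge0:X_t\notin\mathcal D\}$ and assume that for all $x\in\mathcal D$ $$|\nabla f(x)|^2\ge2Lf(x)\quad\text{and}\quad\|\Sigma(x)\|_F^2\le\sigma f(x).$$ If $\mu>\frac{C_L\sigma}{4L}$, then there exist $C,m>0$ such that: (i) For all $t\ge0$, $\mathbb E[\mathbf 1_{\{T>t\}}f(X_t)]\le C\exp(-mt)$. (ii) For all $m'<m$ we have $\exp(m't)f(X_t)\to0$ as $t\to\infty$ almost surely on the event $\{T=\infty\}$. Moreover: (iii) The process $(X_t)_{t\ge0}$ converges almost surely on $\{T=\infty\}$.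
   Context: Setting. $f:\mathbb R^d\to\mathbb R$ is twice continuously differentiable with $C_L$-Lipschitz continuous gradient for some constant $C_L\ge0$, and $\inf_{x\in\mathbb R^d}f(x)=0$. $\Sigma:\mathbb R^d\to\mathbb R^{d\times d'}$ is Lipschitz continuous. $(\Omega,(\mathcal F_t)_{t\ge0},\mathcal F,\mathbb P)$ is a filtered probability space satisfying the usual conditions, $(W_t)_{t\ge0}$ is a standard $\mathbb R^{d'}$-valued $(\mathcal F_t)$-Brownian motion, $X_0,V_0\in L^4(\Omega,\mathcal F_0)$ are $\mathbb R^d$-valued, $\mu>0$, and $(X_t,V_t)_{t\ge0}$ is the unique continuous $\mathbb R^{2d}$-valued semimartingale satisfying $$dX_t=V_t\,dt,\qquad dV_t=-(\mu V_t+\nabla f(X_t))\,dt+\Sigma(X_t)\,dW_t.$$ $\|\cdot\|_F$ denotes the Frobenius norm. *)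

theory Defs
  imports "HOL-Probability.Probability"
begin

section \<open>Calculus\<close>

definition gradient :: "('a::real_inner \<Rightarrow> real) \<Rightarrow> 'a \<Rightarrow> 'a" where
  "gradient f x = (THE g. GDERIV f x :> g)"

definition twice_continuously_differentiable :: "(real^'d \<Rightarrow> real) \<Rightarrow> bool" where
  "twice_continuously_differentiable f \<longleftrightarrow>
     (\<forall>x. \<exists>g. GDERIV f x :> g) \<and>
     (\<exists>H :: real^'d \<Rightarrow> real^'d^'d.
        (\<forall>x. (gradient f has_derivative (\<lambda>h. H x *v h)) (at x)) \<and> continuous_on UNIV H)"

definition frobenius_norm :: "real^'k^'d \<Rightarrow> real" where
  "frobenius_norm A = sqrt (\<Sum>i\<in>UNIV. \<Sum>j\<in>UNIV. (A $ i $ j)\<^sup>2)"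

text \<open>The norm that the library puts on the type of matrices is the Frobenius norm, so Lipschitz
  continuity and distances of matrix-valued maps below refer to it.\<close>

lemma norm_eq_frobenius_norm: "norm A = frobenius_norm A"
  by (simp add: frobenius_norm_def norm_vec_def L2_set_def sum_nonneg)


section \<open>Filtered probability spaces and Brownian motion\<close>

text \<open>Processes and filtrations are indexed by \<open>real\<close>; only times \<open>t \<ge> 0\<close> are ever constrained.\<close>

definition filtered_prob_space :: "'w measure \<Rightarrow> (real \<Rightarrow> 'w measure) \<Rightarrow> bool" where
  "filtered_prob_space M F \<longleftrightarrow>
     prob_space M \<and>
     (\<forall>t\<ge>0. subalgebra M (F t)) \<and>
     (\<forall>s t. 0 \<le> s \<longrightarrow> s \<le> t \<longrightarrow> sets (F s) \<subseteq> sets (F t))"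

definition usual_conditions :: "'w measure \<Rightarrow> (real \<Rightarrow> 'w measure) \<Rightarrow> bool" where
  "usual_conditions M F \<longleftrightarrow>
     complete_measure M \<and>
     null_sets M \<subseteq> sets (F 0) \<and>
     (\<forall>t\<ge>0. sets (F t) = (\<Inter>s\<in>{t<..}. sets (F s)))"

definition adapted ::
  "(real \<Rightarrow> 'w measure) \<Rightarrow> (real \<Rightarrow> 'w \<Rightarrow> 'b::topological_space) \<Rightarrow> bool" where
  "adapted F X \<longleftrightarrow> (\<forall>t\<ge>0. X t \<in> borel_measurable (F t))"

definition continuous_paths ::
  "'w measure \<Rightarrow> (real \<Rightarrow> 'w \<Rightarrow> 'b::topological_space) \<Rightarrow> bool" where
  "continuous_paths M X \<longleftrightarrow> (AE \<omega> in M. continuous_on {0..} (\<lambda>t. X t \<omega>))"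

text \<open>The density below is that of the centred normal law with covariance \<open>(t - s) I\<close>
  (\<open>normal_density\<close> takes the standard deviation, not the variance).\<close>

definition brownian_motion ::
  "'w measure \<Rightarrow> (real \<Rightarrow> 'w measure) \<Rightarrow> (real \<Rightarrow> 'w \<Rightarrow> real^'k) \<Rightarrow> bool" where
  "brownian_motion M F W \<longleftrightarrow>
     adapted F W \<and> continuous_paths M W \<and> (AE \<omega> in M. W 0 \<omega> = 0) \<and>
     (\<forall>s t. 0 \<le> s \<longrightarrow> s < t \<longrightarrow>
        distributed M lborel (\<lambda>\<omega>. W t \<omega> - W s \<omega>)
          (\<lambda>x. ennreal (\<Prod>j\<in>UNIV. normal_density 0 (sqrt (t - s)) (x $ j))) \<and>
        prob_space.indep_set M (sets (F s))
          {(\<lambda>\<omega>. W t \<omega> - W s \<omega>) -` B \<inter> space M | B. B \<in> sets borel})"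


section \<open>The Ito integral\<close>

text \<open>A simple process is \<open>\<Sum>i<n. \<xi> i 1_(\<tau> i, \<tau> (i+1)]\<close> with deterministic times \<open>\<tau>\<close> and bounded
  matrix-valued \<open>\<xi> i\<close> known at time \<open>\<tau> i\<close>; it is represented by the triple \<open>(n, \<tau>, \<xi>)\<close>.\<close>

type_synonym ('w, 'd, 'k) simple_data =
  "nat \<times> (nat \<Rightarrow> real) \<times> (nat \<Rightarrow> 'w \<Rightarrow> real^'k^'d)"

definition simple_process ::
  "'w measure \<Rightarrow> (real \<Rightarrow> 'w measure) \<Rightarrow> ('w, 'd::finite, 'k::finite) simple_data \<Rightarrow> bool" where
  "simple_process M F = (\<lambda>(n, \<tau>, \<xi>).
     0 \<le> \<tau> 0 \<and> (\<forall>i<n. \<tau> i \<le> \<tau> (Suc i)) \<and>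
     (\<forall>i<n. \<xi> i \<in> borel_measurable (F (\<tau> i)) \<and> (\<exists>B. \<forall>\<omega>\<in>space M. norm (\<xi> i \<omega>) \<le> B)))"

definition simple_value ::
  "('w, 'd::finite, 'k::finite) simple_data \<Rightarrow> real \<Rightarrow> 'w \<Rightarrow> real^'k^'d" where
  "simple_value = (\<lambda>(n, \<tau>, \<xi>) t \<omega>. \<Sum>i<n. indicat_real {\<tau> i<..\<tau> (Suc i)} t *\<^sub>R \<xi> i \<omega>)"

definition simple_integral ::
  "(real \<Rightarrow> 'w \<Rightarrow> real^'k) \<Rightarrow> ('w, 'd::finite, 'k::finite) simple_data \<Rightarrow> real \<Rightarrow> 'w \<Rightarrow> real^'d" where
  "simple_integral W = (\<lambda>(n, \<tau>, \<xi>) t \<omega>.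
     \<Sum>i<n. \<xi> i \<omega> *v (W (min t (\<tau> (Suc i))) \<omega> - W (min t (\<tau> i)) \<omega>))"

text \<open>Measurability is part of the definition because \<open>emeasure\<close> is \<open>0\<close> on non-measurable sets.\<close>

definition tends_to_0_in_prob :: "'w measure \<Rightarrow> (nat \<Rightarrow> 'w \<Rightarrow> ennreal) \<Rightarrow> bool" where
  "tends_to_0_in_prob M Y \<longleftrightarrow>
     (\<forall>n. Y n \<in> borel_measurable M) \<and>
     (\<forall>\<epsilon>>0. (\<lambda>n. emeasure M {\<omega> \<in> space M. Y n \<omega> > \<epsilon>}) \<longlonglongrightarrow> 0)"

text \<open>\<open>I\<close> is (a continuous version of) \<open>\<integral>\<^sub>0\<^sup>t H\<^sub>s dW\<^sub>s\<close>: the limit, uniformly on compact time intervals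
  in probability, of the integrals of simple processes approximating \<open>H\<close> in \<open>L\<^sup>2([0,t])\<close> in
  probability. By the Ito isometry \<open>I\<close> is unique up to indistinguishability and does not depend on
  the approximating sequence. The integrands admitting such a sequence are, up to null sets, the
  progressively measurable ones with almost surely locally square-integrable paths, so no separate
  progressive measurability condition is needed.\<close>

definition is_Ito_integral ::
  "'w measure \<Rightarrow> (real \<Rightarrow> 'w measure) \<Rightarrow> (real \<Rightarrow> 'w \<Rightarrow> real^'k) \<Rightarrow>
   (real \<Rightarrow> 'w \<Rightarrow> real^'k^'d) \<Rightarrow> (real \<Rightarrow> 'w \<Rightarrow> real^'d) \<Rightarrow> bool" where
  "is_Ito_integral M F W H I \<longleftrightarrow>
     adapted F H \<and> (AE \<omega> in M. set_borel_measurable lborel {0..} (\<lambda>s. H s \<omega>)) \<and>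
     adapted F I \<and> continuous_paths M I \<and>
     (\<exists>S. (\<forall>n. simple_process M F (S n)) \<and>
       (\<forall>t\<ge>0.
         tends_to_0_in_prob M
           (\<lambda>n \<omega>. \<integral>\<^sup>+s\<in>{0..t}. ennreal ((norm (simple_value (S n) s \<omega> - H s \<omega>))\<^sup>2) \<partial>lborel) \<and>
         tends_to_0_in_prob M
           (\<lambda>n \<omega>. SUP s\<in>{0..t}. ennreal (norm (simple_integral W (S n) s \<omega> - I s \<omega>)))))"


section \<open>The kinetic system and the exit time\<close>

text \<open>\<open>(X, V)\<close> solves \<open>dX = V dt\<close>, \<open>dV = -(\<mu> V + \<nabla>f(X)) dt + \<Sigma>(X) dW\<close>, in integrated form. The
  semimartingale property of \<open>(X, V)\<close> is a consequence of the equations.\<close>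

definition kinetic_solution ::
  "'w measure \<Rightarrow> (real \<Rightarrow> 'w measure) \<Rightarrow> (real \<Rightarrow> 'w \<Rightarrow> real^'k) \<Rightarrow> real \<Rightarrow> (real^'d \<Rightarrow> real) \<Rightarrow>
   (real^'d \<Rightarrow> real^'k^'d) \<Rightarrow> (real \<Rightarrow> 'w \<Rightarrow> real^'d) \<Rightarrow> (real \<Rightarrow> 'w \<Rightarrow> real^'d) \<Rightarrow> bool" where
  "kinetic_solution M F W \<mu> f \<Sigma> X V \<longleftrightarrow>
     adapted F X \<and> continuous_paths M X \<and> adapted F V \<and> continuous_paths M V \<and>
     (\<exists>I. is_Ito_integral M F W (\<lambda>t \<omega>. \<Sigma> (X t \<omega>)) I \<and>
       (AE \<omega> in M. \<forall>t\<ge>0.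
          X t \<omega> = X 0 \<omega> + integral {0..t} (\<lambda>s. V s \<omega>) \<and>
          V t \<omega> = V 0 \<omega> - integral {0..t} (\<lambda>s. \<mu> *\<^sub>R V s \<omega> + gradient f (X s \<omega>)) + I t \<omega>))"

definition exit_time :: "'b set \<Rightarrow> (real \<Rightarrow> 'w \<Rightarrow> 'b) \<Rightarrow> 'w \<Rightarrow> ereal" where
  "exit_time D X \<omega> = (INF t\<in>{t. 0 \<le> t \<and> X t \<omega> \<notin> D}. ereal t)"

end

theory Submission
  imports Defs
begin

text \<open>For \<open>\<sigma> / (4 L) < b < \<mu> / C\<close>, with \<open>C\<close> slightly larger than \<open>C\<^sub>L\<close>, the function
  \<open>E(x, v) = (1 + b \<mu>) f(x) + b \<langle>\<nabla>f(x), v\<rangle> + |v|\<^sup>2 / 2\<close> dominates \<open>f(x) / 2 + \<kappa> |v|\<^sup>2\<close>, and on \<open>D\<close> its drift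
  along the system is at most \<open>- m E\<close>. Hence \<open>S\<^sub>t = exp (m t) E(X\<^sub>t, V\<^sub>t)\<close>, stopped at the exit from \<open>D\<close>, is
  a nonnegative supermartingale. Its expectation gives (i); its boundedness on \<open>{T = \<infinity>}\<close>, by Markov's inequality
  at the hitting time of a level, gives (ii); and then \<open>V\<close> decays exponentially, which gives (iii).

  Ito's formula is not needed. As \<open>V = U + I\<close> with \<open>I\<close> the stochastic integral and \<open>U\<close> of class \<open>C\<^sup>1\<close>,
  only products of \<open>C\<^sup>1\<close> processes with \<open>I\<close> and with \<open>|I|\<^sup>2 - \<integral> |\<Sigma>(X)|\<^sup>2\<close> occur, and integration by parts
  in expectation for these follows from Fubini's theorem. That the latter two processes are martingales up to a
  stopping time that bounds them is inherited from simple integrands through optional stopping and uniform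
  convergence.\<close>

section \<open>Filtrations and bounded stopping times\<close>

text \<open>Friction dissipates only \<open>|v|^2\<close>, so the energy
  \<open>f + |v|^2 / 2\<close> alone has no drift that controls \<open>f\<close>. The mixed term
  \<open>b <g, v>\<close>, with \<open>g\<close> the gradient, repairs this: its drift is
  \<open><H v, v> - \<mu> <g, v> - |g|^2\<close>, while \<open>f\<close> has drift
  \<open><g, v>\<close> and \<open>|v|^2 / 2\<close> has drift
  \<open>- \<mu> |v|^2 - <g, v> + |\<Sigma>|^2 / 2\<close>. The weight \<open>1 + b \<mu>\<close> of
  \<open>f\<close> is the one for which all multiples of \<open><g, v>\<close> cancel. Since
  \<open>|H v| \<le> C |v|\<close>, and \<open>|\<Sigma>|^2 / 2 \<le> \<sigma> f / 2 \<le> \<sigma>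
  |g|^2 / (4 L)\<close> on \<open>D\<close>, what remains is at most
  \<open>- (\<mu> - b C) |v|^2 - (b - \<sigma> / (4 L)) |g|^2\<close>. Both coefficients are
  negative for a suitable \<open>b\<close> exactly when \<open>\<mu> > C \<sigma> / (4 L)\<close>.
  The constant \<open>C\<close> is taken above \<open>C\<^sub>L\<close> because
  \<open>C\<^sub>L\<close> may be \<open>0\<close> and the estimates divide by \<open>C\<close>; the
  strict inequality for \<open>\<mu>\<close> leaves room for this.\<close>

locale usual_filtration = prob_space M for M :: "'w measure" +
  fixes F :: "real \<Rightarrow> 'w measure"
  assumes filtered: "filtered_prob_space M F"
    and usual: "usual_conditions M F"
begin

lemma subalgebra_F: "0 \<le> t \<Longrightarrow> subalgebra M (F t)"
  using filtered by (auto simp: filtered_prob_space_def)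

lemma space_F: "0 \<le> t \<Longrightarrow> space (F t) = space M"
  using subalgebra_F by (auto simp: subalgebra_def)

lemma sets_F_mono: "0 \<le> s \<Longrightarrow> s \<le> t \<Longrightarrow> A \<in> sets (F s) \<Longrightarrow> A \<in> sets (F t)"
  using filtered by (auto simp: filtered_prob_space_def)

lemma sets_F_M: "0 \<le> t \<Longrightarrow> A \<in> sets (F t) \<Longrightarrow> A \<in> sets M"
  using subalgebra_F by (auto simp: subalgebra_def)

lemma measurable_F_M: "0 \<le> t \<Longrightarrow> g \<in> measurable (F t) N \<Longrightarrow> g \<in> measurable M N"
  using measurable_from_subalg[OF subalgebra_F] .

lemma measurable_F_mono:
  assumes "0 \<le> s" "s \<le> t" "g \<in> measurable (F s) N"
  shows "g \<in> measurable (F t) N"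
proof (rule measurableI)
  have sp: "space (F t) = space (F s)" using assms(1,2) space_F by simp
  show "g \<omega> \<in> space N" if "\<omega> \<in> space (F t)" for \<omega>
    using that assms(3) sp by (metis measurable_space)
  show "g -` A \<inter> space (F t) \<in> sets (F t)" if "A \<in> sets N" for A
    using sets_F_mono[OF assms(1,2) measurable_sets[OF assms(3) that]] sp by simp
qed

lemma null_sets_F: "0 \<le> t \<Longrightarrow> A \<in> null_sets M \<Longrightarrow> A \<in> sets (F t)"
  using usual sets_F_mono[of 0 t A] unfolding usual_conditions_def by blast

text \<open>The two sets differ by null sets; completeness makes every subset of a null set
  measurable, and the usual conditions put null sets into \<open>F 0\<close>. This is how path
  properties that hold only almost surely can still yield adapted objects.\<close>

lemma sets_F_AE:
  assumes t: "0 \<le> t" and A: "A \<in> sets (F t)" and B: "B \<subseteq> space M"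
    and eq: "AE \<omega> in M. \<omega> \<in> A \<longleftrightarrow> \<omega> \<in> B"
  shows "B \<in> sets (F t)"
proof -
  interpret complete_measure M using usual unfolding usual_conditions_def by blast
  have As: "A \<subseteq> space M" using sets_F_M[OF t A] sets.sets_into_space by blast
  have AB: "AE \<omega> in M. \<omega> \<notin> A - B" and BA: "AE \<omega> in M. \<omega> \<notin> B - A"
    using eq by auto
  have 1: "A - B \<in> sets (F t)"
    using AB As null_sets_iff_AE[of "A - B"] by (intro null_sets_F[OF t]) auto
  have 2: "B - A \<in> sets (F t)"
    using BA B null_sets_iff_AE[of "B - A"] by (intro null_sets_F[OF t]) auto
  have "B = (A - (A - B)) \<union> (B - A)" by auto
  with 1 2 A show ?thesis by (metis sets.Diff sets.Un)
qed

lemma measurable_F_AE: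
  fixes g h :: "'w \<Rightarrow> 'b::topological_space"
  assumes t: "0 \<le> t" and g: "g \<in> borel_measurable (F t)" and eq: "AE \<omega> in M. g \<omega> = h \<omega>"
  shows "h \<in> borel_measurable (F t)"
proof (rule measurableI)
  fix A :: "'b set" assume "A \<in> sets borel"
  show "h -` A \<inter> space (F t) \<in> sets (F t)"
  proof (rule sets_F_AE[OF t, of "g -` A \<inter> space (F t)"])
    show "g -` A \<inter> space (F t) \<in> sets (F t)" using g \<open>A \<in> sets borel\<close> by measurable
    show "AE \<omega> in M. \<omega> \<in> g -` A \<inter> space (F t) \<longleftrightarrow> \<omega> \<in> h -` A \<inter> space (F t)" using eq by auto
  qed (auto simp: space_F[OF t])
qed simp

lemma sets_M_AE:
  assumes "A \<in> sets M" "B \<subseteq> space M" "AE \<omega> in M. \<omega> \<in> A \<longleftrightarrow> \<omega> \<in> B"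
  shows "B \<in> sets M"
proof -
  interpret complete_measure M using usual unfolding usual_conditions_def by blast
  have As: "A \<subseteq> space M" using assms sets.sets_into_space by blast
  have AB: "AE \<omega> in M. \<omega> \<notin> A - B" and BA: "AE \<omega> in M. \<omega> \<notin> B - A" using assms by auto
  have 1: "A - B \<in> sets M" "B - A \<in> sets M"
    using AB BA As assms(2) null_sets_iff_AE[of "A - B"] null_sets_iff_AE[of "B - A"] by auto
  have "B = (A - (A - B)) \<union> (B - A)" by auto
  with 1 assms show ?thesis by (metis sets.Diff sets.Un)
qed

lemma measurable_M_AE:
  fixes g h :: "'w \<Rightarrow> 'b::topological_space"
  assumes g: "g \<in> borel_measurable M" and eq: "AE \<omega> in M. g \<omega> = h \<omega>"
  shows "h \<in> borel_measurable M"
proof (rule measurableI)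
  fix A :: "'b set" assume "A \<in> sets borel"
  show "h -` A \<inter> space M \<in> sets M"
  proof (rule sets_M_AE[of "g -` A \<inter> space M"])
    show "g -` A \<inter> space M \<in> sets M" using g \<open>A \<in> sets borel\<close> by measurable
    show "AE \<omega> in M. \<omega> \<in> g -` A \<inter> space M \<longleftrightarrow> \<omega> \<in> h -` A \<inter> space M" using eq by auto
  qed auto
qed simp

text \<open>\<open>{u < \<rho>}\<close> is the complement of \<open>{\<rho> \<le> u}\<close>, so
  these are the usual stopping times with values in \<open>[0, T]\<close>. The strict event is the
  one that multiplies increments after time \<open>u\<close> in optional stopping.\<close>

definition bounded_stopping :: "real \<Rightarrow> ('w \<Rightarrow> real) \<Rightarrow> bool" where
  "bounded_stopping T \<rho> \<longleftrightarrow> (\<forall>\<omega>\<in>space M. 0 \<le> \<rho> \<omega> \<and> \<rho> \<omega> \<le> T) \<and>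
     (\<forall>u\<ge>0. {\<omega> \<in> space M. u < \<rho> \<omega>} \<in> sets (F u))"

lemma bounded_stopping_bounds:
  "bounded_stopping T \<rho> \<Longrightarrow> \<omega> \<in> space M \<Longrightarrow> 0 \<le> \<rho> \<omega>"
  "bounded_stopping T \<rho> \<Longrightarrow> \<omega> \<in> space M \<Longrightarrow> \<rho> \<omega> \<le> T"
  by (auto simp: bounded_stopping_def)

lemma bounded_stopping_sets:
  "bounded_stopping T \<rho> \<Longrightarrow> 0 \<le> u \<Longrightarrow> {\<omega> \<in> space M. u < \<rho> \<omega>} \<in> sets (F u)"
  by (auto simp: bounded_stopping_def)

lemma bounded_stopping_measurable:
  assumes "bounded_stopping T \<rho>"
  shows "\<rho> \<in> borel_measurable M"
proof (rule borel_measurableI_greater)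
  fix u :: real
  show "{\<omega> \<in> space M. u < \<rho> \<omega>} \<in> sets M"
  proof (cases "0 \<le> u")
    case True
    then show ?thesis using bounded_stopping_sets[OF assms] sets_F_M by blast
  next
    case False
    then have "{\<omega> \<in> space M. u < \<rho> \<omega>} = space M"
      using bounded_stopping_bounds(1)[OF assms] by fastforce
    then show ?thesis by simp
  qed
qed

lemma bounded_stopping_min:
  assumes "bounded_stopping T \<rho>" "bounded_stopping T \<rho>'"
  shows "bounded_stopping T (\<lambda>\<omega>. min (\<rho> \<omega>) (\<rho>' \<omega>))"
  unfolding bounded_stopping_def
proof (intro conjI ballI allI impI)
  fix u :: real assume "0 \<le> u"
  have "{\<omega> \<in> space M. u < min (\<rho> \<omega>) (\<rho>' \<omega>)} =
      {\<omega> \<in> space M. u < \<rho> \<omega>} \<inter> {\<omega> \<in> space M. u < \<rho>' \<omega>}" by auto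
  then show "{\<omega> \<in> space M. u < min (\<rho> \<omega>) (\<rho>' \<omega>)} \<in> sets (F u)"
    using bounded_stopping_sets[OF assms(1) \<open>0 \<le> u\<close>] bounded_stopping_sets[OF assms(2) \<open>0 \<le> u\<close>]
    by (simp only: sets.Int)
qed (use bounded_stopping_bounds[OF assms(1)] bounded_stopping_bounds[OF assms(2)]
  in \<open>auto simp: min_def\<close>)

lemma indicator_stopping:
  assumes "bounded_stopping T \<rho>" "0 \<le> u"
  shows "(\<lambda>\<omega>. indicator {\<omega>. u < \<rho> \<omega>} \<omega> :: real) \<in> borel_measurable (F u)"
proof -
  have "{\<omega>. u < \<rho> \<omega>} \<inter> space (F u) = {\<omega> \<in> space M. u < \<rho> \<omega>}"
    using space_F[OF assms(2)] by auto
  then have "{\<omega>. u < \<rho> \<omega>} \<inter> space (F u) \<in> sets (F u)"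
    using bounded_stopping_sets[OF assms] by simp
  then show ?thesis by (simp add: borel_measurable_indicator_iff)
qed

end

section \<open>Hitting times of the nonpositive half-line by continuous processes, capped at a
  horizon\<close>

definition hit :: "real \<Rightarrow> (real \<Rightarrow> 'w \<Rightarrow> real) \<Rightarrow> 'w \<Rightarrow> real" where
  "hit T \<phi> \<omega> = Inf (insert T {u \<in> {0..T}. \<phi> u \<omega> \<le> 0})"

lemma hit_bounds:
  assumes "0 \<le> T" shows "0 \<le> hit T \<phi> \<omega>" "hit T \<phi> \<omega> \<le> T"
proof -
  show "0 \<le> hit T \<phi> \<omega>" unfolding hit_def using assms by (intro cInf_greatest) auto
  show "hit T \<phi> \<omega> \<le> T" unfolding hit_def using assms
    by (intro cInf_lower bdd_belowI[of _ 0]) auto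
qed

text \<open>For a continuous path the set of times with \<open>\<phi> \<le> 0\<close> is closed, so
  it contains its infimum; below the horizon this infimum is a genuine hit and not the inserted
  \<open>T\<close>.\<close>

lemma hit_attained:
  assumes T: "0 \<le> T" and cont: "continuous_on {0..T} (\<lambda>u. \<phi> u \<omega>)" and less: "hit T \<phi> \<omega> < T"
  shows "\<phi> (hit T \<phi> \<omega>) \<omega> \<le> 0"
proof -
  define A where "A = {u \<in> {0..T}. \<phi> u \<omega> \<le> 0}"
  have "closed A"
    unfolding A_def using continuous_on_closed_Collect_le[OF cont continuous_on_const[of _ 0]] by simp
  then have cl: "closed (insert T A)" by simp
  have "Inf (insert T A) \<in> insert T A"
    using T by (intro closed_contains_Inf cl bdd_belowI[of _ 0]) (auto simp: A_def)
  then show ?thesis using less by (auto simp: hit_def A_def)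
qed

text \<open>Because the infimum is attained, being strictly before the hit is a condition on the
  path over \<open>[0, u]\<close> only. This is what makes \<open>hit\<close> a stopping
  time.\<close>

lemma less_hit_iff:
  assumes T: "0 \<le> T" and cont: "continuous_on {0..T} (\<lambda>u. \<phi> u \<omega>)" and u: "0 \<le> u"
  shows "u < hit T \<phi> \<omega> \<longleftrightarrow> u < T \<and> (\<forall>r\<in>{0..u}. 0 < \<phi> r \<omega>)"
proof
  assume less: "u < hit T \<phi> \<omega>"
  then have uT: "u < T" using hit_bounds(2)[OF T] by (rule less_le_trans)
  moreover have "0 < \<phi> r \<omega>" if "r \<in> {0..u}" for r
  proof (rule ccontr)
    assume "\<not> 0 < \<phi> r \<omega>"
    then have "hit T \<phi> \<omega> \<le> r" unfolding hit_def using that T uT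
      by (intro cInf_lower bdd_belowI[of _ 0]) auto
    then show False using less that by auto
  qed
  ultimately show "u < T \<and> (\<forall>r\<in>{0..u}. 0 < \<phi> r \<omega>)" by blast
next
  assume R: "u < T \<and> (\<forall>r\<in>{0..u}. 0 < \<phi> r \<omega>)"
  show "u < hit T \<phi> \<omega>"
  proof (rule ccontr)
    assume n: "\<not> u < hit T \<phi> \<omega>"
    then have "\<phi> (hit T \<phi> \<omega>) \<omega> \<le> 0" using R by (intro hit_attained[where \<phi>=\<phi> and \<omega>=\<omega>, OF T cont]) auto
    moreover have "hit T \<phi> \<omega> \<in> {0..u}" using hit_bounds[OF T] n by auto
    ultimately show False using R by fastforce
  qed
qed

context usual_filtration
begin

lemma bounded_stopping_hit:
  assumes T: "0 \<le> T" and ad: "\<And>u. 0 \<le> u \<Longrightarrow> \<phi> u \<in> borel_measurable (F u)"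
    and cont: "AE \<omega> in M. continuous_on {0..T} (\<lambda>u. \<phi> u \<omega>)"
  shows "bounded_stopping T (hit T \<phi>)"
  unfolding bounded_stopping_def
proof (intro conjI ballI allI impI)
  fix u :: real assume u: "0 \<le> u"
  show "{\<omega> \<in> space M. u < hit T \<phi> \<omega>} \<in> sets (F u)"
  proof (cases "u < T")
    case False
    then have "\<not> u < hit T \<phi> \<omega>" for \<omega> using hit_bounds(2)[OF T, of \<phi> \<omega>] by linarith
    then show ?thesis by simp
  next
    case uT: True
    obtain S where S: "countable S" "S \<subseteq> {0..u}" "{0..u} \<subseteq> closure S" using separable by blast
    have Sne: "S \<noteq> {}" using S(3) u by auto
    have clS: "closure S = {0..u}" using S by (simp add: closure_minimal subset_antisym)
    \<comment> \<open>Positivity on the dense set \<open>S\<close> would not exclude a zero outside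
      \<open>S\<close>. By compactness, however, a path positive on \<open>[0, u]\<close> stays
      above some \<open>1 / (m + 1)\<close>, and a lower bound of this kind does pass from
      \<open>S\<close> to its closure.\<close>
    define A where "A = (\<Union>m. \<Inter>r\<in>S. {\<omega> \<in> space (F u). 1 / real (Suc m) \<le> \<phi> r \<omega>})"
    have [measurable]: "\<phi> r \<in> borel_measurable (F u)" if "r \<in> S" for r
      using that S(2) by (intro measurable_F_mono[of r u] ad) auto
    have A: "A \<in> sets (F u)"
      unfolding A_def
    proof (intro sets.countable_UN'[OF countableI_type] sets.countable_INT'[OF S(1) Sne] image_subsetI)
      fix m r assume [simp]: "r \<in> S"
      show "{\<omega> \<in> space (F u). 1 / real (Suc m) \<le> \<phi> r \<omega>} \<in> sets (F u)" by measurable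
    qed
    have A_iff: "\<omega> \<in> A \<longleftrightarrow> u < hit T \<phi> \<omega>" if w: "\<omega> \<in> space M" and c: "continuous_on {0..T} (\<lambda>u. \<phi> u \<omega>)" for \<omega>
    proof -
      have c': "continuous_on {0..u} (\<lambda>u. \<phi> u \<omega>)" using c uT by (elim continuous_on_subset) auto
      have "\<omega> \<in> A \<longleftrightarrow> (\<forall>r\<in>{0..u}. 0 < \<phi> r \<omega>)"
      proof
        assume "\<omega> \<in> A"
        then obtain m where m: "\<And>r. r \<in> S \<Longrightarrow> 1 / real (Suc m) \<le> \<phi> r \<omega>" by (auto simp: A_def)
        show "\<forall>r\<in>{0..u}. 0 < \<phi> r \<omega>"
        proof
          fix r assume "r \<in> {0..u}"
          then have "1 / real (Suc m) \<le> \<phi> r \<omega>"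
            using continuous_ge_on_closure[of S "\<lambda>u. \<phi> u \<omega>" r "1 / real (Suc m)"] c' m clS by auto
          then show "0 < \<phi> r \<omega>" by (smt (verit) divide_pos_pos of_nat_0_less_iff zero_less_Suc)
        qed
      next
        assume pos: "\<forall>r\<in>{0..u}. 0 < \<phi> r \<omega>"
        obtain x where x: "x \<in> {0..u}" "\<And>y. y \<in> {0..u} \<Longrightarrow> \<phi> x \<omega> \<le> \<phi> y \<omega>"
          using continuous_attains_inf[OF _ _ c'] u by fastforce
        obtain m where "inverse (of_nat (Suc m)) < \<phi> x \<omega>"
          using pos x(1) reals_Archimedean by blast
        then have "1 / real (Suc m) \<le> \<phi> r \<omega>" if "r \<in> S" for r
          using x(2)[of r] that S(2) by (auto simp: inverse_eq_divide)
        then show "\<omega> \<in> A" using w space_F[OF u] unfolding A_def by blast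
      qed
      then show ?thesis using less_hit_iff[where \<phi>=\<phi> and \<omega>=\<omega>, OF T c u] uT by simp
    qed
    have "AE \<omega> in M. \<omega> \<in> A \<longleftrightarrow> \<omega> \<in> {\<omega> \<in> space M. u < hit T \<phi> \<omega>}"
      using cont AE_space[of M] by eventually_elim (simp add: A_iff)
    then show ?thesis by (intro sets_F_AE[OF u A]) auto
  qed
qed (simp_all add: hit_bounds[OF T])

end

text \<open>Time is approximated from below by the grid of mesh \<open>1 / (n + 1)\<close>, where
  only countably many measurable functions occur; continuity gives the limit. \<open>max 0 u\<close>
  extends the process to negative times, on which nothing is assumed.\<close>

lemma measurable_continuous_process:
  fixes Y :: "real \<Rightarrow> 'w \<Rightarrow> 'b::metric_space"
  assumes meas: "\<And>u. 0 \<le> u \<Longrightarrow> Y u \<in> borel_measurable M"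
    and cont: "\<And>\<omega>. \<omega> \<in> space M \<Longrightarrow> continuous_on {0..} (\<lambda>u. Y u \<omega>)"
  shows "(\<lambda>(u, \<omega>). Y (max 0 u) \<omega>) \<in> borel_measurable (borel \<Otimes>\<^sub>M M)"
proof (rule borel_measurable_LIMSEQ_metric)
  fix n :: nat
  let ?g = "\<lambda>i::nat. \<lambda>p::real \<times> 'w. Y (real i / real (Suc n)) (snd p)"
  have [measurable]: "Y (real i / real (Suc n)) \<in> borel_measurable M" for i by (rule meas) auto
  show "(\<lambda>p. ?g (nat \<lfloor>max 0 (fst p) * real (Suc n)\<rfloor>) p) \<in> borel_measurable (borel \<Otimes>\<^sub>M M)"
    by (rule measurable_compose_countable[where f = ?g and g = "\<lambda>p. nat \<lfloor>max 0 (fst p) * real (Suc n)\<rfloor>"]) measurable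
next
  fix p :: "real \<times> 'w" assume "p \<in> space (borel \<Otimes>\<^sub>M M)"
  then obtain u \<omega> where p: "p = (u, \<omega>)" and w: "\<omega> \<in> space M" by (auto simp: space_pair_measure)
  let ?v = "max 0 u"
  have "(\<lambda>n. real (nat \<lfloor>?v * real (Suc n)\<rfloor>) / real (Suc n)) \<longlonglongrightarrow> ?v"
  proof (rule real_tendsto_sandwich)
    show "eventually (\<lambda>n. ?v - 1 / real (Suc n) \<le> real (nat \<lfloor>?v * real (Suc n)\<rfloor>) / real (Suc n)) sequentially"
    proof (intro always_eventually allI)
      fix n
      have "?v * real (Suc n) - 1 \<le> real (nat \<lfloor>?v * real (Suc n)\<rfloor>)" by linarith
      then have "(?v * real (Suc n) - 1) / real (Suc n) \<le> real (nat \<lfloor>?v * real (Suc n)\<rfloor>) / real (Suc n)"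
        by (rule divide_right_mono) simp
      then show "?v - 1 / real (Suc n) \<le> real (nat \<lfloor>?v * real (Suc n)\<rfloor>) / real (Suc n)"
        by (simp add: diff_divide_distrib del: of_nat_Suc)
    qed
    show "eventually (\<lambda>n. real (nat \<lfloor>?v * real (Suc n)\<rfloor>) / real (Suc n) \<le> ?v) sequentially"
    proof (intro always_eventually allI)
      fix n
      have "real (nat \<lfloor>?v * real (Suc n)\<rfloor>) \<le> ?v * real (Suc n)" by simp
      then show "real (nat \<lfloor>?v * real (Suc n)\<rfloor>) / real (Suc n) \<le> ?v" by (simp add: pos_divide_le_eq)
    qed
    have "(\<lambda>n. ?v - 1 / real (Suc n)) \<longlonglongrightarrow> ?v - 0"
      by (intro tendsto_diff tendsto_const) (use LIMSEQ_inverse_real_of_nat in \<open>simp add: inverse_eq_divide\<close>)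
    then show "(\<lambda>n. ?v - 1 / real (Suc n)) \<longlonglongrightarrow> ?v" by simp
  qed simp
  then show "(\<lambda>n. Y (real (nat \<lfloor>max 0 (fst p) * real (Suc n)\<rfloor>) / real (Suc n)) (snd p)) \<longlonglongrightarrow> (case p of (u, \<omega>) \<Rightarrow> Y (max 0 u) \<omega>)"
    using cont[OF w] by (auto simp: p intro!: continuous_on_tendsto_compose[of "{0..}" "\<lambda>u. Y u \<omega>"])
qed

lemma measurable_process_at_time:
  fixes Y :: "real \<Rightarrow> 'w \<Rightarrow> 'b::metric_space"
  assumes meas: "\<And>u. 0 \<le> u \<Longrightarrow> Y u \<in> borel_measurable M"
    and cont: "\<And>\<omega>. \<omega> \<in> space M \<Longrightarrow> continuous_on {0..} (\<lambda>u. Y u \<omega>)"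
    and \<rho>[measurable]: "\<rho> \<in> borel_measurable M" and pos: "\<And>\<omega>. \<omega> \<in> space M \<Longrightarrow> 0 \<le> \<rho> \<omega>"
  shows "(\<lambda>\<omega>. Y (\<rho> \<omega>) \<omega>) \<in> borel_measurable M"
proof -
  have "(\<lambda>\<omega>. (\<lambda>(u, \<omega>). Y (max 0 u) \<omega>) (\<rho> \<omega>, \<omega>)) \<in> borel_measurable M"
    by (rule measurable_compose[OF _ measurable_continuous_process[OF meas cont]]) auto
  then show ?thesis
    by (rule measurable_cong[THEN iffD1, rotated]) (simp add: pos max_absorb2)
qed

section \<open>Optional stopping for square-integrable martingales\<close>

text \<open>Integrability of the square alone does not make \<open>f\<close> measurable, hence the
  first conjunct.\<close>

definition square_integrable :: "'w measure \<Rightarrow> ('w \<Rightarrow> real) \<Rightarrow> bool" where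
  "square_integrable M f \<longleftrightarrow> f \<in> borel_measurable M \<and> integrable M (\<lambda>x. (f x)\<^sup>2)"

lemma square_integrable_measurable: "square_integrable M f \<Longrightarrow> f \<in> borel_measurable M"
  by (simp add: square_integrable_def)

lemma square_integrable_bound:
  assumes f: "f \<in> borel_measurable M" and g: "integrable M g"
    and le: "\<And>x. x \<in> space M \<Longrightarrow> (f x)\<^sup>2 \<le> g x"
  shows "square_integrable M f"
  unfolding square_integrable_def
proof
  show "integrable M (\<lambda>x. (f x)\<^sup>2)"
  proof (rule Bochner_Integration.integrable_bound[OF g])
    show "(\<lambda>x. (f x)\<^sup>2) \<in> borel_measurable M" using f by measurable
    show "AE x in M. norm ((f x)\<^sup>2) \<le> norm (g x)" using le by (intro AE_I2) force
  qed
qed fact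

lemma square_integrable_mult:
  assumes "square_integrable M f" "square_integrable M g"
  shows "integrable M (\<lambda>x. f x * g x)"
proof (rule Bochner_Integration.integrable_bound)
  show "integrable M (\<lambda>x. (f x)\<^sup>2 + (g x)\<^sup>2)"
    using assms by (auto simp: square_integrable_def)
  show "(\<lambda>x. f x * g x) \<in> borel_measurable M"
    using assms[THEN square_integrable_measurable] by measurable
  show "AE x in M. norm (f x * g x) \<le> norm ((f x)\<^sup>2 + (g x)\<^sup>2)"
  proof (intro AE_I2)
    fix x
    have "2 * \<bar>f x * g x\<bar> \<le> (f x)\<^sup>2 + (g x)\<^sup>2"
      using sum_squares_bound[of "\<bar>f x\<bar>" "\<bar>g x\<bar>"] by (simp add: abs_mult)
    then show "norm (f x * g x) \<le> norm ((f x)\<^sup>2 + (g x)\<^sup>2)" by (smt (verit) real_norm_def)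
  qed
qed

lemma square_integrable_add:
  assumes "square_integrable M f" "square_integrable M g"
  shows "square_integrable M (\<lambda>x. f x + g x)"
proof (rule square_integrable_bound)
  show "integrable M (\<lambda>x. 2 * (f x)\<^sup>2 + 2 * (g x)\<^sup>2)"
    using assms by (auto simp: square_integrable_def)
  show "(\<lambda>x. f x + g x) \<in> borel_measurable M"
    using assms[THEN square_integrable_measurable] by measurable
  show "(f x + g x)\<^sup>2 \<le> 2 * (f x)\<^sup>2 + 2 * (g x)\<^sup>2" for x
    using sum_squares_bound[of "f x" "g x"] by (simp add: power2_sum)
qed

lemma square_integrable_mult_bounded:
  assumes "square_integrable M f" and g: "g \<in> borel_measurable M"
    and B: "\<And>x. x \<in> space M \<Longrightarrow> \<bar>g x\<bar> \<le> B"
  shows "square_integrable M (\<lambda>x. g x * f x)"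
proof (rule square_integrable_bound)
  show "integrable M (\<lambda>x. B\<^sup>2 * (f x)\<^sup>2)"
    using assms by (auto simp: square_integrable_def)
  show "(\<lambda>x. g x * f x) \<in> borel_measurable M"
    using square_integrable_measurable[OF assms(1)] g by measurable
  show "(g x * f x)\<^sup>2 \<le> B\<^sup>2 * (f x)\<^sup>2" if "x \<in> space M" for x
    using B[OF that] by (simp add: power_mult_distrib mult_right_mono abs_le_square_iff[symmetric])
qed

lemma square_integrable_cmult:
  "square_integrable M f \<Longrightarrow> square_integrable M (\<lambda>x. c * f x)"
  by (rule square_integrable_mult_bounded[where B = "\<bar>c\<bar>"]) auto

lemma square_integrable_diff:
  assumes "square_integrable M f" "square_integrable M g"
  shows "square_integrable M (\<lambda>x. f x - g x)"
  using square_integrable_add[OF assms(1) square_integrable_cmult[OF assms(2), of "-1"]] by simp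

lemma square_integrable_sum:
  assumes "\<And>i. i \<in> S \<Longrightarrow> square_integrable M (f i)"
  shows "square_integrable M (\<lambda>x. \<Sum>i\<in>S. f i x)"
proof (cases "finite S")
  case True
  then show ?thesis using assms
  proof (induction S rule: finite_induct)
    case empty
    then show ?case by (simp add: square_integrable_def)
  next
    case (insert i S)
    then show ?case by (simp add: square_integrable_add)
  qed
qed (simp add: square_integrable_def)

context prob_space
begin

lemma square_integrable_bounded:
  assumes "f \<in> borel_measurable M" "\<And>x. x \<in> space M \<Longrightarrow> \<bar>f x\<bar> \<le> B"
  shows "square_integrable M f"
proof (rule square_integrable_bound[OF assms(1)])
  show "integrable M (\<lambda>_. B\<^sup>2)" by simp
  show "(f x)\<^sup>2 \<le> B\<^sup>2" if "x \<in> space M" for x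
    using assms(2)[OF that] by (simp add: abs_le_square_iff[symmetric])
qed

lemma square_integrable_integrable:
  assumes "square_integrable M f"
  shows "integrable M f"
  using square_integrable_mult[OF assms square_integrable_bounded[of "\<lambda>_. 1" 1]] by simp

text \<open>The \<open>L2\<close> bound makes the sequence uniformly integrable. Concretely,
  \<open>|Yn - Y|\<close> is at most its cut at a level \<open>R\<close> plus
  \<open>(Yn - Y)^2 / R\<close>; dominated convergence handles the first part, and a large
  \<open>R\<close> makes the second uniformly small.\<close>

lemma L1_convergence_of_L2_bounded:
  fixes Y :: "'a \<Rightarrow> real"
  assumes Yn: "\<And>n. square_integrable M (Yn n)" and C: "\<And>n. (\<integral>x. (Yn n x)\<^sup>2 \<partial>M) \<le> C"
    and Y: "Y \<in> borel_measurable M" and K: "\<And>x. x \<in> space M \<Longrightarrow> \<bar>Y x\<bar> \<le> K"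
    and lim: "AE x in M. (\<lambda>n. Yn n x) \<longlonglongrightarrow> Y x"
  shows "(\<lambda>n. \<integral>x. \<bar>Yn n x - Y x\<bar> \<partial>M) \<longlonglongrightarrow> 0"
proof (rule LIMSEQ_I)
  fix e :: real assume e: "0 < e"
  note [measurable] = square_integrable_measurable[OF Yn] Y
  have Y2: "square_integrable M Y" by (rule square_integrable_bounded[OF Y K])
  have D2: "square_integrable M (\<lambda>x. Yn n x - Y x)" for n
    by (rule square_integrable_diff[OF Yn Y2])
  define c where "c = 2 * C + 2 * K\<^sup>2"
  have D2_le: "(\<integral>x. (Yn n x - Y x)\<^sup>2 \<partial>M) \<le> c" for n
  proof -
    have "(\<integral>x. (Yn n x - Y x)\<^sup>2 \<partial>M) \<le> (\<integral>x. 2 * (Yn n x)\<^sup>2 + 2 * K\<^sup>2 \<partial>M)"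
    proof (rule integral_mono)
      show "(Yn n x - Y x)\<^sup>2 \<le> 2 * (Yn n x)\<^sup>2 + 2 * K\<^sup>2" if "x \<in> space M" for x
      proof -
        have "(Y x)\<^sup>2 \<le> K\<^sup>2" using K[OF that] by (simp add: abs_le_square_iff[symmetric])
        then show ?thesis using sum_squares_bound[of "Yn n x" "- Y x"] by (simp add: power2_diff)
      qed
    qed (use D2 Yn in \<open>auto simp: square_integrable_def\<close>)
    also have "\<dots> \<le> c"
      using Yn[of n] C[of n] by (simp add: square_integrable_def c_def prob_space)
    finally show ?thesis .
  qed
  have c0: "0 \<le> c" by (rule order_trans[OF Bochner_Integration.integral_nonneg D2_le[of 0]]) simp
  \<comment> \<open>\<open>c\<close> bounds the second moments of the differences; this level makes
    \<open>c / R\<close> less than \<open>e / 2\<close>, and the summand \<open>1\<close> keeps it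
    positive when \<open>c = 0\<close>.\<close>
  define R where "R = 2 * c / e + 1"
  have R: "0 < R" "c / R < e / 2" using c0 e by (auto simp: R_def field_simps intro: add_nonneg_pos)
  have "(\<lambda>n. \<integral>x. min \<bar>Yn n x - Y x\<bar> R \<partial>M) \<longlonglongrightarrow> (\<integral>x. 0 \<partial>M)"
  proof (rule integral_dominated_convergence[where w = "\<lambda>_. R"])
    show "AE x in M. (\<lambda>n. min \<bar>Yn n x - Y x\<bar> R) \<longlonglongrightarrow> 0"
      using lim
    proof eventually_elim
      case (elim x)
      have "(\<lambda>n. min \<bar>Yn n x - Y x\<bar> R) \<longlonglongrightarrow> min \<bar>Y x - Y x\<bar> R"
        by (intro tendsto_intros elim)
      then show ?case using R by simp
    qed
    show "AE x in M. norm (min \<bar>Yn i x - Y x\<bar> R) \<le> R" for i using R by auto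
  qed (use R in auto)
  then obtain N where N: "\<And>n. n \<ge> N \<Longrightarrow> \<bar>\<integral>x. min \<bar>Yn n x - Y x\<bar> R \<partial>M\<bar> < e / 2"
    using LIMSEQ_D[of _ 0 "e/2"] e by fastforce
  show "\<exists>no. \<forall>n\<ge>no. norm ((\<integral>x. \<bar>Yn n x - Y x\<bar> \<partial>M) - 0) < e"
  proof (intro exI allI impI)
    fix n assume "N \<le> n"
    have i1: "integrable M (\<lambda>x. min \<bar>Yn n x - Y x\<bar> R)"
      by (rule Bochner_Integration.integrable_bound[of _ "\<lambda>_. R"]) (use R in auto)
    have i2: "integrable M (\<lambda>x. (Yn n x - Y x)\<^sup>2)" using D2 by (simp add: square_integrable_def)
    have "(\<integral>x. \<bar>Yn n x - Y x\<bar> \<partial>M) \<le> (\<integral>x. min \<bar>Yn n x - Y x\<bar> R + (Yn n x - Y x)\<^sup>2 / R \<partial>M)"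
    proof (rule integral_mono)
      show "integrable M (\<lambda>x. \<bar>Yn n x - Y x\<bar>)"
        using square_integrable_integrable[OF D2] by auto
      show "\<bar>Yn n x - Y x\<bar> \<le> min \<bar>Yn n x - Y x\<bar> R + (Yn n x - Y x)\<^sup>2 / R" for x
      proof (cases "\<bar>Yn n x - Y x\<bar> \<le> R")
        case False
        then have "\<bar>Yn n x - Y x\<bar> * R \<le> (Yn n x - Y x)\<^sup>2"
          using mult_left_mono[of R "\<bar>Yn n x - Y x\<bar>" "\<bar>Yn n x - Y x\<bar>"]
          by (simp add: power2_eq_square abs_mult_self_eq)
        then have "\<bar>Yn n x - Y x\<bar> \<le> (Yn n x - Y x)\<^sup>2 / R" using R by (simp add: pos_le_divide_eq)
        then show ?thesis using R False by simp
      qed (use R in simp)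
    qed (use i1 i2 in auto)
    also have "\<dots> = (\<integral>x. min \<bar>Yn n x - Y x\<bar> R \<partial>M) + (\<integral>x. (Yn n x - Y x)\<^sup>2 \<partial>M) / R"
      using i1 i2 by simp
    also have "\<dots> < e / 2 + e / 2"
    proof (rule add_strict_mono)
      show "(\<integral>x. min \<bar>Yn n x - Y x\<bar> R \<partial>M) < e / 2" using N[OF \<open>N \<le> n\<close>] by simp
      show "(\<integral>x. (Yn n x - Y x)\<^sup>2 \<partial>M) / R < e / 2"
        by (rule order.strict_trans1[OF divide_right_mono[OF D2_le less_imp_le[OF R(1)]] R(2)])
    qed
    finally show "norm ((\<integral>x. \<bar>Yn n x - Y x\<bar> \<partial>M) - 0) < e"
      using integral_nonneg_AE[of "\<lambda>x. \<bar>Yn n x - Y x\<bar>" M] by simp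
  qed
qed

end

context usual_filtration
begin

text \<open>The martingale property in dual form, without conditional expectations: increments after
  \<open>s\<close> are orthogonal to the square-integrable \<open>F s\<close>-measurable variables.
  The test variables include past increments of \<open>N\<close> itself, so Pythagoras
  applies.\<close>

definition l2_martingale :: "(real \<Rightarrow> 'w \<Rightarrow> real) \<Rightarrow> bool" where
  "l2_martingale N \<longleftrightarrow>
     (\<forall>t\<ge>0. N t \<in> borel_measurable (F t) \<and> square_integrable M (N t)) \<and>
     (\<forall>s t z. 0 \<le> s \<longrightarrow> s \<le> t \<longrightarrow> z \<in> borel_measurable (F s) \<longrightarrow> square_integrable M z \<longrightarrow>
        (\<integral>\<omega>. z \<omega> * (N t \<omega> - N s \<omega>) \<partial>M) = 0)"

lemma l2_martingaleD:
  assumes "l2_martingale N"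
  shows "0 \<le> t \<Longrightarrow> N t \<in> borel_measurable (F t)" "0 \<le> t \<Longrightarrow> square_integrable M (N t)"
    "0 \<le> s \<Longrightarrow> s \<le> t \<Longrightarrow> z \<in> borel_measurable (F s) \<Longrightarrow> square_integrable M z \<Longrightarrow>
        (\<integral>\<omega>. z \<omega> * (N t \<omega> - N s \<omega>) \<partial>M) = 0"
  using assms unfolding l2_martingale_def by blast+

text \<open>A discrete martingale transform. On an increasing grid it telescopes to the increment of
  \<open>N\<close> from \<open>g 0\<close> to the first grid point that is not before
  \<open>\<rho>\<close>, or to \<open>g k\<close> if there is none.\<close>

definition stopped_sum :: "(real \<Rightarrow> 'w \<Rightarrow> real) \<Rightarrow> ('w \<Rightarrow> real) \<Rightarrow> (nat \<Rightarrow> real) \<Rightarrow> nat \<Rightarrow> 'w \<Rightarrow> real" where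
  "stopped_sum N \<rho> g k \<omega> =
     (\<Sum>i<k. indicator {\<omega>. g i < \<rho> \<omega>} \<omega> * (N (g (Suc i)) \<omega> - N (g i) \<omega>))"

text \<open>Increments are orthogonal, so second moments add, and an indicator can only shrink its
  own term. The bound does not depend on the interior grid points, which is what refining the grid
  requires.\<close>

lemma stopped_sum_L2:
  assumes N: "l2_martingale N" and \<rho>: "bounded_stopping T \<rho>" and g: "incseq g" "0 \<le> g 0"
  shows "stopped_sum N \<rho> g k \<in> borel_measurable (F (g k)) \<and> square_integrable M (stopped_sum N \<rho> g k) \<and>
    (\<integral>\<omega>. (stopped_sum N \<rho> g k \<omega>)\<^sup>2 \<partial>M) \<le> (\<integral>\<omega>. (N (g k) \<omega> - N (g 0) \<omega>)\<^sup>2 \<partial>M)"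
proof (induction k)
  case 0
  then show ?case by (simp add: stopped_sum_def[abs_def] square_integrable_def)
next
  case (Suc k)
  have g0: "0 \<le> g i" for i using g by (metis incseq_def le0 order_trans)
  have gS: "g k \<le> g (Suc k)" "g 0 \<le> g k" using g(1) by (auto simp: incseq_def)
  let ?Y = "stopped_sum N \<rho> g k" and ?ind = "\<lambda>\<omega>. indicator {\<omega>. g k < \<rho> \<omega>} \<omega> :: real"
  let ?d = "\<lambda>\<omega>. N (g (Suc k)) \<omega> - N (g k) \<omega>"
  have eq: "stopped_sum N \<rho> g (Suc k) = (\<lambda>\<omega>. ?Y \<omega> + ?ind \<omega> * ?d \<omega>)"
    by (auto simp: stopped_sum_def fun_eq_iff)
  have ind: "?ind \<in> borel_measurable (F (g k))" by (rule indicator_stopping[OF \<rho> g0])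
  have ind': "?ind \<in> borel_measurable (F (g (Suc k)))" by (rule measurable_F_mono[OF g0 gS(1) ind])
  have Y: "?Y \<in> borel_measurable (F (g k))" "square_integrable M ?Y" using Suc by auto
  have Y': "?Y \<in> borel_measurable (F (g (Suc k)))" by (rule measurable_F_mono[OF g0 gS(1) Y(1)])
  have Nk: "N (g k) \<in> borel_measurable (F (g k))" "N (g (Suc k)) \<in> borel_measurable (F (g (Suc k)))"
      "N (g 0) \<in> borel_measurable (F (g 0))"
    using l2_martingaleD(1)[OF N g0] by auto
  have Nk': "N (g k) \<in> borel_measurable (F (g (Suc k)))" by (rule measurable_F_mono[OF g0 gS(1) Nk(1)])
  have N0: "N (g 0) \<in> borel_measurable (F (g k))" by (rule measurable_F_mono[OF g0 gS(2) Nk(3)])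
  have L2: "square_integrable M (N (g i))" for i by (rule l2_martingaleD(2)[OF N g0])
  have d2: "square_integrable M ?d" by (rule square_integrable_diff[OF L2 L2])
  have indM: "?ind \<in> borel_measurable M" by (rule measurable_F_M[OF g0 ind])
  have id2: "square_integrable M (\<lambda>\<omega>. ?ind \<omega> * ?d \<omega>)"
    by (rule square_integrable_mult_bounded[OF d2 indM, where B = 1]) (simp add: indicator_def)
  have m: "stopped_sum N \<rho> g (Suc k) \<in> borel_measurable (F (g (Suc k)))"
    unfolding eq using Y' ind' Nk(2) Nk' by measurable
  have sq: "square_integrable M (stopped_sum N \<rho> g (Suc k))"
    unfolding eq by (rule square_integrable_add[OF Y(2) id2])
  have iY: "square_integrable M (\<lambda>\<omega>. ?ind \<omega> * ?Y \<omega>)"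
    by (rule square_integrable_mult_bounded[OF Y(2) indM, where B = 1]) (simp add: indicator_def)
  have cross1: "(\<integral>\<omega>. (?ind \<omega> * ?Y \<omega>) * ?d \<omega> \<partial>M) = 0"
    by (intro l2_martingaleD(3)[OF N g0 gS(1)] iY borel_measurable_times ind Y(1))
  have cross2: "(\<integral>\<omega>. (N (g k) \<omega> - N (g 0) \<omega>) * ?d \<omega> \<partial>M) = 0"
    using Nk N0 by (intro l2_martingaleD(3)[OF N g0 gS(1)] square_integrable_diff[OF L2 L2]) measurable
  note [simp] = square_integrable_mult[OF iY d2] square_integrable_mult[OF square_integrable_diff[OF L2 L2] d2]
  have iY2: "integrable M (\<lambda>\<omega>. (?Y \<omega>)\<^sup>2)" "integrable M (\<lambda>\<omega>. (?ind \<omega> * ?d \<omega>)\<^sup>2)"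
      "integrable M (\<lambda>\<omega>. (?d \<omega>)\<^sup>2)" "integrable M (\<lambda>\<omega>. (N (g k) \<omega> - N (g 0) \<omega>)\<^sup>2)"
    using Y(2) id2 d2 square_integrable_diff[OF L2 L2] by (auto simp: square_integrable_def)
  have "(\<integral>\<omega>. (stopped_sum N \<rho> g (Suc k) \<omega>)\<^sup>2 \<partial>M)
      = (\<integral>\<omega>. (?Y \<omega>)\<^sup>2 + (?ind \<omega> * ?d \<omega>)\<^sup>2 + 2 * ((?ind \<omega> * ?Y \<omega>) * ?d \<omega>) \<partial>M)"
    unfolding eq by (rule Bochner_Integration.integral_cong) (simp_all add: power2_eq_square algebra_simps)
  also have "\<dots> = (\<integral>\<omega>. (?Y \<omega>)\<^sup>2 \<partial>M) + (\<integral>\<omega>. (?ind \<omega> * ?d \<omega>)\<^sup>2 \<partial>M)"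
    using iY2 square_integrable_mult[OF iY d2] by (subst Bochner_Integration.integral_add) (auto simp: cross1)
  also have "\<dots> \<le> (\<integral>\<omega>. (N (g k) \<omega> - N (g 0) \<omega>)\<^sup>2 \<partial>M) + (\<integral>\<omega>. (?d \<omega>)\<^sup>2 \<partial>M)"
  proof (rule add_mono)
    show "(\<integral>\<omega>. (?ind \<omega> * ?d \<omega>)\<^sup>2 \<partial>M) \<le> (\<integral>\<omega>. (?d \<omega>)\<^sup>2 \<partial>M)"
      by (rule integral_mono[OF iY2(2,3)]) (simp add: indicator_def)
  qed (use Suc in simp)
  also have "\<dots> = (\<integral>\<omega>. (N (g k) \<omega> - N (g 0) \<omega>)\<^sup>2 + (?d \<omega>)\<^sup>2 + 2 * ((N (g k) \<omega> - N (g 0) \<omega>) * ?d \<omega>) \<partial>M)"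
    using iY2 square_integrable_mult[OF square_integrable_diff[OF L2 L2] d2]
    by (subst Bochner_Integration.integral_add) (auto simp: cross2)
  also have "\<dots> = (\<integral>\<omega>. (N (g (Suc k)) \<omega> - N (g 0) \<omega>)\<^sup>2 \<partial>M)"
    by (rule Bochner_Integration.integral_cong) (auto simp: power2_eq_square algebra_simps)
  finally show ?case using m sq by blast
qed

text \<open>Whether \<open>g i < \<rho>\<close> is known at time \<open>g i\<close>, so each
  indicator can be absorbed into the test variable of the martingale property.\<close>

lemma stopped_sum_centered:
  assumes N: "l2_martingale N" and \<rho>: "bounded_stopping T \<rho>" and g: "incseq g" "0 \<le> g 0"
    and z: "z \<in> borel_measurable (F (g 0))" and B: "\<And>\<omega>. \<omega> \<in> space M \<Longrightarrow> \<bar>z \<omega>\<bar> \<le> B"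
  shows "(\<integral>\<omega>. z \<omega> * stopped_sum N \<rho> g k \<omega> \<partial>M) = 0"
proof -
  have g0: "0 \<le> g i" for i using g by (metis incseq_def le0 order_trans)
  have gS: "g i \<le> g (Suc i)" "g 0 \<le> g i" for i using g(1) by (auto simp: incseq_def)
  have zi: "(\<lambda>\<omega>. indicator {\<omega>. g i < \<rho> \<omega>} \<omega> * z \<omega>) \<in> borel_measurable (F (g i))" for i
    by (intro borel_measurable_times indicator_stopping[OF \<rho> g0] measurable_F_mono[OF g(2) gS(2) z])
  have zi2: "square_integrable M (\<lambda>\<omega>. indicator {\<omega>. g i < \<rho> \<omega>} \<omega> * z \<omega>)" for i
    using measurable_F_M[OF g0 zi] B
    by (intro square_integrable_bounded[where B = "\<bar>B\<bar>"]) (force simp: indicator_def)+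
  have L2: "square_integrable M (N (g i))" for i by (rule l2_martingaleD(2)[OF N g0])
  have "(\<integral>\<omega>. z \<omega> * stopped_sum N \<rho> g k \<omega> \<partial>M)
    = (\<integral>\<omega>. (\<Sum>i<k. (indicator {\<omega>. g i < \<rho> \<omega>} \<omega> * z \<omega>) * (N (g (Suc i)) \<omega> - N (g i) \<omega>)) \<partial>M)"
    by (simp add: stopped_sum_def sum_distrib_left algebra_simps)
  also have "\<dots> = (\<Sum>i<k. \<integral>\<omega>. (indicator {\<omega>. g i < \<rho> \<omega>} \<omega> * z \<omega>) * (N (g (Suc i)) \<omega> - N (g i) \<omega>) \<partial>M)"
    by (intro Bochner_Integration.integral_sum square_integrable_mult[OF zi2] square_integrable_diff[OF L2 L2])
  also have "\<dots> = 0"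
    by (intro sum.neutral ballI l2_martingaleD(3)[OF N g0 gS(1) zi zi2])
  finally show ?thesis .
qed

lemma stopped_sum_limit:
  assumes s: "0 \<le> s" "s < T" and cont: "continuous_on {0..T} (\<lambda>u. N u \<omega>)" and \<rho>: "\<rho> \<omega> \<le> T"
  shows "(\<lambda>k. stopped_sum N \<rho> (\<lambda>i. s + (T - s) * (real i / real (Suc k))) (Suc k) \<omega>)
    \<longlonglongrightarrow> indicator {\<omega>. s < \<rho> \<omega>} \<omega> * (N (\<rho> \<omega>) \<omega> - N s \<omega>)"
proof -
  \<comment> \<open>\<open>x\<close> is the position of \<open>\<rho>\<close> in
    \<open>[s, T]\<close> rescaled to the unit interval, and \<open>j k\<close> is the index of the
    first point of the grid with \<open>k + 1\<close> steps that is not before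
    \<open>\<rho>\<close>; \<open>nat\<close> turns it into \<open>0\<close> when
    \<open>\<rho> \<le> s\<close>.\<close>
  define x where "x = (\<rho> \<omega> - s) / (T - s)"
  define j where "j k = nat \<lceil>x * real (Suc k)\<rceil>" for k
  have x1: "x \<le> 1" using s \<rho> by (simp add: x_def)
  have iff: "s + (T - s) * (real i / real (Suc k)) < \<rho> \<omega> \<longleftrightarrow> i < j k" for i k
  proof -
    have "s + (T - s) * (real i / real (Suc k)) < \<rho> \<omega> \<longleftrightarrow> real i / real (Suc k) < x"
      using s by (simp add: x_def pos_less_divide_eq algebra_simps)
    also have "\<dots> \<longleftrightarrow> real i < x * real (Suc k)" by (simp add: pos_divide_less_eq)
    also have "\<dots> \<longleftrightarrow> int i < \<lceil>x * real (Suc k)\<rceil>" by linarith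
    also have "\<dots> \<longleftrightarrow> i < j k" unfolding j_def by linarith
    finally show ?thesis .
  qed
  have jk: "j k \<le> Suc k" for k
  proof -
    have "x * real (Suc k) \<le> real (Suc k)" using x1 mult_right_mono[OF x1, of "real (Suc k)"] by simp
    then show ?thesis unfolding j_def by linarith
  qed
  have sum_eq: "stopped_sum N \<rho> (\<lambda>i. s + (T - s) * (real i / real (Suc k))) (Suc k) \<omega>
      = N (s + (T - s) * (real (j k) / real (Suc k))) \<omega> - N s \<omega>" (is "?l k = _") for k
  proof -
    let ?g = "\<lambda>i. s + (T - s) * (real i / real (Suc k))"
    have "?l k = (\<Sum>i<Suc k. if i < j k then N (?g (Suc i)) \<omega> - N (?g i) \<omega> else 0)"
      unfolding stopped_sum_def by (intro sum.cong refl) (simp only: indicator_def mem_Collect_eq iff, simp)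
    also have "\<dots> = (\<Sum>i<j k. N (?g (Suc i)) \<omega> - N (?g i) \<omega>)"
      using jk[of k] by (intro sum.mono_neutral_cong_right) auto
    also have "\<dots> = N (?g (j k)) \<omega> - N (?g 0) \<omega>"
      using sum_lessThan_telescope[of "\<lambda>i. N (?g i) \<omega>" "j k"] by simp
    finally show ?thesis by simp
  qed
  show ?thesis
  proof (cases "s < \<rho> \<omega>")
    case False
    then have "j k = 0" for k using s by (simp add: j_def x_def mult_nonpos_nonneg divide_nonpos_pos)
    then show ?thesis using False unfolding sum_eq by simp
  next
    case True
    then have x0: "0 < x" using s by (simp add: x_def)
    have lim: "(\<lambda>k. real (j k) / real (Suc k)) \<longlonglongrightarrow> x"
    proof (rule real_tendsto_sandwich)
      have jr: "x * real (Suc k) \<le> real (j k)" "real (j k) \<le> x * real (Suc k) + 1" for k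
        using mult_pos_pos[OF x0, of "real (Suc k)"] unfolding j_def by linarith+
      show "\<forall>\<^sub>F k in sequentially. x \<le> real (j k) / real (Suc k)"
        using jr by (intro always_eventually allI) (simp add: pos_le_divide_eq)
      show "\<forall>\<^sub>F k in sequentially. real (j k) / real (Suc k) \<le> x + 1 / real (Suc k)"
      proof (intro always_eventually allI)
        fix k
        have "real (j k) / real (Suc k) \<le> (x * real (Suc k) + 1) / real (Suc k)"
          using jr(2)[of k] by (rule divide_right_mono) simp
        then show "real (j k) / real (Suc k) \<le> x + 1 / real (Suc k)"
          by (simp add: add_divide_distrib del: of_nat_Suc)
      qed
      have "(\<lambda>k. x + 1 / real (Suc k)) \<longlonglongrightarrow> x + 0"
        by (intro tendsto_add tendsto_const) (use LIMSEQ_inverse_real_of_nat in \<open>simp add: inverse_eq_divide\<close>)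
      then show "(\<lambda>k. x + 1 / real (Suc k)) \<longlonglongrightarrow> x" by simp
    qed simp
    have "(\<lambda>k. s + (T - s) * (real (j k) / real (Suc k))) \<longlonglongrightarrow> s + (T - s) * x"
      by (intro tendsto_intros lim)
    moreover have "s + (T - s) * x = \<rho> \<omega>" using s by (simp add: x_def)
    ultimately have lim': "(\<lambda>k. s + (T - s) * (real (j k) / real (Suc k))) \<longlonglongrightarrow> \<rho> \<omega>" by simp
    have inT: "s + (T - s) * (real (j k) / real (Suc k)) \<in> {0..T}" for k
    proof -
      have "real (j k) / real (Suc k) \<le> 1" using jk[of k] by (simp add: pos_divide_le_eq)
      then have "(T - s) * (real (j k) / real (Suc k)) \<le> (T - s) * 1" using s by (intro mult_left_mono) auto
      then show ?thesis using s by (auto intro!: add_nonneg_nonneg)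
    qed
    have "(\<lambda>k. N (s + (T - s) * (real (j k) / real (Suc k))) \<omega>) \<longlonglongrightarrow> N (\<rho> \<omega>) \<omega>"
      using continuous_on_tendsto_compose[OF cont lim'] inT True \<rho> s
      by (auto simp del: of_nat_Suc)
    then show ?thesis using True unfolding sum_eq by (auto intro!: tendsto_intros)
  qed
qed

text \<open>The discrete identity on finer and finer grids of \<open>[s, T]\<close>; the
  grid-independent \<open>L2\<close> bound and the boundedness of \<open>N\<close> up to
  \<open>\<rho>\<close> give \<open>L1\<close> convergence. The bound on \<open>N\<close> is
  required only where \<open>0 < \<rho>\<close>: a path that starts outside the bounded region is
  stopped at once, at an uncontrolled initial value.\<close>

lemma optional_stopping_bounded:
  assumes N: "l2_martingale N" and cont: "AE \<omega> in M. continuous_on {0..T} (\<lambda>u. N u \<omega>)"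
    and \<rho>: "bounded_stopping T \<rho>"
    and K: "AE \<omega> in M. 0 < \<rho> \<omega> \<longrightarrow> (\<forall>u\<in>{0..\<rho> \<omega>}. \<bar>N u \<omega>\<bar> \<le> K)"
    and s: "0 \<le> s" and z: "z \<in> borel_measurable (F s)" and B: "\<And>\<omega>. \<omega> \<in> space M \<Longrightarrow> \<bar>z \<omega>\<bar> \<le> B"
  shows "(\<lambda>\<omega>. indicator {\<omega>. s < \<rho> \<omega>} \<omega> * (N (\<rho> \<omega>) \<omega> - N s \<omega>)) \<in> borel_measurable M" (is "?Y \<in> _")
    and "(\<integral>\<omega>. z \<omega> * (indicator {\<omega>. s < \<rho> \<omega>} \<omega> * (N (\<rho> \<omega>) \<omega> - N s \<omega>)) \<partial>M) = 0"
proof -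
  have "?Y \<in> borel_measurable M \<and> (\<integral>\<omega>. z \<omega> * ?Y \<omega> \<partial>M) = 0"
  proof (cases "s < T")
    case False
    have Y0: "?Y \<omega> = 0" if "\<omega> \<in> space M" for \<omega>
      using False bounded_stopping_bounds(2)[OF \<rho> that] by (simp add: indicator_def)
    have "?Y \<in> borel_measurable M \<longleftrightarrow> (\<lambda>_. 0::real) \<in> borel_measurable M"
      by (rule measurable_cong) (rule Y0)
    moreover have "(\<integral>\<omega>. z \<omega> * ?Y \<omega> \<partial>M) = (\<integral>\<omega>. 0 \<partial>M)"
      by (rule Bochner_Integration.integral_cong) (simp_all only: Y0 mult_zero_right)
    ultimately show ?thesis by simp
  next
    case sT: True
    define g where "g k i = s + (T - s) * (real i / real (Suc k))" for k i
    define Yn where "Yn k = stopped_sum N \<rho> (g k) (Suc k)" for k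
    have g: "incseq (g k)" "0 \<le> g k 0" "g k 0 = s" "g k (Suc k) = T" for k
    proof -
      show "incseq (g k)" unfolding g_def incseq_def using sT
        by (auto intro!: mult_left_mono divide_right_mono)
    qed (use s sT in \<open>simp_all add: g_def\<close>)
    have Yn: "square_integrable M (Yn k)" "(\<integral>\<omega>. (Yn k \<omega>)\<^sup>2 \<partial>M) \<le> (\<integral>\<omega>. (N T \<omega> - N s \<omega>)\<^sup>2 \<partial>M)" for k
      using stopped_sum_L2[OF N \<rho> g(1,2), of k "Suc k"] by (simp_all add: Yn_def g)
    note [measurable] = square_integrable_measurable[OF Yn(1)]
    have zM[measurable]: "z \<in> borel_measurable M" by (rule measurable_F_M[OF s z])
    have lim: "AE \<omega> in M. (\<lambda>k. Yn k \<omega>) \<longlonglongrightarrow> ?Y \<omega>"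
      using cont AE_space[of M]
    proof eventually_elim
      case (elim \<omega>)
      then show ?case unfolding Yn_def g_def
        by (rule_tac stopped_sum_limit[OF s sT]) (auto intro: bounded_stopping_bounds(2)[OF \<rho>])
    qed
    \<comment> \<open>\<open>?Y\<close> evaluates \<open>N\<close> at a random time; it is
      measurable because it agrees almost surely with a limit of measurable functions and the space
      is complete.\<close>
    have "AE \<omega> in M. lim (\<lambda>k. Yn k \<omega>) = ?Y \<omega>"
      using lim by eventually_elim (rule limI)
    then have Ym[measurable]: "?Y \<in> borel_measurable M"
      by (rule measurable_M_AE[rotated]) measurable
    have YK: "AE \<omega> in M. \<bar>?Y \<omega>\<bar> \<le> 2 * \<bar>K\<bar>"
      using K AE_space[of M]
    proof eventually_elim
      case (elim \<omega>)
      show ?case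
      proof (cases "s < \<rho> \<omega>")
        case True
        then have "\<bar>N (\<rho> \<omega>) \<omega>\<bar> \<le> K" "\<bar>N s \<omega>\<bar> \<le> K" using elim s by auto
        then show ?thesis using True by simp
      qed simp
    qed
    \<comment> \<open>Clipping turns the almost sure bound on \<open>?Y\<close> into one at every
      outcome, the form in which \<open>L1_convergence_of_L2_bounded\<close> takes it.\<close>
    let ?Y' = "\<lambda>\<omega>. max (- (2 * \<bar>K\<bar>)) (min (2 * \<bar>K\<bar>) (?Y \<omega>))"
    have YY': "AE \<omega> in M. ?Y \<omega> = ?Y' \<omega>"
      using YK by eventually_elim auto
    have lim': "AE \<omega> in M. (\<lambda>k. Yn k \<omega>) \<longlonglongrightarrow> ?Y' \<omega>"
      using lim YY' by eventually_elim simp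
    have conv: "(\<lambda>k. \<integral>\<omega>. \<bar>Yn k \<omega> - ?Y' \<omega>\<bar> \<partial>M) \<longlonglongrightarrow> 0"
      by (rule L1_convergence_of_L2_bounded[OF Yn _ _ lim', where K = "2 * \<bar>K\<bar>"]) auto
    have iY': "integrable M ?Y'"
      by (rule Bochner_Integration.integrable_bound[of _ "\<lambda>_. 2 * \<bar>K\<bar>"]) auto
    have zint: "integrable M (\<lambda>\<omega>. z \<omega> * y \<omega>)" if "integrable M y" for y
      using that
      by (rule_tac Bochner_Integration.integrable_bound[of _ "\<lambda>\<omega>. B * y \<omega>"])
        (auto simp: abs_mult intro!: mult_right_mono AE_I2 order_trans[OF B])
    have zY: "(\<integral>\<omega>. z \<omega> * Yn k \<omega> \<partial>M) = 0" for k
      unfolding Yn_def using z by (intro stopped_sum_centered[OF N \<rho> g(1,2) _ B]) (auto simp: g)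
    have le: "\<bar>\<integral>\<omega>. z \<omega> * ?Y' \<omega> \<partial>M\<bar> \<le> \<bar>B\<bar> * (\<integral>\<omega>. \<bar>Yn k \<omega> - ?Y' \<omega>\<bar> \<partial>M)" for k
    proof -
      have iD: "integrable M (\<lambda>\<omega>. Yn k \<omega> - ?Y' \<omega>)"
        using square_integrable_integrable[OF Yn(1)] iY' by auto
      have "(\<integral>\<omega>. z \<omega> * ?Y' \<omega> \<partial>M) = - (\<integral>\<omega>. z \<omega> * (Yn k \<omega> - ?Y' \<omega>) \<partial>M)"
        using zY[of k] zint[OF square_integrable_integrable[OF Yn(1)[of k]]] zint[OF iY']
        by (simp add: right_diff_distrib)
      then have "\<bar>\<integral>\<omega>. z \<omega> * ?Y' \<omega> \<partial>M\<bar> \<le> (\<integral>\<omega>. \<bar>z \<omega> * (Yn k \<omega> - ?Y' \<omega>)\<bar> \<partial>M)"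
        by (simp add: integral_abs_bound)
      also have "\<dots> \<le> (\<integral>\<omega>. \<bar>B\<bar> * \<bar>Yn k \<omega> - ?Y' \<omega>\<bar> \<partial>M)"
      proof (rule integral_mono[OF integrable_abs[OF zint[OF iD]]])
        show "integrable M (\<lambda>\<omega>. \<bar>B\<bar> * \<bar>Yn k \<omega> - ?Y' \<omega>\<bar>)"
          by (rule integrable_mult_right[OF integrable_abs[OF iD]])
        show "\<bar>z \<omega> * (Yn k \<omega> - ?Y' \<omega>)\<bar> \<le> \<bar>B\<bar> * \<bar>Yn k \<omega> - ?Y' \<omega>\<bar>" if "\<omega> \<in> space M" for \<omega>
          unfolding abs_mult using B[OF that] by (intro mult_right_mono) auto
      qed
      finally show ?thesis by simp
    qed
    have "\<bar>\<integral>\<omega>. z \<omega> * ?Y' \<omega> \<partial>M\<bar> \<le> 0"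
      by (rule LIMSEQ_le_const[OF tendsto_mult_right_zero[OF conv, of "\<bar>B\<bar>"]]) (use le in blast)
    moreover have "(\<integral>\<omega>. z \<omega> * ?Y \<omega> \<partial>M) = (\<integral>\<omega>. z \<omega> * ?Y' \<omega> \<partial>M)"
    proof (rule integral_cong_AE)
      show "AE \<omega> in M. z \<omega> * ?Y \<omega> = z \<omega> * ?Y' \<omega>"
        using YY' by eventually_elim (erule arg_cong)
    qed measurable
    ultimately show ?thesis using Ym by simp
  qed
  then show "?Y \<in> borel_measurable M" "(\<integral>\<omega>. z \<omega> * ?Y \<omega> \<partial>M) = 0" by auto
qed


section \<open>Martingales up to a stopping time\<close>

text \<open>\<open>N\<close> is a martingale up to \<open>\<rho>\<close>, tested only at the terminal time \<open>\<rho>\<close>.\<close>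

definition stopped_centered :: "('w \<Rightarrow> real) \<Rightarrow> (real \<Rightarrow> 'w \<Rightarrow> real) \<Rightarrow> bool" where
  "stopped_centered \<rho> N \<longleftrightarrow>
     (\<forall>s z B. 0 \<le> s \<longrightarrow> z \<in> borel_measurable (F s) \<longrightarrow> (\<forall>\<omega>\<in>space M. s < \<rho> \<omega> \<longrightarrow> \<bar>z \<omega>\<bar> \<le> B) \<longrightarrow>
        (\<integral>\<omega>. z \<omega> * (indicator {\<omega>. s < \<rho> \<omega>} \<omega> * (N (\<rho> \<omega>) \<omega> - N s \<omega>)) \<partial>M) = 0)"

lemma stopped_centeredD:
  assumes "stopped_centered \<rho> N" "0 \<le> s" "z \<in> borel_measurable (F s)"
    and "\<And>\<omega>. \<omega> \<in> space M \<Longrightarrow> s < \<rho> \<omega> \<Longrightarrow> \<bar>z \<omega>\<bar> \<le> B"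
  shows "(\<integral>\<omega>. z \<omega> * (indicator {\<omega>. s < \<rho> \<omega>} \<omega> * (N (\<rho> \<omega>) \<omega> - N s \<omega>)) \<partial>M) = 0"
  using assms unfolding stopped_centered_def by blast

text \<open>The approximating martingales are stopped when they leave \<open>[-K - 1, K + 1]\<close>; by uniform
  convergence this eventually happens after \<open>\<rho>\<close>, and dominated convergence applies.\<close>

lemma stopped_centered_limit:
  assumes T: "0 \<le> T" and Mn: "\<And>n. l2_martingale (Mn n)"
    and cont: "\<And>n. AE \<omega> in M. continuous_on {0..T} (\<lambda>u. Mn n u \<omega>)"
    and lim: "AE \<omega> in M. uniform_limit {0..T} (\<lambda>n u. Mn n u \<omega>) (\<lambda>u. N u \<omega>) sequentially"
    and \<rho>: "bounded_stopping T \<rho>"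
    and K: "AE \<omega> in M. 0 < \<rho> \<omega> \<longrightarrow> (\<forall>u\<in>{0..\<rho> \<omega>}. \<bar>N u \<omega>\<bar> \<le> K)"
  shows "stopped_centered \<rho> N"
  unfolding stopped_centered_def
proof (intro allI impI)
  fix s :: real and z :: "'w \<Rightarrow> real" and B :: real
  assume s: "0 \<le> s" and z: "z \<in> borel_measurable (F s)"
    and B: "\<forall>\<omega>\<in>space M. s < \<rho> \<omega> \<longrightarrow> \<bar>z \<omega>\<bar> \<le> B"
  \<comment> \<open>\<open>z\<close> is bounded only where \<open>s < \<rho>\<close>; clipping
    changes it only elsewhere, and there the indicator vanishes.\<close>
  let ?z = "\<lambda>\<omega>. max (- \<bar>B\<bar>) (min \<bar>B\<bar> (z \<omega>))"
  let ?I = "\<lambda>\<rho> N \<omega>. indicator {\<omega>. s < \<rho> \<omega>} \<omega> * (N (\<rho> \<omega>) \<omega> - N s \<omega>) :: real"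
  have z': "?z \<in> borel_measurable (F s)" using z by measurable
  have zM[measurable]: "?z \<in> borel_measurable M" by (rule measurable_F_M[OF s z'])
  define \<tau> where "\<tau> n = hit T (\<lambda>u \<omega>. \<bar>K\<bar> + 1 - \<bar>Mn n u \<omega>\<bar>)" for n
  define \<rho>n where "\<rho>n n \<omega> = min (\<rho> \<omega>) (\<tau> n \<omega>)" for n \<omega>
  have cont\<tau>: "continuous_on {0..T} (\<lambda>u. \<bar>K\<bar> + 1 - \<bar>Mn n u \<omega>\<bar>)"
    if "continuous_on {0..T} (\<lambda>u. Mn n u \<omega>)" for n \<omega>
    by (intro continuous_intros that)
  have \<tau>: "bounded_stopping T (\<tau> n)" for n
    unfolding \<tau>_def
  proof (rule bounded_stopping_hit[OF T])
    show "(\<lambda>\<omega>. \<bar>K\<bar> + 1 - \<bar>Mn n u \<omega>\<bar>) \<in> borel_measurable (F u)" if "0 \<le> u" for u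
      using l2_martingaleD(1)[OF Mn that, of n] by measurable
    show "AE \<omega> in M. continuous_on {0..T} (\<lambda>u. \<bar>K\<bar> + 1 - \<bar>Mn n u \<omega>\<bar>)"
      using cont[of n] by eventually_elim (rule cont\<tau>)
  qed
  have \<rho>n: "bounded_stopping T (\<rho>n n)" for n
    unfolding \<rho>n_def by (rule bounded_stopping_min[OF \<rho> \<tau>])
  have bnd: "AE \<omega> in M. 0 < \<rho>n n \<omega> \<longrightarrow> (\<forall>u\<in>{0..\<rho>n n \<omega>}. \<bar>Mn n u \<omega>\<bar> \<le> \<bar>K\<bar> + 1)" for n
    using cont[of n] AE_space[of M]
  proof eventually_elim
    case (elim \<omega>)
    show ?case
    proof (intro impI ballI)
      fix u assume pos: "0 < \<rho>n n \<omega>" and u: "u \<in> {0..\<rho>n n \<omega>}"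
      \<comment> \<open>Strictly before \<open>\<rho>n\<close> the process is inside the interval;
        the bound reaches the end point by continuity. That \<open>[0, \<rho>n]\<close> is the
        closure of the half-open interval uses \<open>0 < \<rho>n\<close>.\<close>
      have clos: "closure {0..<\<rho>n n \<omega>} = {0..\<rho>n n \<omega>}" using pos by simp
      have "\<bar>Mn n r \<omega>\<bar> \<le> \<bar>K\<bar> + 1" if "r \<in> {0..<\<rho>n n \<omega>}" for r
      proof -
        have "r < hit T (\<lambda>u \<omega>. \<bar>K\<bar> + 1 - \<bar>Mn n u \<omega>\<bar>) \<omega>" using that by (simp add: \<rho>n_def \<tau>_def)
        moreover have r0: "0 \<le> r" using that by simp
        ultimately have "\<forall>r'\<in>{0..r}. 0 < \<bar>K\<bar> + 1 - \<bar>Mn n r' \<omega>\<bar>"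
          using less_hit_iff[where \<phi> = "\<lambda>u \<omega>. \<bar>K\<bar> + 1 - \<bar>Mn n u \<omega>\<bar>" and \<omega> = \<omega> and u = r,
              OF T cont\<tau>[OF elim(1)] r0] by blast
        then have "0 < \<bar>K\<bar> + 1 - \<bar>Mn n r \<omega>\<bar>" using r0 by simp
        then show ?thesis by simp
      qed
      moreover have "continuous_on (closure {0..<\<rho>n n \<omega>}) (\<lambda>u. \<bar>Mn n u \<omega>\<bar>)"
        unfolding clos using elim(1) bounded_stopping_bounds(2)[OF \<rho>n elim(2)]
        by (intro continuous_intros continuous_on_subset[OF elim(1)]) simp
      ultimately show "\<bar>Mn n u \<omega>\<bar> \<le> \<bar>K\<bar> + 1"
        using continuous_le_on_closure[of "{0..<\<rho>n n \<omega>}" "\<lambda>u. \<bar>Mn n u \<omega>\<bar>" u "\<bar>K\<bar> + 1"] u clos by auto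
    qed
  qed
  have zB: "\<bar>?z \<omega>\<bar> \<le> \<bar>B\<bar>" for \<omega> by auto
  note os = optional_stopping_bounded[OF Mn cont \<rho>n bnd s z' zB]
  note [measurable] = os(1)
  have cont_all: "AE \<omega> in M. \<forall>n. continuous_on {0..T} (\<lambda>u. Mn n u \<omega>)"
    using cont by (simp add: AE_all_countable)
  have I_conv: "AE \<omega> in M. (\<lambda>n. ?I (\<rho>n n) (Mn n) \<omega>) \<longlonglongrightarrow> ?I \<rho> N \<omega>"
    using lim K AE_space[of M] cont_all
  proof eventually_elim
    case (elim \<omega>)
    show ?case
    proof (cases "s < \<rho> \<omega>")
      case False
      then have "\<not> s < \<rho>n n \<omega>" for n by (simp add: \<rho>n_def)
      with False show ?thesis by simp
    next
      case True
      then have pos: "0 < \<rho> \<omega>" and \<rho>T: "\<rho> \<omega> \<le> T"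
        using s bounded_stopping_bounds(2)[OF \<rho> elim(3)] by auto
      have "\<forall>\<^sub>F n in sequentially. \<forall>u\<in>{0..T}. dist (Mn n u \<omega>) (N u \<omega>) < 1"
        using elim(1) by (rule uniform_limitD) simp
      then have "\<forall>\<^sub>F n in sequentially. \<rho>n n \<omega> = \<rho> \<omega>"
      proof eventually_elim
        case (elim n)
        note close = elim
        have c: "continuous_on {0..T} (\<lambda>u. Mn n u \<omega>)"
          using \<open>\<forall>n. continuous_on {0..T} (\<lambda>u. Mn n u \<omega>)\<close> by blast
        \<comment> \<open>At a hit before \<open>\<rho>\<close> the approximation has modulus at
          least \<open>|K| + 1\<close> while \<open>|N| \<le> K\<close>, contradicting a distance
          less than \<open>1\<close>. This is why the interval is widened by exactly the tolerance
          of the uniform approximation.\<close>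
        have "\<rho> \<omega> \<le> \<tau> n \<omega>"
        proof (rule ccontr)
          assume n: "\<not> \<rho> \<omega> \<le> \<tau> n \<omega>"
          then have le: "\<bar>K\<bar> + 1 - \<bar>Mn n (\<tau> n \<omega>) \<omega>\<bar> \<le> 0"
            using \<rho>T unfolding \<tau>_def by (intro hit_attained[where \<phi> = "\<lambda>u \<omega>. \<bar>K\<bar> + 1 - \<bar>Mn n u \<omega>\<bar>" and \<omega> = \<omega>, OF T cont\<tau>[OF c]]) auto
          have in1: "\<tau> n \<omega> \<in> {0..\<rho> \<omega>}" using n hit_bounds(1)[OF T] by (auto simp: \<tau>_def)
          then have "\<bar>N (\<tau> n \<omega>) \<omega>\<bar> \<le> K"
            using \<open>0 < \<rho> \<omega> \<longrightarrow> (\<forall>u\<in>{0..\<rho> \<omega>}. \<bar>N u \<omega>\<bar> \<le> K)\<close> pos by blast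
          moreover have "dist (Mn n (\<tau> n \<omega>) \<omega>) (N (\<tau> n \<omega>) \<omega>) < 1" using close in1 \<rho>T by auto
          ultimately show False using le by (auto simp: dist_real_def)
        qed
        then show ?case by (simp add: \<rho>n_def)
      qed
      then have ev: "\<forall>\<^sub>F n in sequentially. Mn n (\<rho> \<omega>) \<omega> - Mn n s \<omega> = ?I (\<rho>n n) (Mn n) \<omega>"
        by eventually_elim (use True in simp)
      have "(\<lambda>n. Mn n u \<omega>) \<longlonglongrightarrow> N u \<omega>" if "u \<in> {0..T}" for u
        using tendsto_uniform_limitI[OF elim(1) that] .
      then have "(\<lambda>n. Mn n (\<rho> \<omega>) \<omega> - Mn n s \<omega>) \<longlonglongrightarrow> N (\<rho> \<omega>) \<omega> - N s \<omega>"
        using True s \<rho>T by (intro tendsto_diff) auto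
      from Lim_transform_eventually[OF this ev] show ?thesis using True by simp
    qed
  qed
  have "AE \<omega> in M. lim (\<lambda>n. ?I (\<rho>n n) (Mn n) \<omega>) = ?I \<rho> N \<omega>"
    using I_conv by eventually_elim (rule limI)
  then have Im[measurable]: "?I \<rho> N \<in> borel_measurable M"
    by (rule measurable_M_AE[rotated]) measurable
  have "(\<lambda>n. \<integral>\<omega>. ?z \<omega> * ?I (\<rho>n n) (Mn n) \<omega> \<partial>M) \<longlonglongrightarrow> (\<integral>\<omega>. ?z \<omega> * ?I \<rho> N \<omega> \<partial>M)"
  proof (rule integral_dominated_convergence[where w = "\<lambda>_. \<bar>B\<bar> * (2 * (\<bar>K\<bar> + 1))"])
    show "AE \<omega> in M. (\<lambda>n. ?z \<omega> * ?I (\<rho>n n) (Mn n) \<omega>) \<longlonglongrightarrow> ?z \<omega> * ?I \<rho> N \<omega>"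
      using I_conv by eventually_elim (rule tendsto_mult[OF tendsto_const])
    show "AE \<omega> in M. norm (?z \<omega> * ?I (\<rho>n n) (Mn n) \<omega>) \<le> \<bar>B\<bar> * (2 * (\<bar>K\<bar> + 1))" for n
      using bnd[of n]
    proof eventually_elim
      case (elim \<omega>)
      have I_le: "\<bar>?I (\<rho>n n) (Mn n) \<omega>\<bar> \<le> 2 * (\<bar>K\<bar> + 1)"
      proof (cases "s < \<rho>n n \<omega>")
        case True
        then have "\<bar>Mn n (\<rho>n n \<omega>) \<omega>\<bar> \<le> \<bar>K\<bar> + 1" "\<bar>Mn n s \<omega>\<bar> \<le> \<bar>K\<bar> + 1" using elim s by auto
        then show ?thesis using True by simp
      qed simp
      have "\<bar>?z \<omega>\<bar> * \<bar>?I (\<rho>n n) (Mn n) \<omega>\<bar> \<le> \<bar>B\<bar> * (2 * (\<bar>K\<bar> + 1))"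
        by (rule mult_mono[OF zB I_le]) auto
      then show ?case by (simp only: real_norm_def abs_mult)
    qed
  qed (auto)
  then have "(\<integral>\<omega>. ?z \<omega> * ?I \<rho> N \<omega> \<partial>M) = 0"
    using os(2) by (simp add: LIMSEQ_const_iff)
  moreover have "(\<integral>\<omega>. z \<omega> * ?I \<rho> N \<omega> \<partial>M) = (\<integral>\<omega>. ?z \<omega> * ?I \<rho> N \<omega> \<partial>M)"
  proof (rule Bochner_Integration.integral_cong)
    fix \<omega> assume "\<omega> \<in> space M"
    then have "s < \<rho> \<omega> \<Longrightarrow> z \<omega> = ?z \<omega>" using B by fastforce
    then show "z \<omega> * ?I \<rho> N \<omega> = ?z \<omega> * ?I \<rho> N \<omega>" by (cases "s < \<rho> \<omega>") simp_all
  qed simp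
  ultimately show "(\<integral>\<omega>. z \<omega> * ?I \<rho> N \<omega> \<partial>M) = 0" by simp
qed

text \<open>Integration by parts in expectation: \<open>Z\<^sub>\<rho> N\<^sub>\<rho> - Z\<^sub>0 N\<^sub>0 - \<integral>\<^sub>0\<^sup>\<rho> z N = Z\<^sub>0 (N\<^sub>\<rho> - N\<^sub>0) + \<integral>\<^sub>0\<^sup>\<rho> z\<^sub>u (N\<^sub>\<rho> - N\<^sub>u) du\<close>,
  and by Fubini both terms on the right are centred.\<close>

lemma stopped_integration_by_parts:
  assumes T: "0 \<le> T" and \<rho>: "bounded_stopping T \<rho>" and N: "stopped_centered \<rho> N"
    and Nm: "\<And>u. 0 \<le> u \<Longrightarrow> N u \<in> borel_measurable M"
    and Nc: "\<And>\<omega>. \<omega> \<in> space M \<Longrightarrow> continuous_on {0..} (\<lambda>u. N u \<omega>)"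
    and zm: "\<And>u. 0 \<le> u \<Longrightarrow> z u \<in> borel_measurable (F u)"
    and zc: "\<And>\<omega>. \<omega> \<in> space M \<Longrightarrow> continuous_on {0..} (\<lambda>u. z u \<omega>)"
    and Z0: "Z 0 \<in> borel_measurable (F 0)"
    and Z: "\<And>\<omega>. \<omega> \<in> space M \<Longrightarrow> 0 < \<rho> \<omega> \<Longrightarrow> Z (\<rho> \<omega>) \<omega> = Z 0 \<omega> + integral {0..\<rho> \<omega>} (\<lambda>u. z u \<omega>)"
    and B: "\<And>\<omega> u. \<omega> \<in> space M \<Longrightarrow> 0 < \<rho> \<omega> \<Longrightarrow> u \<in> {0..\<rho> \<omega>} \<Longrightarrow> \<bar>z u \<omega>\<bar> \<le> B"
    and B0: "\<And>\<omega>. \<omega> \<in> space M \<Longrightarrow> 0 < \<rho> \<omega> \<Longrightarrow> \<bar>Z 0 \<omega>\<bar> \<le> B"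
    and K: "\<And>\<omega> u. \<omega> \<in> space M \<Longrightarrow> 0 < \<rho> \<omega> \<Longrightarrow> u \<in> {0..\<rho> \<omega>} \<Longrightarrow> \<bar>N u \<omega>\<bar> \<le> K"
  defines "R \<equiv> \<lambda>\<omega>. indicator {\<omega>. 0 < \<rho> \<omega>} \<omega> * (Z (\<rho> \<omega>) \<omega> * N (\<rho> \<omega>) \<omega> - Z 0 \<omega> * N 0 \<omega>
      - integral {0..\<rho> \<omega>} (\<lambda>u. z u \<omega> * N u \<omega>))"
  shows "integrable M R \<and> (\<integral>\<omega>. R \<omega> \<partial>M) = 0"
proof
  interpret P: pair_sigma_finite lborel M
    by (simp add: pair_sigma_finite_def sigma_finite_lborel sigma_finite_measure_axioms)
  have [measurable]: "\<rho> \<in> borel_measurable M" by (rule bounded_stopping_measurable[OF \<rho>])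
  have \<rho>0: "0 \<le> \<rho> \<omega>" "\<rho> \<omega> \<le> T" if "\<omega> \<in> space M" for \<omega>
    using bounded_stopping_bounds[OF \<rho> that] by auto
  have N\<rho>[measurable]: "(\<lambda>\<omega>. N (\<rho> \<omega>) \<omega>) \<in> borel_measurable M"
    by (rule measurable_process_at_time[OF Nm Nc]) (auto simp: \<rho>0)
  have [measurable]: "N 0 \<in> borel_measurable M" by (rule Nm) simp
  have [measurable]: "Z 0 \<in> borel_measurable M" by (rule measurable_F_M[OF _ Z0]) simp
  have Nj[measurable]: "(\<lambda>(u, \<omega>). N (max 0 u) \<omega>) \<in> borel_measurable (borel \<Otimes>\<^sub>M M)"
    by (rule measurable_continuous_process[OF Nm Nc])
  have zj[measurable]: "(\<lambda>(u, \<omega>). z (max 0 u) \<omega>) \<in> borel_measurable (borel \<Otimes>\<^sub>M M)"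
    by (rule measurable_continuous_process[OF measurable_F_M[OF _ zm] zc])
  \<comment> \<open>The integrand of the double integral, cut to
    \<open>0 \<le> u \<le> \<rho>\<close> and to outcomes with \<open>0 < \<rho>\<close>, where the
    bounds hold. The forms with \<open>max 0 u\<close> are those whose joint measurability is
    known.\<close>
  define G where "G u \<omega> = indicator {p. 0 < \<rho> (snd p) \<and> 0 \<le> fst p \<and> fst p \<le> \<rho> (snd p)} (u, \<omega>) *
      ((\<lambda>(u, \<omega>). z (max 0 u) \<omega>) (u, \<omega>) * (N (\<rho> \<omega>) \<omega> - (\<lambda>(u, \<omega>). N (max 0 u) \<omega>) (u, \<omega>)))" for u \<omega>
  have Gm[measurable]: "(\<lambda>(u, \<omega>). G u \<omega>) \<in> borel_measurable (lborel \<Otimes>\<^sub>M M)"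
    unfolding G_def split_beta' by measurable
  have G_le: "norm (G u \<omega>) \<le> \<bar>B\<bar> * (2 * \<bar>K\<bar>) * indicator {0..T} u" if w: "\<omega> \<in> space M" for u \<omega>
  proof (cases "0 < \<rho> \<omega> \<and> 0 \<le> u \<and> u \<le> \<rho> \<omega>")
    case True
    then have "\<bar>z u \<omega>\<bar> \<le> \<bar>B\<bar>" "\<bar>N u \<omega>\<bar> \<le> \<bar>K\<bar>" "\<bar>N (\<rho> \<omega>) \<omega>\<bar> \<le> \<bar>K\<bar>"
      using B[OF w, of u] K[OF w, of u] K[OF w, of "\<rho> \<omega>"] by auto
    then have "\<bar>z u \<omega>\<bar> * \<bar>N (\<rho> \<omega>) \<omega> - N u \<omega>\<bar> \<le> \<bar>B\<bar> * (2 * \<bar>K\<bar>)" by (intro mult_mono) auto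
    then show ?thesis using True \<rho>0[OF w] by (simp add: G_def abs_mult max_absorb2)
  qed (auto simp: G_def)
  have Gint: "integrable (lborel \<Otimes>\<^sub>M M) (\<lambda>(u, \<omega>). G u \<omega>)"
  proof (rule Bochner_Integration.integrable_bound)
    have "integrable (lborel \<Otimes>\<^sub>M M) (\<lambda>p. indicator ({0..T} \<times> space M) p :: real)"
      using T by (simp add: emeasure_pair_measure_Times emeasure_space_1 ennreal_mult_less_top)
    then show "integrable (lborel \<Otimes>\<^sub>M M) (\<lambda>p. \<bar>B\<bar> * (2 * \<bar>K\<bar>) * indicator ({0..T} \<times> space M) p)"
      by (rule integrable_mult_right)
    show "AE p in lborel \<Otimes>\<^sub>M M. norm (case p of (u, \<omega>) \<Rightarrow> G u \<omega>)
        \<le> norm (\<bar>B\<bar> * (2 * \<bar>K\<bar>) * indicator ({0..T} \<times> space M) p)"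
    proof (rule AE_I2)
      fix p :: "real \<times> 'w" assume "p \<in> space (lborel \<Otimes>\<^sub>M M)"
      then show "norm (case p of (u, \<omega>) \<Rightarrow> G u \<omega>) \<le> norm (\<bar>B\<bar> * (2 * \<bar>K\<bar>) * indicator ({0..T} \<times> space M) p)"
        using G_le[of "snd p" "fst p"]
        by (cases "fst p \<in> {0..T}") (auto simp: space_pair_measure split_beta')
    qed
  qed simp
  have Gu: "(\<integral>\<omega>. G u \<omega> \<partial>M) = 0" for u
  proof (cases "0 \<le> u")
    case u: True
    have "(\<integral>\<omega>. G u \<omega> \<partial>M) = (\<integral>\<omega>. z u \<omega> * (indicator {\<omega>. u < \<rho> \<omega>} \<omega> * (N (\<rho> \<omega>) \<omega> - N u \<omega>)) \<partial>M)"
    proof (rule Bochner_Integration.integral_cong)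
      fix \<omega>
      \<comment> \<open>The cut in \<open>G\<close> is \<open>u \<le> \<rho>\<close>, the indicator
        on the right is \<open>u < \<rho>\<close>; they differ only at \<open>u = \<rho>\<close>,
        where the increment of \<open>N\<close> is \<open>0\<close>.\<close>
      show "G u \<omega> = z u \<omega> * (indicator {\<omega>. u < \<rho> \<omega>} \<omega> * (N (\<rho> \<omega>) \<omega> - N u \<omega>))"
        using u by (cases "u = \<rho> \<omega>") (auto simp: G_def max_absorb2 indicator_def)
    qed simp
    also have "\<dots> = 0"
      using u B by (intro stopped_centeredD[OF N u zm[OF u], of B]) auto
    finally show ?thesis .
  qed (simp add: G_def)
  have G1: "integrable M (\<lambda>\<omega>. \<integral>u. G u \<omega> \<partial>lborel)" using P.integrable_snd[OF Gint] by simp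
  have G2: "(\<integral>\<omega>. (\<integral>u. G u \<omega> \<partial>lborel) \<partial>M) = 0"
    using P.Fubini_integral[OF Gint] by (simp add: Gu)
  let ?S = "\<lambda>\<omega>. Z 0 \<omega> * (indicator {\<omega>. 0 < \<rho> \<omega>} \<omega> * (N (\<rho> \<omega>) \<omega> - N 0 \<omega>))"
  have S2: "(\<integral>\<omega>. ?S \<omega> \<partial>M) = 0" by (rule stopped_centeredD[OF N order_refl Z0 B0])
  have S1: "integrable M ?S"
  proof (rule Bochner_Integration.integrable_bound[of _ "\<lambda>_. \<bar>B\<bar> * (2 * \<bar>K\<bar>)"])
    show "AE \<omega> in M. norm (?S \<omega>) \<le> norm (\<bar>B\<bar> * (2 * \<bar>K\<bar>))"
    proof (rule AE_I2)
      fix \<omega> assume w: "\<omega> \<in> space M"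
      show "norm (?S \<omega>) \<le> norm (\<bar>B\<bar> * (2 * \<bar>K\<bar>))"
      proof (cases "0 < \<rho> \<omega>")
        case True
        then have "\<bar>Z 0 \<omega>\<bar> \<le> \<bar>B\<bar>" "\<bar>N 0 \<omega>\<bar> \<le> \<bar>K\<bar>" "\<bar>N (\<rho> \<omega>) \<omega>\<bar> \<le> \<bar>K\<bar>"
          using B0[OF w] K[OF w, of 0] K[OF w, of "\<rho> \<omega>"] by auto
        then have "\<bar>Z 0 \<omega>\<bar> * \<bar>N (\<rho> \<omega>) \<omega> - N 0 \<omega>\<bar> \<le> \<bar>B\<bar> * (2 * \<bar>K\<bar>)" by (intro mult_mono) auto
        then show ?thesis using True by (simp add: abs_mult)
      qed simp
    qed
  qed auto
  have eq: "R \<omega> = ?S \<omega> + (\<integral>u. G u \<omega> \<partial>lborel)" if w: "\<omega> \<in> space M" for \<omega>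
  proof (cases "0 < \<rho> \<omega>")
    case False
    then show ?thesis by (simp add: R_def G_def)
  next
    case True
    have sub: "{0..\<rho> \<omega>} \<subseteq> {0..}" by auto
    have c1: "continuous_on {0..\<rho> \<omega>} (\<lambda>u. z u \<omega>)" "continuous_on {0..\<rho> \<omega>} (\<lambda>u. N u \<omega>)"
      using continuous_on_subset[OF zc[OF w] sub] continuous_on_subset[OF Nc[OF w] sub] by auto
    have c2: "continuous_on {0..\<rho> \<omega>} (\<lambda>u. z u \<omega> * (N (\<rho> \<omega>) \<omega> - N u \<omega>))"
      by (intro continuous_intros c1)
    have "(\<integral>u. G u \<omega> \<partial>lborel) = (LINT u:{0..\<rho> \<omega>}|lborel. z u \<omega> * (N (\<rho> \<omega>) \<omega> - N u \<omega>))"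
      unfolding set_lebesgue_integral_def
      using True by (intro Bochner_Integration.integral_cong) (auto simp: G_def indicator_def max_absorb2)
    also have "\<dots> = integral {0..\<rho> \<omega>} (\<lambda>u. z u \<omega> * (N (\<rho> \<omega>) \<omega> - N u \<omega>))"
      by (intro set_borel_integral_eq_integral(2) borel_integrable_atLeastAtMost' c2)
    also have "\<dots> = integral {0..\<rho> \<omega>} (\<lambda>u. z u \<omega> * N (\<rho> \<omega>) \<omega> - z u \<omega> * N u \<omega>)"
      by (simp add: right_diff_distrib)
    also have "\<dots> = integral {0..\<rho> \<omega>} (\<lambda>u. z u \<omega>) * N (\<rho> \<omega>) \<omega> - integral {0..\<rho> \<omega>} (\<lambda>u. z u \<omega> * N u \<omega>)"
      using c1 by (subst Henstock_Kurzweil_Integration.integral_diff)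
        (auto intro!: integrable_continuous_interval continuous_intros)
    finally show ?thesis using True Z[OF w True] by (simp add: R_def algebra_simps)
  qed
  have "integrable M R \<longleftrightarrow> integrable M (\<lambda>\<omega>. ?S \<omega> + (\<integral>u. G u \<omega> \<partial>lborel))"
    by (rule Bochner_Integration.integrable_cong) (simp_all add: eq)
  then show "integrable M R" using S1 G1 by simp
  have "(\<integral>\<omega>. R \<omega> \<partial>M) = (\<integral>\<omega>. ?S \<omega> + (\<integral>u. G u \<omega> \<partial>lborel) \<partial>M)"
    by (rule Bochner_Integration.integral_cong) (simp_all add: eq)
  then show "(\<integral>\<omega>. R \<omega> \<partial>M) = 0" using S1 G1 S2 G2 by simp
qed

end

section \<open>Brownian increments\<close>

text \<open>A finite fourth moment, phrased through the square: for an integral \<open>J\<close> of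
  a simple process it makes \<open>|J|^2\<close> square integrable, so that the compensated square
  is again an \<open>l2_martingale\<close>.\<close>

definition quartic_integrable :: "'w measure \<Rightarrow> ('w \<Rightarrow> real) \<Rightarrow> bool" where
  "quartic_integrable M f \<longleftrightarrow> f \<in> borel_measurable M \<and> square_integrable M (\<lambda>x. (f x)\<^sup>2)"

lemma quartic_integrable_mult:
  assumes "quartic_integrable M f" "quartic_integrable M g"
  shows "square_integrable M (\<lambda>x. f x * g x)"
proof (rule square_integrable_bound)
  show "integrable M (\<lambda>x. ((f x)\<^sup>2)\<^sup>2 + ((g x)\<^sup>2)\<^sup>2)"
    using assms by (auto simp: quartic_integrable_def square_integrable_def)
  show "(\<lambda>x. f x * g x) \<in> borel_measurable M"
    using assms by (auto simp: quartic_integrable_def)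
  show "(f x * g x)\<^sup>2 \<le> ((f x)\<^sup>2)\<^sup>2 + ((g x)\<^sup>2)\<^sup>2" for x
  proof -
    have "2 * ((f x)\<^sup>2 * (g x)\<^sup>2) \<le> ((f x)\<^sup>2)\<^sup>2 + ((g x)\<^sup>2)\<^sup>2"
      using sum_squares_bound[of "(f x)\<^sup>2" "(g x)\<^sup>2"] by (simp add: mult.assoc)
    moreover have "0 \<le> (f x)\<^sup>2 * (g x)\<^sup>2" by simp
    ultimately show ?thesis unfolding power_mult_distrib by linarith
  qed
qed

lemma quartic_integrable_add:
  assumes "quartic_integrable M f" "quartic_integrable M g"
  shows "quartic_integrable M (\<lambda>x. f x + g x)"
  unfolding quartic_integrable_def
proof
  show "(\<lambda>x. f x + g x) \<in> borel_measurable M"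
    using assms by (auto simp: quartic_integrable_def)
  have "square_integrable M (\<lambda>x. ((f x)\<^sup>2 + (g x)\<^sup>2) + 2 * (f x * g x))"
    using assms by (intro square_integrable_add square_integrable_cmult quartic_integrable_mult)
      (auto simp: quartic_integrable_def)
  then show "square_integrable M (\<lambda>x. (f x + g x)\<^sup>2)"
    by (simp add: power2_sum mult.assoc)
qed

lemma quartic_integrable_0: "quartic_integrable M (\<lambda>x. 0)"
  by (simp add: quartic_integrable_def square_integrable_def)

lemma quartic_integrable_sum:
  assumes "\<And>i. i \<in> S \<Longrightarrow> quartic_integrable M (f i)"
  shows "quartic_integrable M (\<lambda>x. \<Sum>i\<in>S. f i x)"
proof (cases "finite S")
  case True
  then show ?thesis using assms
    by (induction S rule: finite_induct) (simp_all add: quartic_integrable_0 quartic_integrable_add)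
qed (simp add: quartic_integrable_0)

lemma quartic_integrable_mult_bounded:
  assumes f: "quartic_integrable M f" and g: "g \<in> borel_measurable M"
    and B: "\<And>x. x \<in> space M \<Longrightarrow> \<bar>g x\<bar> \<le> B"
  shows "quartic_integrable M (\<lambda>x. g x * f x)"
  unfolding quartic_integrable_def
proof
  show "(\<lambda>x. g x * f x) \<in> borel_measurable M" using f g by (auto simp: quartic_integrable_def)
  have "square_integrable M (\<lambda>x. (g x)\<^sup>2 * (f x)\<^sup>2)"
  proof (rule square_integrable_mult_bounded)
    show "\<bar>(g x)\<^sup>2\<bar> \<le> B\<^sup>2" if "x \<in> space M" for x
      using B[OF that] by (simp add: abs_le_square_iff[symmetric])
  qed (use f g in \<open>auto simp: quartic_integrable_def\<close>)
  then show "square_integrable M (\<lambda>x. (g x * f x)\<^sup>2)" by (simp add: power_mult_distrib)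
qed

lemma (in prob_space) quartic_integrable_square_integrable:
  assumes "quartic_integrable M f"
  shows "square_integrable M f"
proof -
  have "square_integrable M (\<lambda>x. (f x)\<^sup>2)" "f \<in> borel_measurable M"
    using assms unfolding quartic_integrable_def by blast+
  from square_integrable_integrable[OF this(1)] this(2) show ?thesis
    unfolding square_integrable_def by blast
qed

text \<open>Fubini's theorem for products of functions of single coordinates. Lebesgue measure on
  \<open>real^'k\<close> is the image of a product measure indexed by \<open>Basis\<close>, so the
  coordinates are first relabelled by the basis vectors \<open>axis j 1\<close>.\<close>

lemma lborel_prod_integral:
  fixes h :: "'k::finite \<Rightarrow> real \<Rightarrow> real"
  assumes h: "\<And>j. integrable lborel (h j)"
  shows "integrable lborel (\<lambda>x::real^'k. \<Prod>j\<in>UNIV. h j (x $ j))"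
    and "(\<integral>x. (\<Prod>j\<in>UNIV. h j (x $ j)) \<partial>(lborel :: (real^'k) measure)) = (\<Prod>j\<in>UNIV. \<integral>x. h j x \<partial>lborel)"
proof -
  interpret P: product_sigma_finite "\<lambda>_::real^'k. lborel :: real measure"
    by (simp add: product_sigma_finite_def sigma_finite_lborel)
  define ax where "ax j = (axis j 1 :: real^'k)" for j
  define idx where "idx = inv ax"
  have inj: "inj ax" by (auto simp: inj_def ax_def axis_eq_axis)
  have idx: "idx (ax j) = j" for j unfolding idx_def by (rule inv_f_f[OF inj])
  have Basis: "(Basis :: (real^'k) set) = ax ` UNIV" by (auto simp: Basis_vec_def ax_def)
  have reindex: "(\<Prod>j\<in>UNIV. g j) = (\<Prod>b\<in>Basis. g (idx b))" for g :: "'k \<Rightarrow> real"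
    unfolding Basis by (subst prod.reindex[OF inj]) (simp add: idx)
  let ?e = "\<lambda>f. \<Sum>b\<in>Basis. f b *\<^sub>R b :: real^'k"
  have hm[measurable]: "h j \<in> borel_measurable borel" for j using h[of j] by auto
  have comp: "?e f $ j = f (ax j)" for f j
  proof -
    have "?e f $ j = ?e f \<bullet> ax j" by (simp add: ax_def inner_axis)
    also have "\<dots> = f (ax j)" by (rule inner_sum_left_Basis) (simp add: Basis)
    finally show ?thesis .
  qed
  have eq: "(\<Prod>j\<in>UNIV. h j (?e f $ j)) = (\<Prod>b\<in>Basis. h (idx b) (f b))" for f
    unfolding comp reindex by (rule prod.cong) (auto simp: Basis idx)
  have em[measurable]: "?e \<in> (\<Pi>\<^sub>M b\<in>Basis. lborel) \<rightarrow>\<^sub>M borel" by measurable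
  have pm[measurable]: "(\<lambda>x::real^'k. \<Prod>j\<in>UNIV. h j (x $ j)) \<in> borel_measurable borel" by measurable
  show "integrable lborel (\<lambda>x::real^'k. \<Prod>j\<in>UNIV. h j (x $ j))"
    unfolding lborel_eq[where 'a = "real^'k"]
    by (subst integrable_distr_eq[OF em pm]) (simp only: eq, rule P.product_integrable_prod, auto intro: h)
  have "(\<integral>x. (\<Prod>j\<in>UNIV. h j (x $ j)) \<partial>(lborel :: (real^'k) measure))
      = (\<integral>f. (\<Prod>b\<in>Basis. h (idx b) (f b)) \<partial>(\<Pi>\<^sub>M b\<in>(Basis::(real^'k) set). lborel))"
    unfolding lborel_eq[where 'a = "real^'k"] by (subst integral_distr[OF em pm]) (simp only: eq)
  also have "\<dots> = (\<Prod>b\<in>(Basis::(real^'k) set). \<integral>x. h (idx b) x \<partial>lborel)"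
    by (rule P.product_integral_prod) (auto intro: h)
  also have "\<dots> = (\<Prod>j\<in>UNIV. \<integral>x. h j x \<partial>lborel)" by (rule reindex[symmetric])
  finally show "(\<integral>x. (\<Prod>j\<in>UNIV. h j (x $ j)) \<partial>(lborel :: (real^'k) measure)) = (\<Prod>j\<in>UNIV. \<integral>x. h j x \<partial>lborel)" .
qed

lemma borel_measurable_vec_component [measurable (raw)]:
  fixes f :: "'w \<Rightarrow> 'b::real_normed_vector ^ 'n"
  assumes "f \<in> borel_measurable M"
  shows "(\<lambda>x. f x $ i) \<in> borel_measurable M"
  using measurable_compose[OF assms borel_measurable_continuous_onI[OF continuous_on_component[OF continuous_on_id]]] .

locale brownian = usual_filtration M F for M :: "'w measure" and F +
  fixes W :: "real \<Rightarrow> 'w \<Rightarrow> real^'k"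
  assumes bm: "brownian_motion M F W"
begin

lemma W_adapted: "0 \<le> t \<Longrightarrow> W t \<in> borel_measurable (F t)"
  using bm by (auto simp: brownian_motion_def adapted_def)

lemma W_continuous: "AE \<omega> in M. continuous_on {0..} (\<lambda>t. W t \<omega>)"
  using bm by (auto simp: brownian_motion_def continuous_paths_def)

lemma W_measurable: "0 \<le> t \<Longrightarrow> W t \<in> borel_measurable M"
  using measurable_F_M[OF _ W_adapted] .

text \<open>The density of an increment is a product, so mixed moments factor into one-dimensional
  Gaussian moments. Mean, covariance and fourth moments all come from choices of the exponents
  \<open>p\<close>.\<close>

lemma increment_moment:
  fixes p :: "'k \<Rightarrow> nat"
  assumes st: "0 \<le> s" "s < t"
  shows "integrable M (\<lambda>\<omega>. \<Prod>j\<in>UNIV. ((W t \<omega> - W s \<omega>) $ j) ^ p j)"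
    and "(\<integral>\<omega>. (\<Prod>j\<in>UNIV. ((W t \<omega> - W s \<omega>) $ j) ^ p j) \<partial>M)
      = (\<Prod>j\<in>UNIV. \<integral>x. normal_density 0 (sqrt (t - s)) x * x ^ p j \<partial>lborel)"
proof -
  let ?nd = "normal_density 0 (sqrt (t - s))"
  let ?f = "\<lambda>x::real^'k. \<Prod>j\<in>UNIV. ?nd (x $ j)" and ?g = "\<lambda>x::real^'k. \<Prod>j\<in>UNIV. (x $ j) ^ p j"
  have D: "distributed M lborel (\<lambda>\<omega>. W t \<omega> - W s \<omega>) (\<lambda>x. ennreal (?f x))"
    using bm st unfolding brownian_motion_def by blast
  have f0: "0 \<le> ?f x" for x by (intro prod_nonneg ballI) simp
  have h: "integrable lborel (\<lambda>x. ?nd x * x ^ p j)" for j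
    using integrable_normal_moment[of "sqrt (t - s)" 0 "p j"] st by simp
  have eq: "?f x * ?g x = (\<Prod>j\<in>UNIV. ?nd (x $ j) * (x $ j) ^ p j)" for x :: "real^'k"
    by (simp add: prod.distrib)
  have gm: "?g \<in> borel_measurable lborel" by measurable
  have "integrable lborel (\<lambda>x. ?f x * ?g x)"
    unfolding eq by (rule lborel_prod_integral(1)[OF h])
  then show "integrable M (\<lambda>\<omega>. \<Prod>j\<in>UNIV. ((W t \<omega> - W s \<omega>) $ j) ^ p j)"
    using distributed_integrable[OF D gm f0] by simp
  have "(\<integral>\<omega>. ?g (W t \<omega> - W s \<omega>) \<partial>M) = (\<integral>x. ?f x * ?g x \<partial>lborel)"
    using distributed_integral[OF D gm f0] by simp
  also have "\<dots> = (\<Prod>j\<in>UNIV. \<integral>x. ?nd x * x ^ p j \<partial>lborel)"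
    unfolding eq by (rule lborel_prod_integral(2)[OF h])
  finally show "(\<integral>\<omega>. ?g (W t \<omega> - W s \<omega>) \<partial>M) = (\<Prod>j\<in>UNIV. \<integral>x. ?nd x * x ^ p j \<partial>lborel)" .
qed

lemma increment_quartic:
  assumes "0 \<le> s" "s \<le> t"
  shows "quartic_integrable M (\<lambda>\<omega>. (W t \<omega> - W s \<omega>) $ j)"
proof (cases "s = t")
  case False
  then have st: "s < t" using assms by simp
  have pr: "(\<Prod>i\<in>UNIV. (x $ i) ^ (if i = j then 4 else 0)) = (x $ j) ^ 4" for x :: "real^'k"
    by (simp add: if_distrib[of "\<lambda>n. _ ^ n"] prod.delta cong: if_cong)
  have "integrable M (\<lambda>\<omega>. ((W t \<omega> - W s \<omega>) $ j) ^ 4)"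
    using increment_moment(1)[OF assms(1) st, of "\<lambda>i. if i = j then 4 else 0"] unfolding pr .
  moreover have [measurable]: "W t \<in> borel_measurable M" "W s \<in> borel_measurable M"
    using W_measurable assms by auto
  have "(\<lambda>\<omega>. (W t \<omega> - W s \<omega>) $ j) \<in> borel_measurable M" by measurable
  ultimately show ?thesis
    unfolding quartic_integrable_def square_integrable_def by simp
qed (simp add: quartic_integrable_0)

lemma increment_mean:
  assumes "0 \<le> s" "s \<le> t"
  shows "(\<integral>\<omega>. (W t \<omega> - W s \<omega>) $ j \<partial>M) = 0"
proof (cases "s = t")
  case False
  then have st: "s < t" using assms by simp
  have pr: "(\<Prod>i\<in>UNIV. (x $ i) ^ (if i = j then 1 else 0)) = x $ j" for x :: "real^'k"
    by (simp add: if_distrib[of "\<lambda>n. _ ^ n"] prod.delta cong: if_cong)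
  have "(\<integral>\<omega>. (W t \<omega> - W s \<omega>) $ j \<partial>M)
      = (\<Prod>i\<in>UNIV. \<integral>x. normal_density 0 (sqrt (t - s)) x * x ^ (if i = j then 1 else 0) \<partial>lborel)"
    using increment_moment(2)[OF assms(1) st, of "\<lambda>i. if i = j then 1 else 0"] unfolding pr .
  also have "\<dots> = 0"
    using integral_normal_moment_nz_1[of "sqrt (t - s)" 0] st by (intro prod_zero) auto
  finally show ?thesis .
qed simp

lemma increment_covariance:
  assumes "0 \<le> s" "s \<le> t"
  shows "(\<integral>\<omega>. (W t \<omega> - W s \<omega>) $ j * (W t \<omega> - W s \<omega>) $ l \<partial>M) = (if j = l then t - s else 0)"
proof (cases "s = t")
  case False
  then have st: "s < t" using assms by simp
  let ?p = "\<lambda>i. (if i = j then 1 else 0) + (if i = l then 1 else 0) :: nat"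
  let ?m = "\<lambda>n. \<integral>x. normal_density 0 (sqrt (t - s)) x * x ^ n \<partial>lborel"
  have pr: "(\<Prod>i\<in>UNIV. (x $ i) ^ ?p i) = x $ j * x $ l" for x :: "real^'k"
    unfolding power_add prod.distrib
    by (simp add: if_distrib[of "\<lambda>n. _ ^ n"] prod.delta cong: if_cong)
  have eq: "(\<integral>\<omega>. (W t \<omega> - W s \<omega>) $ j * (W t \<omega> - W s \<omega>) $ l \<partial>M) = (\<Prod>i\<in>UNIV. ?m (?p i))"
    using increment_moment(2)[OF assms(1) st, of ?p] unfolding pr .
  have m0: "?m 0 = 1" using integral_normal_density[of "sqrt (t - s)" 0] st by simp
  have m1: "?m 1 = 0" using integral_normal_moment_nz_1[of "sqrt (t - s)" 0] st by simp
  have m2: "?m 2 = t - s"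
    using integral_normal_moment_even[of "sqrt (t - s)" 0 1] st by (simp add: fact_2)
  show ?thesis
  proof (cases "j = l")
    case True
    have "(\<Prod>i\<in>UNIV. ?m (?p i)) = (\<Prod>i\<in>UNIV. if i = j then t - s else 1)"
      using True m0 m2 by (intro prod.cong) (auto simp: numeral_2_eq_2)
    then show ?thesis using eq True by simp
  next
    case jl: False
    have "(\<Prod>i\<in>UNIV. ?m (?p i)) = 0"
      using jl m1 by (intro prod_zero bexI[of _ j]) auto
    then show ?thesis using eq jl by simp
  qed
qed simp

text \<open>The given independence concerns events of \<open>F s\<close> and preimages under the
  increment. Both families of preimages are intersection stable, so it passes to the generated
  sigma-algebras and expectations factor. The case \<open>s = t\<close> is separate because
  \<open>brownian_motion\<close> speaks only of \<open>s < t\<close>.\<close>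

lemma increment_independent:
  assumes st: "0 \<le> s" "s \<le> t" and Y: "Y \<in> borel_measurable (F s)" "integrable M Y"
    and g: "g \<in> borel_measurable borel" "integrable M (\<lambda>\<omega>. g (W t \<omega> - W s \<omega>))"
  shows "integrable M (\<lambda>\<omega>. Y \<omega> * g (W t \<omega> - W s \<omega>) :: real)"
    and "(\<integral>\<omega>. Y \<omega> * g (W t \<omega> - W s \<omega>) \<partial>M) = (\<integral>\<omega>. Y \<omega> \<partial>M) * (\<integral>\<omega>. g (W t \<omega> - W s \<omega>) \<partial>M)"
proof -
  have "integrable M (\<lambda>\<omega>. Y \<omega> * g (W t \<omega> - W s \<omega>)) \<and>
    (\<integral>\<omega>. Y \<omega> * g (W t \<omega> - W s \<omega>) \<partial>M) = (\<integral>\<omega>. Y \<omega> \<partial>M) * (\<integral>\<omega>. g (W t \<omega> - W s \<omega>) \<partial>M)"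
  proof (cases "s = t")
    case True
    then show ?thesis using Y(2) by (simp add: prob_space)
  next
    case False
    let ?D = "\<lambda>\<omega>. W t \<omega> - W s \<omega>"
    have ind: "indep_set (sets (F s)) {?D -` B \<inter> space M | B. B \<in> sets borel}"
      using bm st False unfolding brownian_motion_def by auto
    have Dm: "?D \<in> borel_measurable M" using W_measurable[of t] W_measurable[of s] st by simp
    have "indep_var borel Y borel (\<lambda>\<omega>. g (?D \<omega>))"
      unfolding indep_var_eq
    proof (intro conjI)
      show "random_variable borel Y" using Y(2) by auto
      show "random_variable borel (\<lambda>\<omega>. g (?D \<omega>))" using measurable_compose[OF Dm g(1)] .
      let ?A = "{Y -` A \<inter> space M | A. A \<in> sets borel}" and ?B = "{(\<lambda>\<omega>. g (?D \<omega>)) -` A \<inter> space M | A. A \<in> sets borel}"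
      have A: "?A \<subseteq> sets (F s)"
        using measurable_sets[OF Y(1)] space_F[OF st(1)] by auto
      have B: "?B \<subseteq> {?D -` B \<inter> space M | B. B \<in> sets borel}"
      proof
        fix S assume "S \<in> ?B"
        then obtain A where A: "S = (\<lambda>\<omega>. g (?D \<omega>)) -` A \<inter> space M" "A \<in> sets borel" by auto
        have "g -` A \<in> sets borel" using measurable_sets[OF g(1) A(2)] by simp
        moreover have "S = ?D -` (g -` A) \<inter> space M" using A by auto
        ultimately show "S \<in> {?D -` B \<inter> space M | B. B \<in> sets borel}" by blast
      qed
      have "indep_set ?A ?B"
        using ind A B unfolding indep_sets2_eq by (meson in_mono order_trans)
      moreover have "Int_stable ?A"
      proof (rule Int_stableI)
        fix a b assume "a \<in> ?A" "b \<in> ?A"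
        then obtain a' b' where "a = Y -` a' \<inter> space M" "b = Y -` b' \<inter> space M" "a' \<in> sets borel" "b' \<in> sets borel"
          by auto
        then have "a \<inter> b = Y -` (a' \<inter> b') \<inter> space M" "a' \<inter> b' \<in> sets borel" by auto
        then show "a \<inter> b \<in> ?A" by blast
      qed
      moreover have "Int_stable ?B"
      proof (rule Int_stableI)
        fix a b assume "a \<in> ?B" "b \<in> ?B"
        then obtain a' b' where "a = (\<lambda>\<omega>. g (?D \<omega>)) -` a' \<inter> space M" "b = (\<lambda>\<omega>. g (?D \<omega>)) -` b' \<inter> space M"
            "a' \<in> sets borel" "b' \<in> sets borel"
          by auto
        then have "a \<inter> b = (\<lambda>\<omega>. g (?D \<omega>)) -` (a' \<inter> b') \<inter> space M" "a' \<inter> b' \<in> sets borel" by auto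
        then show "a \<inter> b \<in> ?B" by blast
      qed
      ultimately show "indep_set (sigma_sets (space M) ?A) (sigma_sets (space M) ?B)"
        by (rule indep_set_sigma_sets)
    qed
    from indep_var_lebesgue_integral[OF this Y(2) g(2)] indep_var_integrable[OF this Y(2) g(2)]
    show ?thesis by simp
  qed
  then show "integrable M (\<lambda>\<omega>. Y \<omega> * g (W t \<omega> - W s \<omega>) :: real)"
    "(\<integral>\<omega>. Y \<omega> * g (W t \<omega> - W s \<omega>) \<partial>M) = (\<integral>\<omega>. Y \<omega> \<partial>M) * (\<integral>\<omega>. g (W t \<omega> - W s \<omega>) \<partial>M)" by auto
qed

lemma increment_times:
  assumes st: "0 \<le> s" "s \<le> t" and Y: "Y \<in> borel_measurable (F s)" "integrable M Y"
  shows "integrable M (\<lambda>\<omega>. Y \<omega> * (W t \<omega> - W s \<omega>) $ j)"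
    and "(\<integral>\<omega>. Y \<omega> * (W t \<omega> - W s \<omega>) $ j \<partial>M) = 0"
proof -
  have g: "(\<lambda>x::real^'k. x $ j) \<in> borel_measurable borel" by measurable
  have i: "integrable M (\<lambda>\<omega>. (W t \<omega> - W s \<omega>) $ j)"
    by (intro square_integrable_integrable quartic_integrable_square_integrable increment_quartic st)
  show "integrable M (\<lambda>\<omega>. Y \<omega> * (W t \<omega> - W s \<omega>) $ j)"
    by (rule increment_independent(1)[OF st Y g i])
  show "(\<integral>\<omega>. Y \<omega> * (W t \<omega> - W s \<omega>) $ j \<partial>M) = 0"
    using increment_independent(2)[OF st Y g i] increment_mean[OF st, of j] by simp
qed

lemma increment_times2:
  assumes st: "0 \<le> s" "s \<le> t" and Y: "Y \<in> borel_measurable (F s)" "integrable M Y"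
  shows "integrable M (\<lambda>\<omega>. Y \<omega> * ((W t \<omega> - W s \<omega>) $ j * (W t \<omega> - W s \<omega>) $ l))"
    and "(\<integral>\<omega>. Y \<omega> * ((W t \<omega> - W s \<omega>) $ j * (W t \<omega> - W s \<omega>) $ l) \<partial>M)
      = (if j = l then t - s else 0) * (\<integral>\<omega>. Y \<omega> \<partial>M)"
proof -
  have g: "(\<lambda>x::real^'k. x $ j * x $ l) \<in> borel_measurable borel" by measurable
  have i: "integrable M (\<lambda>\<omega>. (W t \<omega> - W s \<omega>) $ j * (W t \<omega> - W s \<omega>) $ l)"
    by (intro square_integrable_mult quartic_integrable_square_integrable increment_quartic st)
  show "integrable M (\<lambda>\<omega>. Y \<omega> * ((W t \<omega> - W s \<omega>) $ j * (W t \<omega> - W s \<omega>) $ l))"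
    by (rule increment_independent(1)[OF st Y g i])
  show "(\<integral>\<omega>. Y \<omega> * ((W t \<omega> - W s \<omega>) $ j * (W t \<omega> - W s \<omega>) $ l) \<partial>M)
      = (if j = l then t - s else 0) * (\<integral>\<omega>. Y \<omega> \<partial>M)"
    using increment_independent(2)[OF st Y g i] increment_covariance[OF st, of j l] by simp
qed

end

section \<open>Integrals of simple processes\<close>

context usual_filtration
begin

text \<open>The gluing step of the induction over the intervals of a simple process:
  \<open>N\<close> follows a known martingale up to \<open>c\<close>, has centred increments on
  \<open>[c, d]\<close> and is frozen from \<open>d\<close> on. Every increment splits into one
  before \<open>c\<close> and one within \<open>[c, d]\<close>.\<close>

lemma l2_martingale_extend:
  assumes N': "l2_martingale N'" and cd: "0 \<le> c" "c \<le> d"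
    and ad: "\<And>t. 0 \<le> t \<Longrightarrow> N t \<in> borel_measurable (F t)"
    and sq: "\<And>t. 0 \<le> t \<Longrightarrow> square_integrable M (N t)"
    and before: "\<And>t \<omega>. 0 \<le> t \<Longrightarrow> t \<le> c \<Longrightarrow> N t \<omega> = N' t \<omega>"
    and after: "\<And>t \<omega>. d \<le> t \<Longrightarrow> N t \<omega> = N d \<omega>"
    and step: "\<And>s t z. c \<le> s \<Longrightarrow> s \<le> t \<Longrightarrow> t \<le> d \<Longrightarrow> z \<in> borel_measurable (F s) \<Longrightarrow> square_integrable M z \<Longrightarrow>
      (\<integral>\<omega>. z \<omega> * (N t \<omega> - N s \<omega>) \<partial>M) = 0"
  shows "l2_martingale N"
  unfolding l2_martingale_def
proof (intro conjI allI impI ad sq)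
  fix s t :: real and z :: "'w \<Rightarrow> real"
  assume s: "0 \<le> s" and st: "s \<le> t" and z: "z \<in> borel_measurable (F s)" "square_integrable M z"
  \<comment> \<open>The projection of \<open>r\<close> to \<open>[c, d]\<close>; the part of the
    path after \<open>d\<close> contributes nothing since \<open>N\<close> is constant
    there.\<close>
  define mid where "mid r = max c (min r d)" for r
  have eq: "N r \<omega> = N (min r c) \<omega> + N (mid r) \<omega> - N c \<omega>" if "0 \<le> r" for r \<omega>
  proof -
    consider "r \<le> c" | "c < r" "r \<le> d" | "d < r" by linarith
    then show ?thesis
    proof cases
      case 1
      then have "min r c = r" "mid r = c" using cd by (auto simp: mid_def)
      then show ?thesis by simp
    next
      case 2
      then have "min r c = c" "mid r = r" by (auto simp: mid_def)
      then show ?thesis by simp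
    next
      case 3
      then have "min r c = c" "mid r = d" using cd by (auto simp: mid_def)
      then show ?thesis using after[of r \<omega>] 3 by simp
    qed
  qed
  have mid0: "0 \<le> mid r" for r using cd by (simp add: mid_def)
  have i: "integrable M (\<lambda>\<omega>. z \<omega> * (N a \<omega> - N b \<omega>))" if "0 \<le> a" "0 \<le> b" for a b
    by (intro square_integrable_mult[OF z(2)] square_integrable_diff sq that)
  have 1: "(\<integral>\<omega>. z \<omega> * (N (min t c) \<omega> - N (min s c) \<omega>) \<partial>M) = 0"
  proof (cases "s \<le> c")
    case True
    then have "(\<integral>\<omega>. z \<omega> * (N (min t c) \<omega> - N (min s c) \<omega>) \<partial>M) = (\<integral>\<omega>. z \<omega> * (N' (min t c) \<omega> - N' s \<omega>) \<partial>M)"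
      using s st cd by (simp add: before min_def)
    also have "\<dots> = 0" using True st by (intro l2_martingaleD(3)[OF N' s _ z]) auto
    finally show ?thesis .
  qed (use st in \<open>simp add: min_def\<close>)
  have 2: "(\<integral>\<omega>. z \<omega> * (N (mid t) \<omega> - N (mid s) \<omega>) \<partial>M) = 0"
  proof (cases "s \<le> d")
    case True
    have "z \<in> borel_measurable (F (mid s))"
      using True by (intro measurable_F_mono[OF s _ z(1)]) (auto simp: mid_def)
    then show ?thesis using st cd by (intro step z(2)) (auto simp: mid_def)
  qed (use st in \<open>simp add: mid_def min_def\<close>)
  have "(\<integral>\<omega>. z \<omega> * (N t \<omega> - N s \<omega>) \<partial>M)
      = (\<integral>\<omega>. z \<omega> * (N (min t c) \<omega> - N (min s c) \<omega>) + z \<omega> * (N (mid t) \<omega> - N (mid s) \<omega>) \<partial>M)"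
  proof (rule Bochner_Integration.integral_cong)
    fix \<omega>
    have "N t \<omega> - N s \<omega> = (N (min t c) \<omega> - N (min s c) \<omega>) + (N (mid t) \<omega> - N (mid s) \<omega>)"
      using s st eq[of t \<omega>] eq[of s \<omega>] by linarith
    then show "z \<omega> * (N t \<omega> - N s \<omega>)
        = z \<omega> * (N (min t c) \<omega> - N (min s c) \<omega>) + z \<omega> * (N (mid t) \<omega> - N (mid s) \<omega>)"
      by (simp only: distrib_left)
  qed simp
  also have "\<dots> = 0"
    using s st cd mid0 by (subst Bochner_Integration.integral_add[OF i i]) (auto simp: 1 2)
  finally show "(\<integral>\<omega>. z \<omega> * (N t \<omega> - N s \<omega>) \<partial>M) = 0" .
qed

end

text \<open>For nondecreasing times starting at \<open>\<tau> 0 \<ge> 0\<close>, this is the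
  integral over \<open>[0, t]\<close> of the squared Frobenius norm of the simple process, the
  compensator of the squared norm of its stochastic integral.\<close>

definition simple_quadratic :: "('w, 'd::finite, 'k::finite) simple_data \<Rightarrow> real \<Rightarrow> 'w \<Rightarrow> real" where
  "simple_quadratic = (\<lambda>(n, \<tau>, \<xi>) t \<omega>. \<Sum>i<n. (norm (\<xi> i \<omega>))\<^sup>2 * (min t (\<tau> (Suc i)) - min t (\<tau> i)))"

lemma norm_matrix_power2: "(norm (A :: real^'k^'d))\<^sup>2 = (\<Sum>a\<in>UNIV. \<Sum>k\<in>UNIV. (A $ a $ k)\<^sup>2)"
  unfolding norm_eq_frobenius_norm frobenius_norm_def by (simp add: sum_nonneg)

lemma norm_vec_power2: "(norm (x :: real^'d))\<^sup>2 = (\<Sum>a\<in>UNIV. (x $ a)\<^sup>2)"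
  unfolding power2_norm_eq_inner inner_vec_def by (simp add: power2_eq_square)

lemma matrix_component_le_norm: "\<bar>A $ a $ k\<bar> \<le> norm (A :: real^'k^'d)"
  using component_le_norm_cart[of "A $ a" k] Finite_Cartesian_Product.norm_nth_le[of A a] by linarith

context brownian
begin

text \<open>Given the past, the increment \<open>D\<close> has mean \<open>0\<close> and covariance
  \<open>(t - s)\<close> times the identity. In the expansion of the squared norm the terms linear
  in \<open>D\<close> therefore vanish, and the quadratic ones average to \<open>(t - s)\<close>
  times the squared Frobenius norm of \<open>\<xi>\<close>.\<close>

lemma simple_step:
  fixes \<xi> :: "'w \<Rightarrow> real^'k^'d" and J0 :: "'w \<Rightarrow> real^'d"
  assumes st: "0 \<le> s" "s \<le> t" and \<xi>: "\<xi> \<in> borel_measurable (F s)" "\<And>\<omega>. \<omega> \<in> space M \<Longrightarrow> norm (\<xi> \<omega>) \<le> B"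
    and J0: "J0 \<in> borel_measurable (F s)" "\<And>a. square_integrable M (\<lambda>\<omega>. J0 \<omega> $ a)"
    and z: "z \<in> borel_measurable (F s)" "square_integrable M z"
  defines "D \<equiv> \<lambda>\<omega>. W t \<omega> - W s \<omega>"
  shows "(\<integral>\<omega>. z \<omega> * ((\<xi> \<omega> *v D \<omega>) $ a) \<partial>M) = 0"
    and "(\<integral>\<omega>. z \<omega> * ((norm (J0 \<omega> + \<xi> \<omega> *v D \<omega>))\<^sup>2 - (norm (J0 \<omega>))\<^sup>2 - (norm (\<xi> \<omega>))\<^sup>2 * (t - s)) \<partial>M) = 0"
proof -
  have \<xi>c[measurable]: "(\<lambda>\<omega>. \<xi> \<omega> $ a $ k) \<in> borel_measurable (F s)" for a k using \<xi>(1) by measurable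
  have \<xi>B: "\<bar>\<xi> \<omega> $ a $ k\<bar> \<le> \<bar>B\<bar>" if "\<omega> \<in> space M" for \<omega> a k
    using \<xi>(2)[OF that] matrix_component_le_norm[of "\<xi> \<omega>" a k] by linarith
  have \<xi>M: "(\<lambda>\<omega>. \<xi> \<omega> $ a $ k) \<in> borel_measurable M" for a k by (rule measurable_F_M[OF st(1) \<xi>c])
  note [measurable] = z(1) J0(1)
  have zx2: "square_integrable M (\<lambda>\<omega>. \<xi> \<omega> $ a $ k * z \<omega>)" for a k
    by (rule square_integrable_mult_bounded[OF z(2) \<xi>M \<xi>B])
  have zxx2: "square_integrable M (\<lambda>\<omega>. \<xi> \<omega> $ a $ l * (\<xi> \<omega> $ a $ k * z \<omega>))" for a k l
    by (rule square_integrable_mult_bounded[OF zx2 \<xi>M \<xi>B])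
  have A: "integrable M (\<lambda>\<omega>. (\<xi> \<omega> $ a $ k * z \<omega>) * D \<omega> $ k)" "(\<integral>\<omega>. (\<xi> \<omega> $ a $ k * z \<omega>) * D \<omega> $ k \<partial>M) = 0" for a k
    unfolding D_def by (rule increment_times[OF st _ square_integrable_integrable[OF zx2]], measurable)+
  have "(\<integral>\<omega>. z \<omega> * ((\<xi> \<omega> *v D \<omega>) $ a) \<partial>M) = (\<integral>\<omega>. (\<Sum>k\<in>UNIV. (\<xi> \<omega> $ a $ k * z \<omega>) * D \<omega> $ k) \<partial>M)"
    by (simp add: matrix_vector_mult_def sum_distrib_left mult_ac)
  also have "\<dots> = 0" by (subst Bochner_Integration.integral_sum) (auto simp: A)
  finally show "(\<integral>\<omega>. z \<omega> * ((\<xi> \<omega> *v D \<omega>) $ a) \<partial>M) = 0" .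
  have B: "integrable M (\<lambda>\<omega>. (2 * J0 \<omega> $ a * (\<xi> \<omega> $ a $ k * z \<omega>)) * D \<omega> $ k)"
      "(\<integral>\<omega>. (2 * J0 \<omega> $ a * (\<xi> \<omega> $ a $ k * z \<omega>)) * D \<omega> $ k \<partial>M) = 0" for a k
    unfolding D_def
    by (rule increment_times[OF st _ square_integrable_mult[OF square_integrable_cmult[OF J0(2)] zx2]], measurable)+
  have C: "integrable M (\<lambda>\<omega>. (\<xi> \<omega> $ a $ l * (\<xi> \<omega> $ a $ k * z \<omega>)) * (D \<omega> $ k * D \<omega> $ l))"
      "(\<integral>\<omega>. (\<xi> \<omega> $ a $ l * (\<xi> \<omega> $ a $ k * z \<omega>)) * (D \<omega> $ k * D \<omega> $ l) \<partial>M)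
        = (if k = l then t - s else 0) * (\<integral>\<omega>. \<xi> \<omega> $ a $ l * (\<xi> \<omega> $ a $ k * z \<omega>) \<partial>M)" for a k l
    unfolding D_def by (rule increment_times2[OF st _ square_integrable_integrable[OF zxx2]], measurable)+
  have E: "integrable M (\<lambda>\<omega>. (t - s) * (\<xi> \<omega> $ a $ k * (\<xi> \<omega> $ a $ k * z \<omega>)))" for a k
    by (intro integrable_mult_right square_integrable_integrable zxx2)
  \<comment> \<open>The expansion is arranged so that each summand is an
    \<open>F s\<close>-measurable factor times a monomial of degree at most two in \<open>D\<close>,
    the form in which the moment formulas for increments apply.\<close>
  have eq: "z \<omega> * ((norm (J0 \<omega> + \<xi> \<omega> *v D \<omega>))\<^sup>2 - (norm (J0 \<omega>))\<^sup>2 - (norm (\<xi> \<omega>))\<^sup>2 * (t - s))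
      = (\<Sum>a\<in>UNIV. (\<Sum>k\<in>UNIV. (2 * J0 \<omega> $ a * (\<xi> \<omega> $ a $ k * z \<omega>)) * D \<omega> $ k)
         + (\<Sum>k\<in>UNIV. \<Sum>l\<in>UNIV. (\<xi> \<omega> $ a $ l * (\<xi> \<omega> $ a $ k * z \<omega>)) * (D \<omega> $ k * D \<omega> $ l))
         - (\<Sum>k\<in>UNIV. (t - s) * (\<xi> \<omega> $ a $ k * (\<xi> \<omega> $ a $ k * z \<omega>))))" for \<omega>
  proof -
    have expand: "(norm (J0 \<omega> + \<xi> \<omega> *v D \<omega>))\<^sup>2 - (norm (J0 \<omega>))\<^sup>2 - (norm (\<xi> \<omega>))\<^sup>2 * (t - s)
      = (\<Sum>a\<in>UNIV. 2 * J0 \<omega> $ a * (\<Sum>k\<in>UNIV. \<xi> \<omega> $ a $ k * D \<omega> $ k)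
          + (\<Sum>k\<in>UNIV. \<xi> \<omega> $ a $ k * D \<omega> $ k) * (\<Sum>l\<in>UNIV. \<xi> \<omega> $ a $ l * D \<omega> $ l)
          - (\<Sum>k\<in>UNIV. (\<xi> \<omega> $ a $ k)\<^sup>2) * (t - s))"
      unfolding norm_vec_power2 norm_matrix_power2 sum_distrib_right[where r = "t - s"] sum_subtractf[symmetric]
      by (intro sum.cong refl)
        (simp add: matrix_vector_mult_def power2_sum power2_eq_square[of "sum _ _"] sum_distrib_right)
    show ?thesis
      unfolding expand
    proof (subst sum_distrib_left, intro sum.cong refl)
      fix a
      have lin: "z \<omega> * (A + B - C) = z \<omega> * A + z \<omega> * B - z \<omega> * C" for A B C
        by (simp add: right_diff_distrib distrib_left)
      have "z \<omega> * (2 * J0 \<omega> $ a * (\<Sum>k\<in>UNIV. \<xi> \<omega> $ a $ k * D \<omega> $ k))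
          = (\<Sum>k\<in>UNIV. (2 * J0 \<omega> $ a * (\<xi> \<omega> $ a $ k * z \<omega>)) * D \<omega> $ k)"
        by (simp add: sum_distrib_left mult_ac)
      moreover have "z \<omega> * ((\<Sum>k\<in>UNIV. \<xi> \<omega> $ a $ k * D \<omega> $ k) * (\<Sum>l\<in>UNIV. \<xi> \<omega> $ a $ l * D \<omega> $ l))
          = (\<Sum>k\<in>UNIV. \<Sum>l\<in>UNIV. (\<xi> \<omega> $ a $ l * (\<xi> \<omega> $ a $ k * z \<omega>)) * (D \<omega> $ k * D \<omega> $ l))"
        by (simp add: sum_product sum_distrib_left mult_ac)
      moreover have "z \<omega> * ((\<Sum>k\<in>UNIV. (\<xi> \<omega> $ a $ k)\<^sup>2) * (t - s))
          = (\<Sum>k\<in>UNIV. (t - s) * (\<xi> \<omega> $ a $ k * (\<xi> \<omega> $ a $ k * z \<omega>)))"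
        unfolding sum_distrib_left sum_distrib_right by (intro sum.cong refl) (simp add: mult_ac power2_eq_square)
      ultimately show "z \<omega> * (2 * J0 \<omega> $ a * (\<Sum>k\<in>UNIV. \<xi> \<omega> $ a $ k * D \<omega> $ k)
          + (\<Sum>k\<in>UNIV. \<xi> \<omega> $ a $ k * D \<omega> $ k) * (\<Sum>l\<in>UNIV. \<xi> \<omega> $ a $ l * D \<omega> $ l)
          - (\<Sum>k\<in>UNIV. (\<xi> \<omega> $ a $ k)\<^sup>2) * (t - s)) =
         (\<Sum>k\<in>UNIV. (2 * J0 \<omega> $ a * (\<xi> \<omega> $ a $ k * z \<omega>)) * D \<omega> $ k)
         + (\<Sum>k\<in>UNIV. \<Sum>l\<in>UNIV. (\<xi> \<omega> $ a $ l * (\<xi> \<omega> $ a $ k * z \<omega>)) * (D \<omega> $ k * D \<omega> $ l))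
         - (\<Sum>k\<in>UNIV. (t - s) * (\<xi> \<omega> $ a $ k * (\<xi> \<omega> $ a $ k * z \<omega>)))"
        by (simp only: lin)
    qed
  qed
  \<comment> \<open>Off-diagonal covariances vanish, so the quadratic terms collapse to the diagonal
    and cancel the compensator.\<close>
  have Cs: "(\<Sum>l\<in>UNIV. (if k = l then t - s else 0) * (\<integral>\<omega>. \<xi> \<omega> $ a $ l * (\<xi> \<omega> $ a $ k * z \<omega>) \<partial>M))
      = (\<integral>\<omega>. (t - s) * (\<xi> \<omega> $ a $ k * (\<xi> \<omega> $ a $ k * z \<omega>)) \<partial>M)" for a k
    by (simp add: if_distrib[of "\<lambda>x. x * _"] sum.delta' cong: if_cong)
  show "(\<integral>\<omega>. z \<omega> * ((norm (J0 \<omega> + \<xi> \<omega> *v D \<omega>))\<^sup>2 - (norm (J0 \<omega>))\<^sup>2 - (norm (\<xi> \<omega>))\<^sup>2 * (t - s)) \<partial>M) = 0"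
    unfolding eq
    by (simp only: Bochner_Integration.integral_sum Bochner_Integration.integral_add Bochner_Integration.integral_diff
        Bochner_Integration.integrable_sum Bochner_Integration.integrable_add Bochner_Integration.integrable_diff
        B C E Cs sum.neutral_const diff_self add_0)
qed

end

lemma borel_measurable_vecI:
  fixes f :: "'w \<Rightarrow> real^'n"
  assumes "\<And>i. (\<lambda>x. f x $ i) \<in> borel_measurable M"
  shows "f \<in> borel_measurable M"
proof (subst borel_measurable_euclidean_space, rule ballI)
  fix b :: "real^'n" assume "b \<in> Basis"
  then obtain i where "b = axis i 1" by (auto simp: Basis_vec_def)
  then show "(\<lambda>x. f x \<bullet> b) \<in> borel_measurable M" using assms[of i] by (simp add: inner_axis)
qed

lemma borel_measurable_matrix_vector_mult:
  fixes A :: "'w \<Rightarrow> real^'n^'m"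
  assumes [measurable]: "A \<in> borel_measurable M" "f \<in> borel_measurable M"
  shows "(\<lambda>x. A x *v f x) \<in> borel_measurable M"
  by (rule borel_measurable_vecI) (simp add: matrix_vector_mult_def)

lemma simple_integral_Suc:
  "simple_integral W (Suc n, \<tau>, \<xi>) t \<omega> =
     simple_integral W (n, \<tau>, \<xi>) t \<omega> + \<xi> n \<omega> *v (W (min t (\<tau> (Suc n))) \<omega> - W (min t (\<tau> n)) \<omega>)"
  by (simp add: simple_integral_def)

lemma simple_quadratic_Suc:
  "simple_quadratic (Suc n, \<tau>, \<xi>) t \<omega> =
     simple_quadratic (n, \<tau>, \<xi>) t \<omega> + (norm (\<xi> n \<omega>))\<^sup>2 * (min t (\<tau> (Suc n)) - min t (\<tau> n))"
  by (simp add: simple_quadratic_def)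

lemma mono_upto_le:
  fixes \<tau> :: "nat \<Rightarrow> real"
  assumes "\<And>i. i < n \<Longrightarrow> \<tau> i \<le> \<tau> (Suc i)"
  shows "i \<le> n \<Longrightarrow> \<tau> i \<le> \<tau> n"
  using assms by (induction n) (auto simp: le_Suc_eq intro: order_trans)

lemma simple_integral_after:
  assumes "\<And>i. i < n \<Longrightarrow> \<tau> i \<le> \<tau> (Suc i)" "\<tau> n \<le> t"
  shows "simple_integral W (n, \<tau>, \<xi>) t \<omega> = simple_integral W (n, \<tau>, \<xi>) (\<tau> n) \<omega>"
    and "simple_quadratic (n, \<tau>, \<xi>) t \<omega> = simple_quadratic (n, \<tau>, \<xi>) (\<tau> n) \<omega>"
proof -
  have le: "\<tau> i \<le> \<tau> n" if "i \<le> n" for i by (rule mono_upto_le[where \<tau> = \<tau>]) (use assms(1) that in auto)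
  have eq: "min t (\<tau> i) = min (\<tau> n) (\<tau> i)" if "i \<le> n" for i
    using le[OF that] assms(2) by simp
  show "simple_integral W (n, \<tau>, \<xi>) t \<omega> = simple_integral W (n, \<tau>, \<xi>) (\<tau> n) \<omega>"
    unfolding simple_integral_def prod.case by (intro sum.cong refl) (simp only: eq lessThan_iff Suc_le_eq less_imp_le)
  show "simple_quadratic (n, \<tau>, \<xi>) t \<omega> = simple_quadratic (n, \<tau>, \<xi>) (\<tau> n) \<omega>"
    unfolding simple_quadratic_def prod.case by (intro sum.cong refl) (simp only: eq lessThan_iff Suc_le_eq less_imp_le)
qed

context brownian
begin

text \<open>Induction on the number of intervals, the last one being added by
  \<open>l2_martingale_extend\<close>. Adaptedness and moments are part of the claim because the
  step needs them; the fourth moments serve the compensated square.\<close>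

lemma simple_martingales:
  fixes \<xi> :: "nat \<Rightarrow> 'w \<Rightarrow> real^'k^'d"
  assumes "simple_process M F (n, \<tau>, \<xi>)"
  shows "(\<forall>t\<ge>0. simple_integral W (n, \<tau>, \<xi>) t \<in> borel_measurable (F t) \<and>
        simple_quadratic (n, \<tau>, \<xi>) t \<in> borel_measurable (F t) \<and>
        square_integrable M (simple_quadratic (n, \<tau>, \<xi>) t) \<and>
        (\<forall>a. quartic_integrable M (\<lambda>\<omega>. simple_integral W (n, \<tau>, \<xi>) t \<omega> $ a))) \<and>
      (\<forall>a. l2_martingale (\<lambda>t \<omega>. simple_integral W (n, \<tau>, \<xi>) t \<omega> $ a)) \<and>
      l2_martingale (\<lambda>t \<omega>. (norm (simple_integral W (n, \<tau>, \<xi>) t \<omega>))\<^sup>2 - simple_quadratic (n, \<tau>, \<xi>) t \<omega>)"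
  using assms
proof (induction n)
  case 0
  show ?case
    by (simp add: simple_integral_def simple_quadratic_def l2_martingale_def square_integrable_def quartic_integrable_0)
next
  case (Suc n)
  from Suc.prems have prem: "0 \<le> \<tau> 0" "\<And>i. i < Suc n \<Longrightarrow> \<tau> i \<le> \<tau> (Suc i)"
      "\<xi> n \<in> borel_measurable (F (\<tau> n))" "\<exists>B. \<forall>\<omega>\<in>space M. norm (\<xi> n \<omega>) \<le> B"
    and "simple_process M F (n, \<tau>, \<xi>)"
    by (auto simp: simple_process_def)
  note IH = Suc.IH[OF this(5)]
  obtain B where B: "\<And>\<omega>. \<omega> \<in> space M \<Longrightarrow> norm (\<xi> n \<omega>) \<le> B" using prem(4) by blast
  let ?c = "\<tau> n" and ?d = "\<tau> (Suc n)"
  let ?J = "simple_integral W (n, \<tau>, \<xi>)" and ?J' = "simple_integral W (Suc n, \<tau>, \<xi>)"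
  let ?q = "simple_quadratic (n, \<tau>, \<xi>)" and ?q' = "simple_quadratic (Suc n, \<tau>, \<xi>)"
  have cd: "0 \<le> ?c" "?c \<le> ?d" using prem(1,2) mono_upto_le[of n \<tau> 0] by force+
  have \<xi>m: "\<xi> n \<in> borel_measurable (F t)" if "?c \<le> t" for t
    by (rule measurable_F_mono[OF cd(1) that prem(3)])
  have \<xi>M: "(\<lambda>\<omega>. \<xi> n \<omega> $ a $ k) \<in> borel_measurable M" for a k
    using measurable_F_M[OF cd(1) prem(3)] by measurable
  have \<xi>B: "\<bar>\<xi> n \<omega> $ a $ k\<bar> \<le> B" if "\<omega> \<in> space M" for \<omega> a k
    using B[OF that] matrix_component_le_norm[of "\<xi> n \<omega>" a k] by linarith
  have before: "?J' t \<omega> = ?J t \<omega>" "?q' t \<omega> = ?q t \<omega>" if "t \<le> ?c" for t \<omega>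
    using that cd unfolding simple_integral_Suc simple_quadratic_Suc by simp_all
  have mid: "?J' t \<omega> = ?J ?c \<omega> + \<xi> n \<omega> *v (W t \<omega> - W ?c \<omega>)"
      "?q' t \<omega> = ?q ?c \<omega> + (norm (\<xi> n \<omega>))\<^sup>2 * (t - ?c)" if "?c \<le> t" "t \<le> ?d" for t \<omega>
    using that cd simple_integral_after(1)[of n \<tau> t W \<xi> \<omega>] simple_integral_after(2)[of n \<tau> t \<xi> \<omega>] prem(2)
    unfolding simple_integral_Suc simple_quadratic_Suc by simp_all
  have after: "?J' t \<omega> = ?J' ?d \<omega>" "?q' t \<omega> = ?q' ?d \<omega>" if "?d \<le> t" for t \<omega>
    using that prem(2) by (intro simple_integral_after; simp)+
  have J'm: "?J' t \<in> borel_measurable (F t)" and q'm: "?q' t \<in> borel_measurable (F t)" if t: "0 \<le> t" for t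
  proof -
    have "?J' t \<in> borel_measurable (F t) \<and> ?q' t \<in> borel_measurable (F t)"
    proof (cases "t \<le> ?c")
      case True
      have "?J' t = ?J t" "?q' t = ?q t" using before[OF True] by auto
      then show ?thesis using IH t by simp
    next
      case False
      have [measurable]: "W (min t ?d) \<in> borel_measurable (F t)" "W (min t ?c) \<in> borel_measurable (F t)"
        using t cd by (auto intro!: measurable_F_mono[OF _ _ W_adapted])
      have [measurable]: "\<xi> n \<in> borel_measurable (F t)" using \<xi>m False by simp
      have [measurable]: "?J t \<in> borel_measurable (F t)" "?q t \<in> borel_measurable (F t)" using IH t by auto
      have "(\<lambda>\<omega>. ?J' t \<omega>) \<in> borel_measurable (F t)"
        unfolding simple_integral_Suc
        by (intro borel_measurable_add borel_measurable_matrix_vector_mult) measurable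
      moreover have "(\<lambda>\<omega>. ?q' t \<omega>) \<in> borel_measurable (F t)"
        unfolding simple_quadratic_Suc by measurable
      ultimately show ?thesis by simp
    qed
    then show "?J' t \<in> borel_measurable (F t)" "?q' t \<in> borel_measurable (F t)" by auto
  qed
  have q'sq: "square_integrable M (?q' t)" if t: "0 \<le> t" for t
  proof -
    have "square_integrable M (\<lambda>\<omega>. (norm (\<xi> n \<omega>))\<^sup>2 * (min t ?d - min t ?c))"
    proof (rule square_integrable_bounded)
      show "(\<lambda>\<omega>. (norm (\<xi> n \<omega>))\<^sup>2 * (min t ?d - min t ?c)) \<in> borel_measurable M"
        using measurable_F_M[OF cd(1) prem(3)] by measurable
      show "\<bar>(norm (\<xi> n \<omega>))\<^sup>2 * (min t ?d - min t ?c)\<bar> \<le> B\<^sup>2 * \<bar>min t ?d - min t ?c\<bar>" if "\<omega> \<in> space M" for \<omega>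
        unfolding abs_mult using B[OF that] by (intro mult_right_mono) (auto intro: power_mono)
    qed
    then have "square_integrable M (\<lambda>\<omega>. ?q' t \<omega>)"
      unfolding simple_quadratic_Suc using IH t by (intro square_integrable_add) auto
    then show ?thesis by simp
  qed
  have J'4: "quartic_integrable M (\<lambda>\<omega>. ?J' t \<omega> $ a)" if t: "0 \<le> t" for t a
  proof -
    have "quartic_integrable M (\<lambda>\<omega>. \<Sum>k\<in>UNIV. \<xi> n \<omega> $ a $ k * (W (min t ?d) \<omega> - W (min t ?c) \<omega>) $ k)"
      using t cd by (intro quartic_integrable_sum quartic_integrable_mult_bounded[OF increment_quartic \<xi>M \<xi>B]) auto
    then show ?thesis
      unfolding simple_integral_Suc vector_add_component matrix_vector_mult_def
      using IH t by (intro quartic_integrable_add) (auto simp: matrix_vector_mult_def)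
  qed
  have J'2: "square_integrable M (\<lambda>\<omega>. ?J' t \<omega> $ a)" if "0 \<le> t" for t a
    by (rule quartic_integrable_square_integrable[OF J'4[OF that]])
  have J'm_comp: "(\<lambda>\<omega>. ?J' t \<omega> $ a) \<in> borel_measurable (F t)" if t: "0 \<le> t" for t a
    using J'm[OF t] by measurable
  have step: "?J' t \<omega> = ?J' s \<omega> + \<xi> n \<omega> *v (W t \<omega> - W s \<omega>)"
      "?q' t \<omega> = ?q' s \<omega> + (norm (\<xi> n \<omega>))\<^sup>2 * (t - s)" if "?c \<le> s" "s \<le> t" "t \<le> ?d" for s t \<omega>
  proof -
    show "?J' t \<omega> = ?J' s \<omega> + \<xi> n \<omega> *v (W t \<omega> - W s \<omega>)"
      using mid(1)[of t \<omega>] mid(1)[of s \<omega>] that by (simp add: matrix_vector_mult_diff_distrib)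
    show "?q' t \<omega> = ?q' s \<omega> + (norm (\<xi> n \<omega>))\<^sup>2 * (t - s)"
      using mid(2)[of t \<omega>] mid(2)[of s \<omega>] that by (simp add: right_diff_distrib)
  qed
  have mart1: "l2_martingale (\<lambda>t \<omega>. ?J' t \<omega> $ a)" for a
  proof (rule l2_martingale_extend[OF _ cd J'm_comp J'2])
    show "l2_martingale (\<lambda>t \<omega>. ?J t \<omega> $ a)" using IH by blast
    fix s t :: real and z :: "'w \<Rightarrow> real"
    assume H: "?c \<le> s" "s \<le> t" "t \<le> ?d" "z \<in> borel_measurable (F s)" "square_integrable M z"
    have s0: "0 \<le> s" using H(1) cd by simp
    have "?J' t \<omega> $ a - ?J' s \<omega> $ a = (\<xi> n \<omega> *v (W t \<omega> - W s \<omega>)) $ a" for \<omega>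
      using step(1)[OF H(1-3), of \<omega>] by simp
    then show "(\<integral>\<omega>. z \<omega> * (?J' t \<omega> $ a - ?J' s \<omega> $ a) \<partial>M) = 0"
      using simple_step(1)[OF s0 H(2) \<xi>m[OF H(1)] B J'm[OF s0] J'2[OF s0] H(4,5)] by simp
  next
    show "?J' t \<omega> $ a = ?J t \<omega> $ a" if "t \<le> ?c" for t \<omega> by (simp only: before(1)[OF that])
    show "?J' t \<omega> $ a = ?J' ?d \<omega> $ a" if "?d \<le> t" for t \<omega> by (simp only: after(1)[OF that])
  qed
  have mart2: "l2_martingale (\<lambda>t \<omega>. (norm (?J' t \<omega>))\<^sup>2 - ?q' t \<omega>)"
  proof (rule l2_martingale_extend[OF _ cd])
    show "l2_martingale (\<lambda>t \<omega>. (norm (?J t \<omega>))\<^sup>2 - ?q t \<omega>)" using IH by blast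
    show "(\<lambda>\<omega>. (norm (?J' t \<omega>))\<^sup>2 - ?q' t \<omega>) \<in> borel_measurable (F t)" if "0 \<le> t" for t
      using J'm[OF that] q'm[OF that] by measurable
    show "square_integrable M (\<lambda>\<omega>. (norm (?J' t \<omega>))\<^sup>2 - ?q' t \<omega>)" if "0 \<le> t" for t
      unfolding norm_vec_power2 using J'4[OF that]
      by (intro square_integrable_diff square_integrable_sum q'sq[OF that]) (auto simp: quartic_integrable_def)
    fix s t :: real and z :: "'w \<Rightarrow> real"
    assume H: "?c \<le> s" "s \<le> t" "t \<le> ?d" "z \<in> borel_measurable (F s)" "square_integrable M z"
    have s0: "0 \<le> s" using H(1) cd by simp
    have inc: "(norm (?J' t \<omega>))\<^sup>2 - ?q' t \<omega> - ((norm (?J' s \<omega>))\<^sup>2 - ?q' s \<omega>)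
        = (norm (?J' s \<omega> + \<xi> n \<omega> *v (W t \<omega> - W s \<omega>)))\<^sup>2 - (norm (?J' s \<omega>))\<^sup>2 - (norm (\<xi> n \<omega>))\<^sup>2 * (t - s)" for \<omega>
      using step[OF H(1-3), of \<omega>] by simp
    show "(\<integral>\<omega>. z \<omega> * ((norm (?J' t \<omega>))\<^sup>2 - ?q' t \<omega> - ((norm (?J' s \<omega>))\<^sup>2 - ?q' s \<omega>)) \<partial>M) = 0"
      unfolding inc by (rule simple_step(2)[OF s0 H(2) \<xi>m[OF H(1)] B J'm[OF s0] J'2[OF s0] H(4,5)])
  next
    show "(norm (?J' t \<omega>))\<^sup>2 - ?q' t \<omega> = (norm (?J' ?d \<omega>))\<^sup>2 - ?q' ?d \<omega>" if "?d \<le> t" for t \<omega>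
      using after[OF that, of \<omega>] by simp
  qed (simp add: before)
  show ?case using J'm q'm q'sq J'4 mart1 mart2 by blast
qed

end

section \<open>Passage to the Ito integral\<close>

context prob_space
begin

text \<open>Capping at \<open>1\<close> turns convergence in probability into \<open>L1\<close>
  convergence of bounded real functions, even though \<open>Y\<close> may take the value infinity;
  \<open>L1\<close> convergence in turn yields an almost surely convergent subsequence.\<close>

lemma tends_to_0_in_prob_L1:
  assumes "tends_to_0_in_prob M Y"
  shows "(\<lambda>n. \<integral>\<omega>. enn2real (min (Y n \<omega>) 1) \<partial>M) \<longlonglongrightarrow> 0"
proof (rule LIMSEQ_I)
  fix e :: real assume e: "0 < e"
  have Ym[measurable]: "Y n \<in> borel_measurable M" for n
    using assms by (simp add: tends_to_0_in_prob_def)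
  define S where "S n = {\<omega> \<in> space M. ennreal (e / 2) < Y n \<omega>}" for n
  have Sm[measurable]: "S n \<in> sets M" for n unfolding S_def by measurable
  have "(\<lambda>n. emeasure M (S n)) \<longlonglongrightarrow> ennreal 0"
    using assms e unfolding S_def tends_to_0_in_prob_def by (simp add: ennreal_zero_less_divide)
  then have "(\<lambda>n. measure M (S n)) \<longlonglongrightarrow> 0"
    unfolding emeasure_eq_measure by (subst (asm) tendsto_ennreal_iff) auto
  then obtain N where N: "\<And>n. n \<ge> N \<Longrightarrow> measure M (S n) < e / 2"
    using LIMSEQ_D[of _ 0 "e / 2"] e by fastforce
  show "\<exists>no. \<forall>n\<ge>no. norm ((\<integral>\<omega>. enn2real (min (Y n \<omega>) 1) \<partial>M) - 0) < e"
  proof (intro exI allI impI)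
    fix n assume n: "N \<le> n"
    have bound: "enn2real (min (Y n \<omega>) 1) \<le> e / 2 + indicator (S n) \<omega>" if "\<omega> \<in> space M" for \<omega>
    proof (cases "\<omega> \<in> S n")
      case True
      have "enn2real (min (Y n \<omega>) 1) \<le> 1" by (rule enn2real_leI) auto
      then show ?thesis using True e by simp
    next
      case False
      then have "min (Y n \<omega>) 1 \<le> ennreal (e / 2)" using that by (auto simp: S_def min_le_iff_disj)
      then have "enn2real (min (Y n \<omega>) 1) \<le> e / 2" using e by (intro enn2real_leI) auto
      then show ?thesis using False by simp
    qed
    have le1: "enn2real (min (Y n \<omega>) 1) \<le> 1" for \<omega> by (rule enn2real_leI) auto
    have "integrable M (\<lambda>\<omega>. enn2real (min (Y n \<omega>) 1))"
      by (rule integrable_const_bound[of _ 1]) (auto simp: le1)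
    then have "(\<integral>\<omega>. enn2real (min (Y n \<omega>) 1) \<partial>M) \<le> (\<integral>\<omega>. e / 2 + indicator (S n) \<omega> \<partial>M)"
      by (rule integral_mono) (auto simp: bound less_top[symmetric])
    also have "\<dots> = e / 2 + measure M (S n)"
      by (subst Bochner_Integration.integral_add) (auto simp: prob_space less_top[symmetric])
    also have "\<dots> < e" using N[OF n] by simp
    finally show "norm ((\<integral>\<omega>. enn2real (min (Y n \<omega>) 1) \<partial>M) - 0) < e"
      by (simp add: Bochner_Integration.integral_nonneg)
  qed
qed

text \<open>A common subsequence for both is obtained from the sum of the two capped sequences. The
  cap does no harm: once the capped value is below \<open>1\<close> it is the value itself.\<close>

lemma tends_to_0_in_prob_AE_subseq:
  assumes Y: "tends_to_0_in_prob M Y" and Y': "tends_to_0_in_prob M Y'"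
  obtains r where "strict_mono r" "AE \<omega> in M. (\<lambda>n. Y (r n) \<omega>) \<longlonglongrightarrow> 0 \<and> (\<lambda>n. Y' (r n) \<omega>) \<longlonglongrightarrow> 0"
proof -
  let ?t = "\<lambda>y :: ennreal. enn2real (min y 1)"
  define u where "u n \<omega> = ?t (Y n \<omega>) + ?t (Y' n \<omega>)" for n \<omega>
  have [measurable]: "Y n \<in> borel_measurable M" "Y' n \<in> borel_measurable M" for n
    using assms by (simp_all add: tends_to_0_in_prob_def)
  have t1: "?t y \<le> 1" for y by (rule enn2real_leI) auto
  have i: "integrable M (\<lambda>\<omega>. ?t (Y n \<omega>))" "integrable M (\<lambda>\<omega>. ?t (Y' n \<omega>))" for n
    by (rule integrable_const_bound[of _ 1]; auto simp: t1)+
  have ui: "integrable M (u n)" for n unfolding u_def using i by auto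
  have "(\<lambda>n. (\<integral>\<omega>. ?t (Y n \<omega>) \<partial>M) + (\<integral>\<omega>. ?t (Y' n \<omega>) \<partial>M)) \<longlonglongrightarrow> 0 + 0"
    by (intro tendsto_add tends_to_0_in_prob_L1 Y Y')
  moreover have "(\<integral>\<omega>. norm (u n \<omega>) \<partial>M) = (\<integral>\<omega>. ?t (Y n \<omega>) \<partial>M) + (\<integral>\<omega>. ?t (Y' n \<omega>) \<partial>M)" for n
    using i by (simp add: u_def)
  ultimately have "(\<lambda>n. \<integral>\<omega>. norm (u n \<omega>) \<partial>M) \<longlonglongrightarrow> 0" by simp
  from tendsto_L1_AE_subseq[OF ui this] obtain r where r: "strict_mono r" "AE \<omega> in M. (\<lambda>n. u (r n) \<omega>) \<longlonglongrightarrow> 0"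
    by blast
  have conv: "y \<longlonglongrightarrow> 0" if "(\<lambda>n. v n) \<longlonglongrightarrow> 0" "\<And>n. ?t (y n) \<le> v n" for y :: "nat \<Rightarrow> ennreal" and v :: "nat \<Rightarrow> real"
  proof -
    have "(\<lambda>n. ?t (y n)) \<longlonglongrightarrow> 0"
      by (rule tendsto_sandwich[OF _ _ tendsto_const that(1)]) (auto simp: that(2))
    then have "(\<lambda>n. ennreal (?t (y n))) \<longlonglongrightarrow> ennreal 0" by (rule tendsto_ennrealI)
    moreover have "ennreal (?t (y n)) = min (y n) 1" for n by (rule ennreal_enn2real) (simp add: min_less_iff_disj)
    ultimately have lim: "(\<lambda>n. min (y n) 1) \<longlonglongrightarrow> 0" by simp
    have "\<forall>\<^sub>F n in sequentially. min (y n) 1 < 1"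
      using order_tendstoD(2)[OF lim, of 1] by simp
    then have "\<forall>\<^sub>F n in sequentially. min (y n) 1 = y n"
      by eventually_elim (auto simp: min_def split: if_splits)
    then show ?thesis by (rule Lim_transform_eventually[OF lim])
  qed
  have "AE \<omega> in M. (\<lambda>n. Y (r n) \<omega>) \<longlonglongrightarrow> 0 \<and> (\<lambda>n. Y' (r n) \<omega>) \<longlonglongrightarrow> 0"
    using r(2)
  proof eventually_elim
    case (elim \<omega>)
    show ?case by (intro conjI conv[OF elim]) (auto simp: u_def)
  qed
  with r(1) show thesis by (rule that)
qed

end

lemma simple_value_Suc:
  "simple_value (Suc n, \<tau>, \<xi>) s \<omega> = simple_value (n, \<tau>, \<xi>) s \<omega> + indicat_real {\<tau> n<..\<tau> (Suc n)} s *\<^sub>R \<xi> n \<omega>"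
  unfolding simple_value_def prod.case by (rule sum.lessThan_Suc)

text \<open>The intervals are disjoint, so at most one summand is nonzero at any time and there are
  no cross terms.\<close>

lemma norm_simple_value_power2:
  fixes \<xi> :: "nat \<Rightarrow> 'w \<Rightarrow> real^'k^'d"
  assumes "\<And>i. i < n \<Longrightarrow> \<tau> i \<le> \<tau> (Suc i)"
  shows "(norm (simple_value (n, \<tau>, \<xi>) s \<omega>))\<^sup>2 = (\<Sum>i<n. (norm (\<xi> i \<omega>))\<^sup>2 * indicat_real {\<tau> i<..\<tau> (Suc i)} s)"
  using assms
proof (induction n)
  case 0
  then show ?case by (simp add: simple_value_def)
next
  case (Suc n)
  show ?case
  proof (cases "s \<in> {\<tau> n<..\<tau> (Suc n)}")
    case True
    have out: "s \<notin> {\<tau> i<..\<tau> (Suc i)}" if "i < n" for i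
    proof -
      have "\<tau> (Suc i) \<le> \<tau> n" by (rule mono_upto_le[where \<tau> = \<tau>]) (use Suc.prems that in auto)
      then show ?thesis using True by auto
    qed
    then have "simple_value (n, \<tau>, \<xi>) s \<omega> = 0"
      unfolding simple_value_def prod.case by (intro sum.neutral ballI) simp
    then show ?thesis using True out by (simp add: simple_value_Suc)
  next
    case False
    then show ?thesis using Suc by (simp add: simple_value_Suc)
  qed
qed

lemma simple_quadratic_eq:
  fixes \<xi> :: "nat \<Rightarrow> 'w \<Rightarrow> real^'k^'d"
  assumes "\<And>i. i < n \<Longrightarrow> \<tau> i \<le> \<tau> (Suc i)" and "0 \<le> \<tau> 0" and "0 \<le> u"
  shows "set_integrable lborel {0..u} (\<lambda>s. (norm (simple_value (n, \<tau>, \<xi>) s \<omega>))\<^sup>2)"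
    and "(LINT s:{0..u}|lborel. (norm (simple_value (n, \<tau>, \<xi>) s \<omega>))\<^sup>2) = simple_quadratic (n, \<tau>, \<xi>) u \<omega>"
proof -
  have \<tau>0: "0 \<le> \<tau> i" if "i \<le> n" for i
  proof -
    have "\<tau> 0 \<le> \<tau> i" by (rule mono_upto_le[where \<tau> = \<tau>]) (use assms(1) that in auto)
    then show ?thesis using assms(2) by simp
  qed
  have ind: "indicator {0..u} s * indicat_real {\<tau> i<..\<tau> (Suc i)} s = indicator {min u (\<tau> i)<..min u (\<tau> (Suc i))} s"
    if "i < n" for i s
    using \<tau>0[of i] that by (auto simp: indicator_def min_def)
  have nv: "(norm (simple_value (n, \<tau>, \<xi>) s \<omega>))\<^sup>2 = (\<Sum>i<n. (norm (\<xi> i \<omega>))\<^sup>2 * indicat_real {\<tau> i<..\<tau> (Suc i)} s)" for s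
    by (rule norm_simple_value_power2) (rule assms(1))
  have eq: "indicator {0..u} s *\<^sub>R (norm (simple_value (n, \<tau>, \<xi>) s \<omega>))\<^sup>2
      = (\<Sum>i<n. (norm (\<xi> i \<omega>))\<^sup>2 * indicator {min u (\<tau> i)<..min u (\<tau> (Suc i))} s)" for s
    unfolding nv real_scaleR_def sum_distrib_left
    by (intro sum.cong refl) (simp add: ind[symmetric])
  have i: "integrable lborel (\<lambda>s. (norm (\<xi> i \<omega>))\<^sup>2 * indicat_real {min u (\<tau> i)<..min u (\<tau> (Suc i))} s)" for i
  proof (intro integrable_mult_right integrable_real_indicator)
    have "emeasure lborel {a<..b} < \<infinity>" for a b :: real
      by (cases "a \<le> b") simp_all
    then show "emeasure lborel {min u (\<tau> i)<..min u (\<tau> (Suc i))} < \<infinity>" .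
  qed simp
  show "set_integrable lborel {0..u} (\<lambda>s. (norm (simple_value (n, \<tau>, \<xi>) s \<omega>))\<^sup>2)"
    unfolding set_integrable_def eq by (intro Bochner_Integration.integrable_sum i)
  show "(LINT s:{0..u}|lborel. (norm (simple_value (n, \<tau>, \<xi>) s \<omega>))\<^sup>2) = simple_quadratic (n, \<tau>, \<xi>) u \<omega>"
    unfolding set_lebesgue_integral_def eq simple_quadratic_def prod.case
  proof (subst Bochner_Integration.integral_sum[OF i], rule sum.cong[OF refl])
    fix i assume "i \<in> {..<n}"
    then have "min u (\<tau> i) \<le> min u (\<tau> (Suc i))" using assms(1)[of i] by (auto simp: min_def)
    note len = measure_lborel_Ioc[OF this]
    have ind: "(\<integral>s. indicat_real A s \<partial>lborel) = measure lborel A" if "A \<in> sets borel" for A :: "real set"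
      using that by simp
    show "(\<integral>s. (norm (\<xi> i \<omega>))\<^sup>2 * indicat_real {min u (\<tau> i)<..min u (\<tau> (Suc i))} s \<partial>lborel)
        = (norm (\<xi> i \<omega>))\<^sup>2 * (min u (\<tau> (Suc i)) - min u (\<tau> i))"
      unfolding integral_mult_right_zero by (subst ind) (simp_all only: len sets_lborel greaterThanAtMost_borel)
  qed
qed

text \<open>Young's inequality for the cross term of
  \<open>|x|^2 = |x - y|^2 + 2 <x - y, y> + |y|^2\<close>. The free weight \<open>\<delta>\<close>
  makes the term in \<open>|y|^2\<close> small; the large factor \<open>1 + 1 / \<delta>\<close>
  then falls on a quantity that tends to \<open>0\<close>.\<close>

lemma norm_power2_diff_le:
  fixes x y :: "'a::real_inner"
  assumes "0 < \<delta>"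
  shows "\<bar>(norm x)\<^sup>2 - (norm y)\<^sup>2\<bar> \<le> (1 + 1 / \<delta>) * (norm (x - y))\<^sup>2 + \<delta> * (norm y)\<^sup>2"
proof -
  have "(norm x)\<^sup>2 = (norm (x - y))\<^sup>2 + 2 * ((x - y) \<bullet> y) + (norm y)\<^sup>2"
    by (simp add: power2_norm_eq_inner inner_diff_left inner_diff_right inner_commute)
  then have "\<bar>(norm x)\<^sup>2 - (norm y)\<^sup>2\<bar> \<le> (norm (x - y))\<^sup>2 + 2 * \<bar>(x - y) \<bullet> y\<bar>"
    using zero_le_power2[of "norm (x - y)"] by linarith
  also have "2 * \<bar>(x - y) \<bullet> y\<bar> \<le> 2 * (norm (x - y) * norm y)"
    using Cauchy_Schwarz_ineq2[of "x - y" y] by simp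
  also have "2 * (norm (x - y) * norm y) \<le> (norm (x - y))\<^sup>2 / \<delta> + \<delta> * (norm y)\<^sup>2"
  proof -
    have "0 \<le> (norm (x - y) - \<delta> * norm y)\<^sup>2 / \<delta>" using assms by simp
    also have "\<dots> = (norm (x - y))\<^sup>2 / \<delta> + \<delta> * (norm y)\<^sup>2 - 2 * (norm (x - y) * norm y)"
      using assms by (simp add: power2_diff field_simps power2_eq_square)
    finally show ?thesis by simp
  qed
  finally show ?thesis by (simp add: distrib_right)
qed

text \<open>Young's inequality replaces Cauchy-Schwarz here, so that only the squared distance in
  \<open>L\<^sup>2\<close> enters.\<close>

lemma simple_quadratic_uniform_limit:
  fixes S :: "nat \<Rightarrow> ('w, 'd::finite, 'k::finite) simple_data" and h :: "real \<Rightarrow> real^'k^'d"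
  assumes S: "\<And>n. simple_process M F (S n)" and T: "0 \<le> T" and h: "continuous_on {0..T} h"
    and lim: "(\<lambda>n. \<integral>\<^sup>+s\<in>{0..T}. ennreal ((norm (simple_value (S n) s \<omega> - h s))\<^sup>2) \<partial>lborel) \<longlonglongrightarrow> 0"
  shows "uniform_limit {0..T} (\<lambda>n u. simple_quadratic (S n) u \<omega>) (\<lambda>u. integral {0..u} (\<lambda>s. (norm (h s))\<^sup>2)) sequentially"
proof -
  let ?v = "\<lambda>n s. simple_value (S n) s \<omega>"
  have prem: "0 \<le> fst (snd (S n)) 0" "\<And>i. i < fst (S n) \<Longrightarrow> fst (snd (S n)) i \<le> fst (snd (S n)) (Suc i)" for n
    using S[of n] unfolding simple_process_def by (auto split: prod.splits)
  have q: "set_integrable lborel {0..u} (\<lambda>s. (norm (?v n s))\<^sup>2)"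
      "(LINT s:{0..u}|lborel. (norm (?v n s))\<^sup>2) = simple_quadratic (S n) u \<omega>" if "0 \<le> u" for n u
    using simple_quadratic_eq[where n = "fst (S n)" and \<tau> = "fst (snd (S n))" and \<xi> = "snd (snd (S n))" and u = u and \<omega> = \<omega>,
        OF prem(2,1) that] by simp_all
  have hc: "continuous_on {0..u} (\<lambda>s. (norm (h s))\<^sup>2)" if "u \<le> T" for u
    by (intro continuous_intros continuous_on_subset[OF h]) (use that in auto)
  have hi: "set_integrable lborel {0..u} (\<lambda>s. (norm (h s))\<^sup>2)" if "u \<le> T" for u
    by (rule borel_integrable_atLeastAtMost'[OF hc[OF that]])
  have Q: "integral {0..u} (\<lambda>s. (norm (h s))\<^sup>2) = (LINT s:{0..u}|lborel. (norm (h s))\<^sup>2)" if "u \<le> T" for u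
    by (rule set_borel_integral_eq_integral(2)[OF hi[OF that], symmetric])
  have vm: "?v n \<in> borel_measurable borel" for n
    unfolding simple_value_def split_beta' by measurable
  have hm: "(\<lambda>s. indicator {0..T} s *\<^sub>R h s) \<in> borel_measurable lborel"
    using borel_measurable_continuous_on_indicator[OF _ h] by simp
  have dm: "set_borel_measurable lborel {0..T} (\<lambda>s. (norm (?v n s - h s))\<^sup>2)" for n
  proof -
    have "(\<lambda>s. (norm (indicator {0..T} s *\<^sub>R ?v n s - indicator {0..T} s *\<^sub>R h s))\<^sup>2) \<in> borel_measurable lborel"
      using vm hm by measurable
    also have "(\<lambda>s. (norm (indicator {0..T} s *\<^sub>R ?v n s - indicator {0..T} s *\<^sub>R h s))\<^sup>2)
        = (\<lambda>s. indicator {0..T} s *\<^sub>R (norm (?v n s - h s))\<^sup>2)"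
      by (auto simp: fun_eq_iff indicator_def)
    finally show ?thesis by (simp add: set_borel_measurable_def)
  qed
  have di: "set_integrable lborel {0..T} (\<lambda>s. (norm (?v n s - h s))\<^sup>2)" for n
  proof (rule set_integrable_bound)
    show "set_integrable lborel {0..T} (\<lambda>s. 2 * (norm (?v n s))\<^sup>2 + 2 * (norm (h s))\<^sup>2)"
      by (intro set_integral_add set_integrable_mult_right q(1)[OF T] hi[OF order_refl])
    show "AE s in lborel. s \<in> {0..T} \<longrightarrow> norm ((norm (?v n s - h s))\<^sup>2) \<le> norm (2 * (norm (?v n s))\<^sup>2 + 2 * (norm (h s))\<^sup>2)"
    proof (intro AE_I2 impI)
      fix s
      have "(norm (?v n s - h s))\<^sup>2 \<le> (norm (?v n s) + norm (h s))\<^sup>2"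
        by (intro power_mono norm_triangle_ineq4) auto
      also have "\<dots> \<le> 2 * (norm (?v n s))\<^sup>2 + 2 * (norm (h s))\<^sup>2"
        using sum_squares_bound[of "norm (?v n s)" "norm (h s)"] by (simp add: power2_sum)
      finally show "norm ((norm (?v n s - h s))\<^sup>2) \<le> norm (2 * (norm (?v n s))\<^sup>2 + 2 * (norm (h s))\<^sup>2)" by simp
    qed
  qed (rule dm)
  define A where "A n = (LINT s:{0..T}|lborel. (norm (?v n s - h s))\<^sup>2)" for n
  have A0: "0 \<le> A n" for n unfolding A_def set_lebesgue_integral_def by (intro Bochner_Integration.integral_nonneg) simp
  have "(\<integral>\<^sup>+s\<in>{0..T}. ennreal ((norm (?v n s - h s))\<^sup>2) \<partial>lborel) = ennreal (A n)" for n
    unfolding A_def set_lebesgue_integral_def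
    by (subst nn_integral_eq_integral[symmetric])
      (use di[of n] in \<open>auto simp: set_integrable_def ennreal_mult' indicator_def intro!: nn_integral_cong\<close>)
  then have "(\<lambda>n. ennreal (A n)) \<longlonglongrightarrow> ennreal 0" using lim by simp
  then have Alim: "A \<longlonglongrightarrow> 0" using A0 by (subst (asm) tendsto_ennreal_iff) auto
  define Q\<^sub>T where "Q\<^sub>T = (LINT s:{0..T}|lborel. (norm (h s))\<^sup>2)"
  have QT0: "0 \<le> Q\<^sub>T" unfolding Q\<^sub>T_def set_lebesgue_integral_def by (intro Bochner_Integration.integral_nonneg) simp
  have bound: "\<bar>simple_quadratic (S n) u \<omega> - integral {0..u} (\<lambda>s. (norm (h s))\<^sup>2)\<bar> \<le> (1 + 1 / \<delta>) * A n + \<delta> * Q\<^sub>T"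
    if u: "u \<in> {0..T}" and \<delta>: "0 < \<delta>" for n u \<delta>
  proof -
    have u': "0 \<le> u" "u \<le> T" using u by auto
    let ?b = "\<lambda>s. (1 + 1 / \<delta>) * (norm (?v n s - h s))\<^sup>2 + \<delta> * (norm (h s))\<^sup>2"
    have bi: "set_integrable lborel {0..T} ?b"
      by (intro set_integral_add set_integrable_mult_right di hi[OF order_refl])
    have bi': "set_integrable lborel {0..u} ?b"
      by (rule set_integrable_subset[OF bi]) (use u' in auto)
    have Di: "set_integrable lborel {0..u} (\<lambda>s. (norm (?v n s))\<^sup>2 - (norm (h s))\<^sup>2)"
      by (intro set_integral_diff q(1)[OF u'(1)] hi[OF u'(2)])
    have "simple_quadratic (S n) u \<omega> - integral {0..u} (\<lambda>s. (norm (h s))\<^sup>2)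
        = (LINT s:{0..u}|lborel. (norm (?v n s))\<^sup>2 - (norm (h s))\<^sup>2)"
      using q[OF u'(1)] hi[OF u'(2)] by (simp add: Q[OF u'(2)] set_integral_diff)
    also have "\<bar>\<dots>\<bar> \<le> (LINT s:{0..u}|lborel. \<bar>(norm (?v n s))\<^sup>2 - (norm (h s))\<^sup>2\<bar>)"
      using set_integral_norm_bound[OF Di] by simp
    also have "\<dots> \<le> (LINT s:{0..u}|lborel. ?b s)"
      by (intro set_integral_mono set_integrable_abs Di bi' norm_power2_diff_le \<delta>)
    \<comment> \<open>Enlarging the domain of the nonnegative integrand makes the estimate uniform
      in \<open>u\<close>.\<close>
    also have "\<dots> \<le> (LINT s:{0..T}|lborel. ?b s)"
      using u' \<delta> unfolding set_lebesgue_integral_def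
      by (intro integral_mono bi[unfolded set_integrable_def] bi'[unfolded set_integrable_def]) (auto simp: indicator_def)
    also have "\<dots> = (1 + 1 / \<delta>) * A n + \<delta> * Q\<^sub>T"
      using di[of n] hi[OF order_refl] by (simp add: A_def Q\<^sub>T_def set_integral_add)
    finally show ?thesis .
  qed
  show ?thesis
  proof (rule uniform_limitI)
    fix e :: real assume e: "0 < e"
    \<comment> \<open>This keeps the term \<open>\<delta> * Q\<^sub>T\<close> of
      \<open>bound\<close> below \<open>e / 2\<close>; the \<open>+ 1\<close> covers
      \<open>Q\<^sub>T = 0\<close>.\<close>
    define \<delta> where "\<delta> = e / (2 * (Q\<^sub>T + 1))"
    have \<delta>: "0 < \<delta>" "\<delta> * Q\<^sub>T < e / 2" using e QT0 by (auto simp: \<delta>_def field_simps)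
    have "(\<lambda>n. (1 + 1 / \<delta>) * A n) \<longlonglongrightarrow> 0" using tendsto_mult_right_zero[OF Alim] .
    then have "\<forall>\<^sub>F n in sequentially. (1 + 1 / \<delta>) * A n < e / 2"
      using order_tendstoD(2)[of _ 0 sequentially "e / 2"] e by simp
    then show "\<forall>\<^sub>F n in sequentially. \<forall>u\<in>{0..T}. dist (simple_quadratic (S n) u \<omega>) (integral {0..u} (\<lambda>s. (norm (h s))\<^sup>2)) < e"
    proof eventually_elim
      case (elim n)
      show ?case
      proof
        fix u assume "u \<in> {0..T}"
        from bound[OF this \<delta>(1), of n] elim \<delta>(2)
        show "dist (simple_quadratic (S n) u \<omega>) (integral {0..u} (\<lambda>s. (norm (h s))\<^sup>2)) < e"
          unfolding dist_real_def by linarith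
      qed
    qed
  qed
qed

context brownian
begin

text \<open>Along one subsequence, almost surely, the simple integrals converge to \<open>I\<close>
  uniformly on \<open>[0, T]\<close> and the integrands converge to \<open>H\<close> in
  \<open>L2\<close> of \<open>[0, T]\<close>, hence the compensators converge uniformly too. Both
  martingales of \<open>simple_martingales\<close> then pass through
  \<open>stopped_centered_limit\<close>.\<close>

lemma Ito_integral_stopped_centered:
  fixes H :: "real \<Rightarrow> 'w \<Rightarrow> real^'k^'d" and I :: "real \<Rightarrow> 'w \<Rightarrow> real^'d"
  assumes Ito: "is_Ito_integral M F W H I" and T: "0 \<le> T"
    and Hc: "AE \<omega> in M. continuous_on {0..} (\<lambda>s. H s \<omega>)"
    and \<rho>: "bounded_stopping T \<rho>"
    and K: "AE \<omega> in M. 0 < \<rho> \<omega> \<longrightarrow> (\<forall>u\<in>{0..\<rho> \<omega>}. norm (I u \<omega>) \<le> K \<and> \<bar>integral {0..u} (\<lambda>s. (norm (H s \<omega>))\<^sup>2)\<bar> \<le> K)"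
  shows "stopped_centered \<rho> (\<lambda>u \<omega>. I u \<omega> $ a)"
    and "stopped_centered \<rho> (\<lambda>u \<omega>. (norm (I u \<omega>))\<^sup>2 - integral {0..u} (\<lambda>s. (norm (H s \<omega>))\<^sup>2))"
proof -
  from Ito obtain S where Ic: "AE \<omega> in M. continuous_on {0..} (\<lambda>s. I s \<omega>)"
    and S: "\<And>n. simple_process M F (S n)"
    and A: "tends_to_0_in_prob M (\<lambda>n \<omega>. \<integral>\<^sup>+s\<in>{0..T}. ennreal ((norm (simple_value (S n) s \<omega> - H s \<omega>))\<^sup>2) \<partial>lborel)"
    and B: "tends_to_0_in_prob M (\<lambda>n \<omega>. SUP s\<in>{0..T}. ennreal (norm (simple_integral W (S n) s \<omega> - I s \<omega>)))"
    using T unfolding is_Ito_integral_def continuous_paths_def by blast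
  obtain r where "AE \<omega> in M. (\<lambda>n. \<integral>\<^sup>+s\<in>{0..T}. ennreal ((norm (simple_value (S (r n)) s \<omega> - H s \<omega>))\<^sup>2) \<partial>lborel) \<longlonglongrightarrow> 0
      \<and> (\<lambda>n. SUP s\<in>{0..T}. ennreal (norm (simple_integral W (S (r n)) s \<omega> - I s \<omega>))) \<longlonglongrightarrow> 0"
    by (rule tends_to_0_in_prob_AE_subseq[OF A B])
  note sub = this
  let ?J = "\<lambda>n. simple_integral W (S (r n))" and ?q = "\<lambda>n. simple_quadratic (S (r n))"
  have mart: "l2_martingale (\<lambda>t \<omega>. ?J n t \<omega> $ a)" "l2_martingale (\<lambda>t \<omega>. (norm (?J n t \<omega>))\<^sup>2 - ?q n t \<omega>)" for n
    using simple_martingales[of "fst (S (r n))" "fst (snd (S (r n)))" "snd (snd (S (r n)))"] S[of "r n"] by simp_all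
  have contJ: "AE \<omega> in M. continuous_on {0..T} (\<lambda>t. ?J n t \<omega>)" for n
    using W_continuous
  proof eventually_elim
    case (elim \<omega>)
    have prem: "0 \<le> fst (snd (S (r n))) i" if "i \<le> fst (S (r n))" for i
    proof -
      have "fst (snd (S (r n))) 0 \<le> fst (snd (S (r n))) i"
        by (rule mono_upto_le[where \<tau> = "fst (snd (S (r n)))"])
          (use S[of "r n"] that in \<open>auto simp: simple_process_def split: prod.splits\<close>)
      then show ?thesis using S[of "r n"] by (auto simp: simple_process_def split: prod.splits)
    qed
    have "continuous_on {0..T} (\<lambda>t. W (min t c) \<omega>)" if "0 \<le> c" for c
      by (rule continuous_on_compose2[OF elim]) (use that in \<open>auto intro!: continuous_intros\<close>)
    then show ?case
      unfolding simple_integral_def split_beta' matrix_vector_mult_def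
      by (intro continuous_intros) (use prem in auto)
  qed
  have contq: "continuous_on {0..T} (\<lambda>t. ?q n t \<omega>)" for n \<omega>
    unfolding simple_quadratic_def split_beta' by (intro continuous_intros)
  have limJ: "AE \<omega> in M. uniform_limit {0..T} (\<lambda>n t. ?J n t \<omega>) (\<lambda>t. I t \<omega>) sequentially"
    using sub
  proof eventually_elim
    case (elim \<omega>)
    show ?case
    proof (rule uniform_limitI)
      fix e :: real assume e: "0 < e"
      have "\<forall>\<^sub>F n in sequentially. (SUP s\<in>{0..T}. ennreal (norm (?J n s \<omega> - I s \<omega>))) < ennreal e"
        using order_tendstoD(2)[OF conjunct2[OF elim], of "ennreal e"] e by simp
      then show "\<forall>\<^sub>F n in sequentially. \<forall>t\<in>{0..T}. dist (?J n t \<omega>) (I t \<omega>) < e"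
      proof eventually_elim
        case (elim n)
        show ?case
        proof
          fix t assume "t \<in> {0..T}"
          then have "ennreal (norm (?J n t \<omega> - I t \<omega>)) \<le> (SUP s\<in>{0..T}. ennreal (norm (?J n s \<omega> - I s \<omega>)))"
            by (rule SUP_upper)
          also note elim
          finally show "dist (?J n t \<omega>) (I t \<omega>) < e" using e by (simp add: dist_norm ennreal_less_iff)
        qed
      qed
    qed
  qed
  show "stopped_centered \<rho> (\<lambda>u \<omega>. I u \<omega> $ a)"
  proof (rule stopped_centered_limit[OF T mart(1) _ _ \<rho>])
    show "AE \<omega> in M. continuous_on {0..T} (\<lambda>u. ?J n u \<omega> $ a)" for n
      using contJ[of n] by eventually_elim (intro continuous_intros)
    show "AE \<omega> in M. uniform_limit {0..T} (\<lambda>n u. ?J n u \<omega> $ a) (\<lambda>u. I u \<omega> $ a) sequentially"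
      using limJ by eventually_elim (rule bounded_linear.uniform_limit[OF bounded_linear_vec_nth])
    show "AE \<omega> in M. 0 < \<rho> \<omega> \<longrightarrow> (\<forall>u\<in>{0..\<rho> \<omega>}. \<bar>I u \<omega> $ a\<bar> \<le> K)"
      using K by eventually_elim (meson component_le_norm_cart order_trans)
  qed
  show "stopped_centered \<rho> (\<lambda>u \<omega>. (norm (I u \<omega>))\<^sup>2 - integral {0..u} (\<lambda>s. (norm (H s \<omega>))\<^sup>2))"
  proof (rule stopped_centered_limit[OF T mart(2) _ _ \<rho>])
    show "AE \<omega> in M. continuous_on {0..T} (\<lambda>u. (norm (?J n u \<omega>))\<^sup>2 - ?q n u \<omega>)" for n
      using contJ[of n] by eventually_elim (intro continuous_intros contq)
    show "AE \<omega> in M. uniform_limit {0..T} (\<lambda>n u. (norm (?J n u \<omega>))\<^sup>2 - ?q n u \<omega>)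
        (\<lambda>u. (norm (I u \<omega>))\<^sup>2 - integral {0..u} (\<lambda>s. (norm (H s \<omega>))\<^sup>2)) sequentially"
      using limJ sub Ic Hc
    proof eventually_elim
      case (elim \<omega>)
      have c: "continuous_on {0..T} (\<lambda>t. norm (I t \<omega>))"
        by (intro continuous_intros continuous_on_subset[OF elim(3)]) auto
      have hc: "continuous_on {0..T} (\<lambda>t. H t \<omega>)"
        by (rule continuous_on_subset[OF elim(4)]) auto
      \<comment> \<open>Uniform convergence survives squaring because the limit path is bounded on
        the compact interval.\<close>
      have bdd: "bounded ((\<lambda>t. norm (I t \<omega>)) ` {0..T})"
        by (intro compact_imp_bounded compact_continuous_image c) simp
      have "uniform_limit {0..T} (\<lambda>n t. norm (?J n t \<omega>)) (\<lambda>t. norm (I t \<omega>)) sequentially"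
        using elim(1) by (rule uniform_limit_norm)
      then have "uniform_limit {0..T} (\<lambda>n t. norm (?J n t \<omega>) * norm (?J n t \<omega>)) (\<lambda>t. norm (I t \<omega>) * norm (I t \<omega>)) sequentially"
        by (intro uniform_lim_mult bdd)
      then have 1: "uniform_limit {0..T} (\<lambda>n t. (norm (?J n t \<omega>))\<^sup>2) (\<lambda>t. (norm (I t \<omega>))\<^sup>2) sequentially"
        by (simp add: power2_eq_square)
      have 2: "uniform_limit {0..T} (\<lambda>n u. ?q n u \<omega>) (\<lambda>u. integral {0..u} (\<lambda>s. (norm (H s \<omega>))\<^sup>2)) sequentially"
        using elim(2) by (intro simple_quadratic_uniform_limit[OF S T hc]) blast
      show ?case by (rule uniform_limit_minus[OF 1 2])
    qed
    show "AE \<omega> in M. 0 < \<rho> \<omega> \<longrightarrow> (\<forall>u\<in>{0..\<rho> \<omega>}.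
        \<bar>(norm (I u \<omega>))\<^sup>2 - integral {0..u} (\<lambda>s. (norm (H s \<omega>))\<^sup>2)\<bar> \<le> K\<^sup>2 + K)"
      using K
    proof eventually_elim
      case (elim \<omega>)
      show ?case
      proof (intro impI ballI)
        fix u assume "0 < \<rho> \<omega>" "u \<in> {0..\<rho> \<omega>}"
        then have "norm (I u \<omega>) \<le> K" "\<bar>integral {0..u} (\<lambda>s. (norm (H s \<omega>))\<^sup>2)\<bar> \<le> K" using elim by auto
        moreover from this(1) have "(norm (I u \<omega>))\<^sup>2 \<le> K\<^sup>2" by (rule power_mono) simp
        ultimately show "\<bar>(norm (I u \<omega>))\<^sup>2 - integral {0..u} (\<lambda>s. (norm (H s \<omega>))\<^sup>2)\<bar> \<le> K\<^sup>2 + K"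
          using zero_le_power2[of "norm (I u \<omega>)"] by linarith
      qed
    qed
  qed
qed

end

section \<open>The Lyapunov function\<close>

text \<open>The definite description in \<open>gradient\<close> denotes because the derivative is
  unique: two candidates have the same inner product with every vector, in particular with their own
  difference.\<close>

lemma GDERIV_gradient:
  assumes "twice_continuously_differentiable f"
  shows "GDERIV f x :> gradient f x"
proof -
  obtain g where g: "GDERIV f x :> g"
    using assms unfolding twice_continuously_differentiable_def by blast
  have "gradient f x = g"
    unfolding gradient_def
  proof (rule the_equality)
    show "GDERIV f x :> g" by (rule g)
    fix g' assume "GDERIV f x :> g'"
    then have "(\<lambda>h. h \<bullet> g') = (\<lambda>h. h \<bullet> g)"
      using g unfolding gderiv_def by (intro has_derivative_unique)
    then have "(g' - g) \<bullet> g' = (g' - g) \<bullet> g" by metis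
    then have "(g' - g) \<bullet> (g' - g) = 0" by (simp add: inner_diff_right)
    then show "g' = g" by simp
  qed
  then show ?thesis using g by simp
qed

lemma has_vector_derivative_chain:
  assumes x: "(x has_vector_derivative v) (at u within S)" and f: "(f has_derivative f') (at (x u))"
  shows "((\<lambda>u. f (x u)) has_vector_derivative f' v) (at u within S)"
proof -
  have "((\<lambda>u. f (x u)) has_derivative (\<lambda>h. f' (h *\<^sub>R v))) (at u within S)"
    using has_derivative_compose[OF x[unfolded has_vector_derivative_def] f] .
  moreover have "(\<lambda>h. f' (h *\<^sub>R v)) = (\<lambda>h. h *\<^sub>R f' v)"
    using has_derivative_linear[OF f] by (auto simp: linear_scale)
  ultimately show ?thesis by (simp add: has_vector_derivative_def)
qed

text \<open>The difference quotients of \<open>g\<close> in direction \<open>v\<close> are bounded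
  by \<open>C * norm v\<close>, and so is their limit. Applied to the gradient, this bounds the
  Hessian by the Lipschitz constant.\<close>

lemma lipschitz_derivative_bound:
  fixes g :: "'a::real_normed_vector \<Rightarrow> 'b::real_normed_vector"
  assumes lip: "C-lipschitz_on UNIV g" and g: "(g has_derivative g') (at x)"
  shows "norm (g' v) \<le> C * norm v"
proof -
  have "((\<lambda>t::real. x + t *\<^sub>R v) has_vector_derivative v) (at 0)"
    by (auto intro!: derivative_eq_intros)
  then have "((\<lambda>t. g (x + t *\<^sub>R v)) has_vector_derivative g' v) (at 0)"
    by (rule has_vector_derivative_chain) (simp add: g)
  then have lim: "((\<lambda>t. (g (x + t *\<^sub>R v) - g x - t *\<^sub>R g' v) /\<^sub>R \<bar>t\<bar>) \<longlongrightarrow> 0) (at 0)"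
    by (simp add: has_vector_derivative_def has_derivative_def)
  have "norm (g' v) - C * norm v \<le> 0"
  proof (rule tendsto_lowerbound[OF tendsto_norm_zero[OF lim]])
    show "\<forall>\<^sub>F t in at 0. norm (g' v) - C * norm v \<le> norm ((g (x + t *\<^sub>R v) - g x - t *\<^sub>R g' v) /\<^sub>R \<bar>t\<bar>)"
      unfolding eventually_at
    proof (intro exI[of _ 1] conjI ballI impI)
      fix t :: real assume "t \<noteq> 0 \<and> dist t 0 < 1"
      then have t: "0 < \<bar>t\<bar>" by simp
      have "norm (g (x + t *\<^sub>R v) - g x) \<le> C * norm (t *\<^sub>R v)"
        using lipschitz_onD[OF lip, of "x + t *\<^sub>R v" x] by (simp add: dist_norm)
      moreover have "norm (t *\<^sub>R g' v) \<le> norm (g (x + t *\<^sub>R v) - g x) + norm (g (x + t *\<^sub>R v) - g x - t *\<^sub>R g' v)"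
        using norm_triangle_ineq4[of "g (x + t *\<^sub>R v) - g x" "g (x + t *\<^sub>R v) - g x - t *\<^sub>R g' v"] by simp
      ultimately have "\<bar>t\<bar> * (norm (g' v) - C * norm v) \<le> norm (g (x + t *\<^sub>R v) - g x - t *\<^sub>R g' v)"
        by (simp add: algebra_simps)
      then have "norm (g' v) - C * norm v \<le> norm (g (x + t *\<^sub>R v) - g x - t *\<^sub>R g' v) / \<bar>t\<bar>"
        using t by (simp add: pos_le_divide_eq mult.commute)
      then show "norm (g' v) - C * norm v \<le> norm ((g (x + t *\<^sub>R v) - g x - t *\<^sub>R g' v) /\<^sub>R \<bar>t\<bar>)"
        by (simp add: divide_inverse mult.commute)
    qed simp
  qed simp
  then show ?thesis by simp
qed

text \<open>Along the segment from \<open>x\<close> to \<open>x + w\<close>, the difference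
  \<open>\<phi>\<close> between \<open>f\<close> and the quadratic bound has nonpositive derivative,
  by Cauchy-Schwarz and the Lipschitz bound on \<open>g\<close>.\<close>

lemma descent_lemma:
  fixes f :: "'a::real_inner \<Rightarrow> real"
  assumes f: "\<And>x. (f has_derivative (\<lambda>h. h \<bullet> g x)) (at x)" and lip: "C-lipschitz_on UNIV g"
  shows "f (x + w) \<le> f x + w \<bullet> g x + C / 2 * (norm w)\<^sup>2"
proof -
  define \<phi> where "\<phi> s = f (x + s *\<^sub>R w) - s * (w \<bullet> g x) - C / 2 * s\<^sup>2 * (norm w)\<^sup>2" for s
  have "\<phi> 1 \<le> \<phi> 0"
  proof (rule DERIV_nonpos_imp_nonincreasing[where f = \<phi>])
    fix s :: real assume s: "0 \<le> s" "s \<le> 1"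
    have "((\<lambda>s. x + s *\<^sub>R w) has_vector_derivative w) (at s)"
      by (auto intro!: derivative_eq_intros)
    then have "((\<lambda>s. f (x + s *\<^sub>R w)) has_vector_derivative w \<bullet> g (x + s *\<^sub>R w)) (at s)"
      by (rule has_vector_derivative_chain[OF _ f])
    then have "((\<lambda>s. f (x + s *\<^sub>R w)) has_real_derivative w \<bullet> g (x + s *\<^sub>R w)) (at s)"
      by (simp add: has_real_derivative_iff_has_vector_derivative)
    then have "(\<phi> has_real_derivative w \<bullet> g (x + s *\<^sub>R w) - w \<bullet> g x - C * s * (norm w)\<^sup>2) (at s)"
      unfolding \<phi>_def by (auto intro!: derivative_eq_intros)
    moreover have "w \<bullet> g (x + s *\<^sub>R w) - w \<bullet> g x - C * s * (norm w)\<^sup>2 \<le> 0"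
    proof -
      have "w \<bullet> (g (x + s *\<^sub>R w) - g x) \<le> norm w * norm (g (x + s *\<^sub>R w) - g x)" by (rule norm_cauchy_schwarz)
      also have "\<dots> \<le> norm w * (C * norm (s *\<^sub>R w))"
        using lipschitz_onD[OF lip, of "x + s *\<^sub>R w" x] by (intro mult_left_mono) (simp_all add: dist_norm)
      also have "\<dots> = C * s * (norm w)\<^sup>2" using s by (simp add: power2_eq_square)
      finally show ?thesis by (simp add: inner_diff_right)
    qed
    ultimately show "\<exists>y. (\<phi> has_real_derivative y) (at s) \<and> y \<le> 0" by blast
  qed simp
  then show ?thesis by (simp add: \<phi>_def)
qed

text \<open>The step \<open>- g x / C\<close> minimizes the quadratic bound of
  \<open>descent_lemma\<close>; since \<open>f\<close> is nonnegative at the point reached, the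
  decrease \<open>|g x|^2 / (2 C)\<close> cannot exceed \<open>f x\<close>.\<close>

lemma gradient_norm_le:
  fixes f :: "'a::real_inner \<Rightarrow> real"
  assumes f: "\<And>x. (f has_derivative (\<lambda>h. h \<bullet> g x)) (at x)" and lip: "C-lipschitz_on UNIV g"
    and C: "0 < C" and nonneg: "\<And>x. 0 \<le> f x"
  shows "(norm (g x))\<^sup>2 \<le> 2 * C * f x"
proof -
  have "0 \<le> f (x + (- 1 / C) *\<^sub>R g x)" by (rule nonneg)
  also have "\<dots> \<le> f x + ((- 1 / C) *\<^sub>R g x) \<bullet> g x + C / 2 * (norm ((- 1 / C) *\<^sub>R g x))\<^sup>2"
    by (rule descent_lemma[OF f lip])
  also have "\<dots> = f x - (norm (g x))\<^sup>2 / (2 * C)"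
    using C by (simp add: power2_norm_eq_inner[symmetric] power_mult_distrib power_divide power2_eq_square field_simps)
  finally show ?thesis using C by (simp add: field_simps)
qed

lemma lyapunov_lower_bound:
  fixes C b \<mu> :: real
  assumes C: "0 < C" and b: "0 < b" "b * C < \<mu>"
  obtains \<kappa> where "0 < \<kappa>"
    and "\<And>F (g :: 'a::real_inner) v. (norm g)\<^sup>2 \<le> 2 * C * F \<Longrightarrow>
      F / 2 + \<kappa> * (norm v)\<^sup>2 \<le> (1 + b * \<mu>) * F + b * (g \<bullet> v) + (norm v)\<^sup>2 / 2"
proof
  define c where "c = b\<^sup>2 * C"
  \<comment> \<open>The weight of Young's inequality for the mixed term. It exceeds
    \<open>1\<close>, which leaves a positive multiple of \<open>|v|^2\<close>, and is close enough
    to \<open>1\<close> that \<open>\<theta> * c \<le> c + 1 / 2\<close>; as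
    \<open>c \<le> b * \<mu>\<close>, half of \<open>F\<close> survives.\<close>
  define \<theta> where "\<theta> = 1 + 1 / (2 * (c + 1))"
  have c: "0 < c" using C b by (simp add: c_def)
  have \<theta>: "1 < \<theta>" "\<theta> * c \<le> c + 1 / 2" using c by (simp_all add: \<theta>_def field_simps)
  show "0 < (1 - 1 / \<theta>) / 2" using \<theta> by simp
  fix F :: real and g v :: 'a
  assume g: "(norm g)\<^sup>2 \<le> 2 * C * F"
  have F: "0 \<le> F" using g C by (smt (verit) zero_le_power2 mult_less_0_iff)
  have "- (g \<bullet> v) \<le> norm g * norm v" using norm_cauchy_schwarz[of "- g" v] by simp
  then have "- (b * (g \<bullet> v)) \<le> b * (norm g * norm v)" using mult_left_mono[of _ _ b] b by fastforce
  also have "b * (norm g * norm v) \<le> (\<theta> * b\<^sup>2 * (norm g)\<^sup>2 + (norm v)\<^sup>2 / \<theta>) / 2"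
  proof -
    have "0 \<le> (\<theta> * b * norm g - norm v)\<^sup>2 / \<theta>" using \<theta> by simp
    also have "\<dots> = \<theta> * b\<^sup>2 * (norm g)\<^sup>2 + (norm v)\<^sup>2 / \<theta> - 2 * (b * (norm g * norm v))"
      using \<theta> by (simp add: power2_diff field_simps power2_eq_square)
    finally show ?thesis by simp
  qed
  also have "\<theta> * b\<^sup>2 * (norm g)\<^sup>2 \<le> 2 * ((b * \<mu> + 1 / 2) * F)"
  proof -
    have "\<theta> * b\<^sup>2 * (norm g)\<^sup>2 \<le> \<theta> * b\<^sup>2 * (2 * C * F)" using g \<theta> by (intro mult_left_mono) auto
    also have "\<dots> = 2 * ((\<theta> * c) * F)" by (simp add: c_def)
    also have "(\<theta> * c) * F \<le> (b * \<mu> + 1 / 2) * F"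
    proof (rule mult_right_mono[OF _ F])
      have "c \<le> b * \<mu>" using b mult_left_mono[of "b * C" \<mu> b] by (simp add: c_def power2_eq_square mult_ac)
      then show "\<theta> * c \<le> b * \<mu> + 1 / 2" using \<theta>(2) by simp
    qed
    finally show ?thesis by simp
  qed
  finally have "- (b * (g \<bullet> v)) \<le> (b * \<mu> + 1 / 2) * F + (norm v)\<^sup>2 / \<theta> / 2" by (simp add: add_divide_distrib)
  then show "F / 2 + (1 - 1 / \<theta>) / 2 * (norm v)\<^sup>2 \<le> (1 + b * \<mu>) * F + b * (g \<bullet> v) + (norm v)\<^sup>2 / 2"
    by (simp add: algebra_simps diff_divide_distrib)
qed

lemma lyapunov_drift_bound:
  fixes C b \<mu> L \<sigma> :: real
  assumes "0 < C" and b: "\<sigma> / (4 * L) < b" "b * C < \<mu>" and L: "0 < L" and \<sigma>: "0 < \<sigma>"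
  obtains m where "0 < m"
    and "\<And>F (g :: 'a::real_inner) v h S. 2 * L * F \<le> (norm g)\<^sup>2 \<Longrightarrow> S \<le> \<sigma> * F \<Longrightarrow> norm h \<le> C * norm v \<Longrightarrow>
      m * ((1 + b * \<mu>) * F + b * (g \<bullet> v) + (norm v)\<^sup>2 / 2)
       + ((1 + b * \<mu>) * (g \<bullet> v) + b * (h \<bullet> v) - (b *\<^sub>R g + v) \<bullet> (\<mu> *\<^sub>R v + g) + S / 2) \<le> 0"
proof -
  \<comment> \<open>\<open>c1\<close> and \<open>c2\<close> are the dissipation rates of
    \<open>|v|^2\<close> and \<open>|g|^2\<close> in the drift, and \<open>e1\<close> and
    \<open>e2\<close> the weights of the same quantities in an upper bound for the Lyapunov
    function. The smaller of the ratios \<open>c1 / e1\<close> and \<open>c2 / e2\<close> is then an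
    admissible decay rate \<open>m\<close>.\<close>
  define c1 c2 e1 e2 where "c1 = \<mu> - b * C" and "c2 = b - \<sigma> / (4 * L)"
    and "e1 = (b + 1) / 2" and "e2 = (1 + b * \<mu>) / (2 * L) + b / 2"
  have b0: "0 < b" using b(1) L \<sigma> by (smt (verit) divide_pos_pos)
  have \<mu>0: "0 < \<mu>" using b(2) b0 \<open>0 < C\<close> by (smt (verit) mult_pos_pos)
  have c: "0 < c1" "0 < c2" using b by (simp_all add: c1_def c2_def)
  have e: "0 < e1" "0 < e2" using b0 \<mu>0 L by (simp_all add: e1_def e2_def add_pos_pos)
  define m where "m = min (c1 / e1) (c2 / e2)"
  have m: "0 < m" "m * e1 \<le> c1" "m * e2 \<le> c2"
    using c e by (simp_all add: m_def min_def field_simps)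
  show thesis
  proof (rule that[OF m(1)])
    fix F S :: real and g v h :: 'a
    assume F: "2 * L * F \<le> (norm g)\<^sup>2" and S: "S \<le> \<sigma> * F" and h: "norm h \<le> C * norm v"
    have F': "F \<le> (norm g)\<^sup>2 / (2 * L)" using F L by (simp add: field_simps)
    have hv: "h \<bullet> v \<le> C * (norm v)\<^sup>2"
      using norm_cauchy_schwarz[of h v] mult_right_mono[OF h, of "norm v"] by (simp add: power2_eq_square mult.assoc)
    have gv: "g \<bullet> v \<le> ((norm g)\<^sup>2 + (norm v)\<^sup>2) / 2"
      using norm_cauchy_schwarz[of g v] sum_squares_bound[of "norm g" "norm v"] by simp
    have upper: "(1 + b * \<mu>) * F + b * (g \<bullet> v) + (norm v)\<^sup>2 / 2 \<le> e2 * (norm g)\<^sup>2 + e1 * (norm v)\<^sup>2"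
    proof -
      have "(1 + b * \<mu>) * F \<le> (1 + b * \<mu>) * ((norm g)\<^sup>2 / (2 * L))"
        using F' b0 \<mu>0 by (intro mult_left_mono) auto
      moreover have "b * (g \<bullet> v) \<le> b * (((norm g)\<^sup>2 + (norm v)\<^sup>2) / 2)"
        using gv b0 by (intro mult_left_mono) auto
      ultimately show ?thesis by (simp add: e1_def e2_def algebra_simps add_divide_distrib)
    qed
    have "m * ((1 + b * \<mu>) * F + b * (g \<bullet> v) + (norm v)\<^sup>2 / 2) \<le> m * (e2 * (norm g)\<^sup>2 + e1 * (norm v)\<^sup>2)"
      using upper m(1) by (intro mult_left_mono) auto
    also have "\<dots> = (m * e2) * (norm g)\<^sup>2 + (m * e1) * (norm v)\<^sup>2" by (simp add: algebra_simps)
    also have "\<dots> \<le> c2 * (norm g)\<^sup>2 + c1 * (norm v)\<^sup>2"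
      using m by (intro add_mono mult_right_mono) auto
    finally have 1: "m * ((1 + b * \<mu>) * F + b * (g \<bullet> v) + (norm v)\<^sup>2 / 2) \<le> c2 * (norm g)\<^sup>2 + c1 * (norm v)\<^sup>2" .
    have "S / 2 \<le> \<sigma> / (4 * L) * (norm g)\<^sup>2"
    proof -
      have "S / 2 \<le> \<sigma> / 2 * F" using S by simp
      also have "\<dots> \<le> \<sigma> / 2 * ((norm g)\<^sup>2 / (2 * L))" using F' \<sigma> by (intro mult_left_mono) auto
      finally show ?thesis by simp
    qed
    moreover have "b * (h \<bullet> v) \<le> b * (C * (norm v)\<^sup>2)" using hv b0 by (intro mult_left_mono) auto
    \<comment> \<open>The last summand is the cross term that cancels
      \<open>(1 + b * \<mu>) * (g \<bullet> v)\<close> in the drift.\<close>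
    moreover have "(b *\<^sub>R g + v) \<bullet> (\<mu> *\<^sub>R v + g) = b * (norm g)\<^sup>2 + \<mu> * (norm v)\<^sup>2 + (1 + b * \<mu>) * (g \<bullet> v)"
      by (simp add: power2_norm_eq_inner inner_add_left inner_add_right inner_commute algebra_simps)
    ultimately have "(1 + b * \<mu>) * (g \<bullet> v) + b * (h \<bullet> v) - (b *\<^sub>R g + v) \<bullet> (\<mu> *\<^sub>R v + g) + S / 2
        \<le> - (c2 * (norm g)\<^sup>2 + c1 * (norm v)\<^sup>2)"
      by (simp add: c1_def c2_def algebra_simps)
    with 1 show "m * ((1 + b * \<mu>) * F + b * (g \<bullet> v) + (norm v)\<^sup>2 / 2)
       + ((1 + b * \<mu>) * (g \<bullet> v) + b * (h \<bullet> v) - (b *\<^sub>R g + v) \<bullet> (\<mu> *\<^sub>R v + g) + S / 2) \<le> 0"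
      by linarith
  qed
qed


section \<open>Insensitivity to changes on null sets\<close>

context usual_filtration
begin

text \<open>By completeness the two functions are either both measurable or both not; in the second
  case both integrals are \<open>0\<close> by convention.\<close>

lemma integral_cong_AE_complete:
  fixes f g :: "'w \<Rightarrow> real"
  assumes eq: "AE \<omega> in M. f \<omega> = g \<omega>"
  shows "(\<integral>\<omega>. f \<omega> \<partial>M) = (\<integral>\<omega>. g \<omega> \<partial>M)"
proof (cases "f \<in> borel_measurable M")
  case True
  then have "g \<in> borel_measurable M" by (rule measurable_M_AE[OF _ eq])
  with True eq show ?thesis by (intro integral_cong_AE)
next
  case False
  have eq': "AE \<omega> in M. g \<omega> = f \<omega>" using eq by eventually_elim simp
  have "g \<notin> borel_measurable M" using False measurable_M_AE[OF _ eq'] by blast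
  then have "\<not> integrable M f" "\<not> integrable M g" using False by auto
  then show ?thesis by (simp add: not_integrable_integral_eq)
qed

lemma stopped_centered_cong_AE:
  assumes N: "stopped_centered \<rho> N" and \<rho>: "bounded_stopping T \<rho>"
    and eq: "AE \<omega> in M. \<forall>u\<ge>0. N u \<omega> = N' u \<omega>"
  shows "stopped_centered \<rho> N'"
  unfolding stopped_centered_def
proof (intro allI impI)
  fix s :: real and z :: "'w \<Rightarrow> real" and B :: real
  assume s: "0 \<le> s" and z: "z \<in> borel_measurable (F s)" and B: "\<forall>\<omega>\<in>space M. s < \<rho> \<omega> \<longrightarrow> \<bar>z \<omega>\<bar> \<le> B"
  have "(\<integral>\<omega>. z \<omega> * (indicator {\<omega>. s < \<rho> \<omega>} \<omega> * (N' (\<rho> \<omega>) \<omega> - N' s \<omega>)) \<partial>M)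
      = (\<integral>\<omega>. z \<omega> * (indicator {\<omega>. s < \<rho> \<omega>} \<omega> * (N (\<rho> \<omega>) \<omega> - N s \<omega>)) \<partial>M)"
  proof (rule integral_cong_AE_complete)
    show "AE \<omega> in M. z \<omega> * (indicator {\<omega>. s < \<rho> \<omega>} \<omega> * (N' (\<rho> \<omega>) \<omega> - N' s \<omega>))
        = z \<omega> * (indicator {\<omega>. s < \<rho> \<omega>} \<omega> * (N (\<rho> \<omega>) \<omega> - N s \<omega>))"
      using eq AE_space[of M]
    proof eventually_elim
      case (elim \<omega>)
      then show ?case using bounded_stopping_bounds(1)[OF \<rho> elim(2)] s by simp
    qed
  qed
  also have "\<dots> = 0" by (rule stopped_centeredD[OF N s z, of B]) (use B in blast)
  finally show "(\<integral>\<omega>. z \<omega> * (indicator {\<omega>. s < \<rho> \<omega>} \<omega> * (N' (\<rho> \<omega>) \<omega> - N' s \<omega>)) \<partial>M) = 0" .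
qed

end

section \<open>The stopped Lyapunov process\<close>

lemma continuous_on_matrix_vector_mult [continuous_intros]:
  fixes A :: "'a::topological_space \<Rightarrow> real^'n^'m"
  assumes "continuous_on S A" "continuous_on S x"
  shows "continuous_on S (\<lambda>u. A u *v x u)"
  unfolding matrix_vector_mult_def by (intro continuous_intros assms)

text \<open>\<open>X\<close>, \<open>V\<close> and \<open>I\<close> have been modified on a null set so that the equations and continuity hold for
  every outcome; \<open>X0\<close> and \<open>I0\<close> are the unmodified processes entering the Ito integral.\<close>

locale kinetic = brownian M F W for M :: "'w measure" and F and W :: "real \<Rightarrow> 'w \<Rightarrow> real^'k" +
  fixes X V I X0 I0 :: "real \<Rightarrow> 'w \<Rightarrow> real^'d"
    and f :: "real^'d \<Rightarrow> real" and g :: "real^'d \<Rightarrow> real^'d" and H :: "real^'d \<Rightarrow> real^'d^'d"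
    and \<Sigma> :: "real^'d \<Rightarrow> real^'k^'d" and \<mu> :: real
  assumes X_adapted: "\<And>t. 0 \<le> t \<Longrightarrow> X t \<in> borel_measurable (F t)"
    and V_adapted: "\<And>t. 0 \<le> t \<Longrightarrow> V t \<in> borel_measurable (F t)"
    and I_adapted: "\<And>t. 0 \<le> t \<Longrightarrow> I t \<in> borel_measurable (F t)"
    and X_cont: "\<And>\<omega>. \<omega> \<in> space M \<Longrightarrow> continuous_on {0..} (\<lambda>t. X t \<omega>)"
    and V_cont: "\<And>\<omega>. \<omega> \<in> space M \<Longrightarrow> continuous_on {0..} (\<lambda>t. V t \<omega>)"
    and I_cont: "\<And>\<omega>. \<omega> \<in> space M \<Longrightarrow> continuous_on {0..} (\<lambda>t. I t \<omega>)"
    and X_eq: "\<And>\<omega> t. \<omega> \<in> space M \<Longrightarrow> 0 \<le> t \<Longrightarrow> X t \<omega> = X 0 \<omega> + integral {0..t} (\<lambda>s. V s \<omega>)"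
    and V_eq: "\<And>\<omega> t. \<omega> \<in> space M \<Longrightarrow> 0 \<le> t \<Longrightarrow>
      V t \<omega> = V 0 \<omega> - integral {0..t} (\<lambda>s. \<mu> *\<^sub>R V s \<omega> + g (X s \<omega>)) + I t \<omega>"
    and Ito: "is_Ito_integral M F W (\<lambda>t \<omega>. \<Sigma> (X0 t \<omega>)) I0"
    and X0_eq: "AE \<omega> in M. \<forall>t\<ge>0. X t \<omega> = X0 t \<omega> \<and> I t \<omega> = I0 t \<omega>"
    and f_deriv: "\<And>x. (f has_derivative (\<lambda>h. h \<bullet> g x)) (at x)"
    and g_deriv: "\<And>x. (g has_derivative (\<lambda>h. H x *v h)) (at x)"
    and H_cont: "continuous_on UNIV H"
    and \<Sigma>_cont: "continuous_on UNIV \<Sigma>"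
begin

lemma g_cont: "continuous_on UNIV g"
  using g_deriv by (meson has_derivative_continuous continuous_at_imp_continuous_on)

lemma f_cont: "continuous_on UNIV f"
  using f_deriv by (meson has_derivative_continuous continuous_at_imp_continuous_on)

text \<open>The trace of the quadratic variation of \<open>I\<close>, hence the compensator of
  \<open>|I|^2\<close>.\<close>

definition Q :: "real \<Rightarrow> 'w \<Rightarrow> real" where
  "Q u \<omega> = integral {0..u} (\<lambda>s. (norm (\<Sigma> (X s \<omega>)))\<^sup>2)"

lemma \<Sigma>X_cont: "\<omega> \<in> space M \<Longrightarrow> continuous_on {0..} (\<lambda>s. (norm (\<Sigma> (X s \<omega>)))\<^sup>2)"
  by (intro continuous_intros continuous_on_compose2[OF \<Sigma>_cont X_cont]) auto

text \<open>Subtracting \<open>I\<close> from \<open>V\<close> removes the part without pathwise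
  derivative; what is left are time integrals of continuous paths.\<close>

lemma derivatives:
  assumes w: "\<omega> \<in> space M" and u: "u \<in> {0..r}"
  shows "((\<lambda>u. X u \<omega>) has_vector_derivative V u \<omega>) (at u within {0..r})"
    and "((\<lambda>u. V u \<omega> - I u \<omega>) has_vector_derivative - (\<mu> *\<^sub>R V u \<omega> + g (X u \<omega>))) (at u within {0..r})"
    and "((\<lambda>u. Q u \<omega>) has_vector_derivative (norm (\<Sigma> (X u \<omega>)))\<^sup>2) (at u within {0..r})"
proof -
  have sub: "{0..r} \<subseteq> {0..}" by auto
  have c: "continuous_on {0..r} (\<lambda>s. V s \<omega>)" "continuous_on {0..r} (\<lambda>s. \<mu> *\<^sub>R V s \<omega> + g (X s \<omega>))"
    by (intro continuous_intros continuous_on_compose2[OF g_cont] continuous_on_subset[OF V_cont[OF w] sub]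
        continuous_on_subset[OF X_cont[OF w] sub]; simp)+
  show "((\<lambda>u. X u \<omega>) has_vector_derivative V u \<omega>) (at u within {0..r})"
  proof (rule has_vector_derivative_transform[OF u])
    show "((\<lambda>u. X 0 \<omega> + integral {0..u} (\<lambda>s. V s \<omega>)) has_vector_derivative V u \<omega>) (at u within {0..r})"
      using has_vector_derivative_add[OF has_vector_derivative_const integral_has_vector_derivative[OF c(1) u]] by simp
    fix t assume "t \<in> {0..r}"
    then show "X t \<omega> = X 0 \<omega> + integral {0..t} (\<lambda>s. V s \<omega>)" by (intro X_eq[OF w]) simp
  qed
  show "((\<lambda>u. V u \<omega> - I u \<omega>) has_vector_derivative - (\<mu> *\<^sub>R V u \<omega> + g (X u \<omega>))) (at u within {0..r})"
  proof (rule has_vector_derivative_transform[OF u])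
    show "((\<lambda>u. V 0 \<omega> - integral {0..u} (\<lambda>s. \<mu> *\<^sub>R V s \<omega> + g (X s \<omega>))) has_vector_derivative
        - (\<mu> *\<^sub>R V u \<omega> + g (X u \<omega>))) (at u within {0..r})"
      using has_vector_derivative_diff[OF has_vector_derivative_const integral_has_vector_derivative[OF c(2) u]] by simp
    fix t assume "t \<in> {0..r}"
    then have e: "V t \<omega> = V 0 \<omega> - integral {0..t} (\<lambda>s. \<mu> *\<^sub>R V s \<omega> + g (X s \<omega>)) + I t \<omega>"
      by (intro V_eq[OF w]) simp
    show "V t \<omega> - I t \<omega> = V 0 \<omega> - integral {0..t} (\<lambda>s. \<mu> *\<^sub>R V s \<omega> + g (X s \<omega>))"
      by (subst e) simp
  qed
  show "((\<lambda>u. Q u \<omega>) has_vector_derivative (norm (\<Sigma> (X u \<omega>)))\<^sup>2) (at u within {0..r})"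
    unfolding Q_def by (rule integral_has_vector_derivative[OF continuous_on_subset[OF \<Sigma>X_cont[OF w] sub] u])
qed

lemma Q_measurable:
  assumes u: "0 \<le> u" shows "Q u \<in> borel_measurable M"
proof -
  have m: "(\<lambda>\<omega>. (norm (\<Sigma> (X s \<omega>)))\<^sup>2) \<in> borel_measurable M" if "0 \<le> s" for s
    using measurable_F_M[OF that X_adapted[OF that]] borel_measurable_continuous_onI[OF \<Sigma>_cont] by measurable
  have j: "(\<lambda>(s, \<omega>). (norm (\<Sigma> (X (max 0 s) \<omega>)))\<^sup>2) \<in> borel_measurable (borel \<Otimes>\<^sub>M M)"
    by (rule measurable_continuous_process[where Y = "\<lambda>s \<omega>. (norm (\<Sigma> (X s \<omega>)))\<^sup>2", OF m \<Sigma>X_cont])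
  have [measurable]: "(\<lambda>p. (norm (\<Sigma> (X (max 0 (snd p)) (fst p))))\<^sup>2) \<in> borel_measurable (M \<Otimes>\<^sub>M lborel)"
  proof -
    have "(\<lambda>p. (\<lambda>(s, \<omega>). (norm (\<Sigma> (X (max 0 s) \<omega>)))\<^sup>2) (snd p, fst p)) \<in> borel_measurable (M \<Otimes>\<^sub>M lborel)"
      by (rule measurable_compose[OF _ j]) measurable
    then show ?thesis by simp
  qed
  have meas: "(\<lambda>\<omega>. \<integral>s. indicator {0..u} s * (norm (\<Sigma> (X (max 0 s) \<omega>)))\<^sup>2 \<partial>lborel) \<in> borel_measurable M"
    by (rule sigma_finite_measure.borel_measurable_lebesgue_integral[OF sigma_finite_lborel])
      (simp add: split_beta')
  have eq: "(\<integral>s. indicator {0..u} s * (norm (\<Sigma> (X (max 0 s) \<omega>)))\<^sup>2 \<partial>lborel) = Q u \<omega>" if w: "\<omega> \<in> space M" for \<omega>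
  proof -
    have "(\<integral>s. indicator {0..u} s * (norm (\<Sigma> (X (max 0 s) \<omega>)))\<^sup>2 \<partial>lborel) = (LINT s:{0..u}|lborel. (norm (\<Sigma> (X s \<omega>)))\<^sup>2)"
      unfolding set_lebesgue_integral_def by (rule Bochner_Integration.integral_cong) (auto simp: indicator_def max_absorb2)
    also have "\<dots> = Q u \<omega>"
      unfolding Q_def
      by (intro set_borel_integral_eq_integral(2) borel_integrable_atLeastAtMost' continuous_on_subset[OF \<Sigma>X_cont[OF w]]) auto
    finally show ?thesis .
  qed
  show ?thesis
    by (rule iffD1[OF measurable_cong meas]) (rule eq)
qed

lemma Q_cont:
  assumes w: "\<omega> \<in> space M" shows "continuous_on {0..} (\<lambda>u. Q u \<omega>)"
  unfolding continuous_on_eq_continuous_within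
proof
  fix u :: real assume u: "u \<in> {0..}"
  have "continuous (at u within {0..u + 1}) (\<lambda>u. Q u \<omega>)"
    using derivatives(3)[OF w, of u "u + 1"] u
    by (auto intro!: has_derivative_continuous simp: has_vector_derivative_def)
  moreover have "at u within {0..} = at u within {0..u + 1}"
    by (rule at_within_nhd[of u "{..<u + 1}"]) (use u in auto)
  ultimately show "continuous (at u within {0..}) (\<lambda>u. Q u \<omega>)" by simp
qed


section \<open>The Lyapunov function, its drift, and its expectation at a localizing stopping
  time\<close>

definition lyapunov :: "real \<Rightarrow> real^'d \<Rightarrow> real^'d \<Rightarrow> real" where
  "lyapunov b x v = (1 + b * \<mu>) * f x + b * (g x \<bullet> v) + (norm v)\<^sup>2 / 2"

text \<open>The generator of the system applied to \<open>lyapunov b\<close>; the vector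
  \<open>b *\<^sub>R g x + v\<close> is the gradient in \<open>v\<close>, and the last summand is
  the Ito correction, the second derivative in \<open>v\<close> being the identity.\<close>

definition drift :: "real \<Rightarrow> real^'d \<Rightarrow> real^'d \<Rightarrow> real" where
  "drift b x v = (1 + b * \<mu>) * (g x \<bullet> v) + b * ((H x *v v) \<bullet> v) - (b *\<^sub>R g x + v) \<bullet> (\<mu> *\<^sub>R v + g x)
     + (norm (\<Sigma> x))\<^sup>2 / 2"

text \<open>Up to \<open>\<rho>\<close>, time and state stay in a compact set, so a continuous
  function of them is bounded. It supplies the uniform bounds that integration by parts up to
  \<open>\<rho>\<close> requires.\<close>

lemma stopped_state_bounded:
  assumes \<Phi>: "continuous_on UNIV (\<Phi> :: real \<times> (real^'d) \<times> (real^'d) \<times> (real^'d) \<Rightarrow> 'b::real_normed_vector)"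
    and \<rho>: "bounded_stopping T \<rho>"
    and R: "\<And>\<omega> u. \<omega> \<in> space M \<Longrightarrow> 0 < \<rho> \<omega> \<Longrightarrow> u \<in> {0..\<rho> \<omega>} \<Longrightarrow>
      norm (X u \<omega>) \<le> R \<and> norm (V u \<omega>) \<le> R \<and> norm (I u \<omega>) \<le> R"
  obtains B where "0 \<le> B" "\<And>\<omega> u. \<omega> \<in> space M \<Longrightarrow> 0 < \<rho> \<omega> \<Longrightarrow> u \<in> {0..\<rho> \<omega>} \<Longrightarrow>
      norm (\<Phi> (u, X u \<omega>, V u \<omega>, I u \<omega>)) \<le> B"
proof -
  let ?K = "{0..T} \<times> cball 0 R \<times> cball 0 R \<times> cball 0 R :: (real \<times> (real^'d) \<times> (real^'d) \<times> (real^'d)) set"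
  have "compact (\<Phi> ` ?K)"
    by (intro compact_continuous_image continuous_on_subset[OF \<Phi>] compact_Times compact_cball) auto
  then have "bounded (\<Phi> ` ?K)" by (rule compact_imp_bounded)
  then obtain B where "\<forall>y\<in>\<Phi> ` ?K. norm y \<le> B" unfolding bounded_iff by blast
  then have B: "norm (\<Phi> p) \<le> B" if "p \<in> ?K" for p using that by blast
  show thesis
  proof (rule that[of "\<bar>B\<bar>"])
    fix \<omega> u assume w: "\<omega> \<in> space M" and u: "0 < \<rho> \<omega>" "u \<in> {0..\<rho> \<omega>}"
    have "(u, X u \<omega>, V u \<omega>, I u \<omega>) \<in> ?K"
      using R[OF w u] u(2) bounded_stopping_bounds(2)[OF \<rho> w] by (simp add: mem_Times_iff)
    from B[OF this] show "norm (\<Phi> (u, X u \<omega>, V u \<omega>, I u \<omega>)) \<le> \<bar>B\<bar>" by simp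
  qed simp
qed

lemma state_function_adapted:
  fixes \<Phi> :: "real \<times> (real^'d) \<times> (real^'d) \<times> (real^'d) \<Rightarrow> 'b::topological_space"
  assumes \<Phi>: "continuous_on UNIV \<Phi>" and u: "0 \<le> u"
  shows "(\<lambda>\<omega>. \<Phi> (u, X u \<omega>, V u \<omega>, I u \<omega>)) \<in> borel_measurable (F u)"
proof -
  note [measurable] = X_adapted[OF u] V_adapted[OF u] I_adapted[OF u]
  have "(\<lambda>\<omega>. (u, X u \<omega>, V u \<omega>, I u \<omega>)) \<in> borel_measurable (F u)" by measurable
  from measurable_compose[OF this borel_measurable_continuous_onI[OF \<Phi>]] show ?thesis .
qed

lemma state_function_continuous:
  fixes \<Phi> :: "real \<times> (real^'d) \<times> (real^'d) \<times> (real^'d) \<Rightarrow> 'b::topological_space"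
  assumes \<Phi>: "continuous_on UNIV \<Phi>" and w: "\<omega> \<in> space M"
  shows "continuous_on {0..} (\<lambda>u. \<Phi> (u, X u \<omega>, V u \<omega>, I u \<omega>))"
  by (intro continuous_on_compose2[OF \<Phi>] continuous_intros X_cont V_cont I_cont w) auto

text \<open>Transfers \<open>Ito_integral_stopped_centered\<close> from the processes of the Ito
  integral to the modified ones, with which they agree almost surely.\<close>

lemma centered_processes:
  assumes T: "0 \<le> T" and \<rho>: "bounded_stopping T \<rho>"
    and K: "\<And>\<omega> u. \<omega> \<in> space M \<Longrightarrow> 0 < \<rho> \<omega> \<Longrightarrow> u \<in> {0..\<rho> \<omega>} \<Longrightarrow> norm (I u \<omega>) \<le> K \<and> \<bar>Q u \<omega>\<bar> \<le> K"
  shows "stopped_centered \<rho> (\<lambda>u \<omega>. I u \<omega> $ j)"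
    and "stopped_centered \<rho> (\<lambda>u \<omega>. (norm (I u \<omega>))\<^sup>2 - Q u \<omega>)"
proof -
  have Qeq: "integral {0..u} (\<lambda>s. (norm (\<Sigma> (X0 s \<omega>)))\<^sup>2) = Q u \<omega>"
    if "\<forall>t\<ge>0. X t \<omega> = X0 t \<omega> \<and> I t \<omega> = I0 t \<omega>" for u \<omega>
    unfolding Q_def by (rule integral_cong) (use that in simp)
  have Hc: "AE \<omega> in M. continuous_on {0..} (\<lambda>s. \<Sigma> (X0 s \<omega>))"
    using X0_eq AE_space[of M]
  proof eventually_elim
    case (elim \<omega>)
    have "continuous_on {0..} (\<lambda>s. \<Sigma> (X s \<omega>))"
      by (intro continuous_on_compose2[OF \<Sigma>_cont X_cont[OF elim(2)]]) auto
    then show ?case by (rule continuous_on_eq) (use elim(1) in simp)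
  qed
  have K0: "AE \<omega> in M. 0 < \<rho> \<omega> \<longrightarrow> (\<forall>u\<in>{0..\<rho> \<omega>}. norm (I0 u \<omega>) \<le> K \<and>
      \<bar>integral {0..u} (\<lambda>s. (norm (\<Sigma> (X0 s \<omega>)))\<^sup>2)\<bar> \<le> K)"
    using X0_eq AE_space[of M]
  proof eventually_elim
    case (elim \<omega>)
    show ?case
    proof (intro impI ballI)
      fix u assume "0 < \<rho> \<omega>" "u \<in> {0..\<rho> \<omega>}"
      then show "norm (I0 u \<omega>) \<le> K \<and> \<bar>integral {0..u} (\<lambda>s. (norm (\<Sigma> (X0 s \<omega>)))\<^sup>2)\<bar> \<le> K"
        using K[OF elim(2), of u] elim(1) Qeq[OF elim(1), of u] by auto
    qed
  qed
  note ito = Ito_integral_stopped_centered[OF Ito T Hc \<rho> K0]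
  show "stopped_centered \<rho> (\<lambda>u \<omega>. I u \<omega> $ j)"
  proof (rule stopped_centered_cong_AE[OF ito(1) \<rho>])
    show "AE \<omega> in M. \<forall>u\<ge>0. I0 u \<omega> $ j = I u \<omega> $ j" using X0_eq by eventually_elim simp
  qed
  show "stopped_centered \<rho> (\<lambda>u \<omega>. (norm (I u \<omega>))\<^sup>2 - Q u \<omega>)"
  proof (rule stopped_centered_cong_AE[OF ito(2) \<rho>])
    show "AE \<omega> in M. \<forall>u\<ge>0. (norm (I0 u \<omega>))\<^sup>2 - integral {0..u} (\<lambda>s. (norm (\<Sigma> (X0 s \<omega>)))\<^sup>2)
        = (norm (I u \<omega>))\<^sup>2 - Q u \<omega>"
      using X0_eq
    proof eventually_elim
      case (elim \<omega>)
      then show ?case by (simp add: Qeq)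
    qed
  qed
qed

lemma exp_has_vector_derivative:
  "((\<lambda>u. exp (m * u)) has_vector_derivative exp (m * u) * m) (at u within S)" for m u :: real
  unfolding has_real_derivative_iff_has_vector_derivative[symmetric]
  by (auto intro!: derivative_eq_intros)

text \<open>Writing \<open>V = U + I\<close> with \<open>U\<close> of class \<open>C\<^sup>1\<close>, the process \<open>exp (m u) E(X, V)\<close> is the sum of a
  \<open>C\<^sup>1\<close> part, of \<open>\<langle>Z, I\<rangle>\<close> and of \<open>exp (m u) (|I|\<^sup>2 - Q) / 2\<close>; integration by parts in expectation for
  the last two replaces Ito's formula.\<close>

lemma lyapunov_stopped:
  assumes T: "0 \<le> T" and \<rho>: "bounded_stopping T \<rho>"
    and R: "\<And>\<omega> u. \<omega> \<in> space M \<Longrightarrow> 0 < \<rho> \<omega> \<Longrightarrow> u \<in> {0..\<rho> \<omega>} \<Longrightarrow>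
      norm (X u \<omega>) \<le> R \<and> norm (V u \<omega>) \<le> R \<and> norm (I u \<omega>) \<le> R"
    and dr: "\<And>\<omega> u. \<omega> \<in> space M \<Longrightarrow> u \<in> {0..<\<rho> \<omega>} \<Longrightarrow>
      m * lyapunov b (X u \<omega>) (V u \<omega>) + drift b (X u \<omega>) (V u \<omega>) \<le> 0"
  defines "S \<equiv> \<lambda>u \<omega>. exp (m * u) * lyapunov b (X u \<omega>) (V u \<omega>)"
  shows "integrable M (\<lambda>\<omega>. S (\<rho> \<omega>) \<omega> - S 0 \<omega>)"
    and "(\<integral>\<omega>. S (\<rho> \<omega>) \<omega> - S 0 \<omega> \<partial>M) \<le> 0"
proof -
  let ?N = "\<lambda>u \<omega>. (norm (I u \<omega>))\<^sup>2 - Q u \<omega>"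
  \<comment> \<open>All quantities are written as continuous functions of time and of the values
    \<open>X\<close>, \<open>V\<close>, \<open>I\<close>, so that adaptedness, continuity and bounds
    hold for all of them at once. \<open>Zf\<close> is the coefficient of \<open>I\<close> in the
    decomposition of the process, \<open>zf\<close> its derivative along the path, and
    \<open>df\<close> the drift of the weighted process \<open>Sf\<close>.\<close>
  define Zf :: "real \<times> (real^'d) \<times> (real^'d) \<times> (real^'d) \<Rightarrow> real^'d" where
    "Zf = (\<lambda>(u, x, v, i). exp (m * u) *\<^sub>R (b *\<^sub>R g x + (v - i)))"
  define zf :: "real \<times> (real^'d) \<times> (real^'d) \<times> (real^'d) \<Rightarrow> real^'d" where
    "zf = (\<lambda>(u, x, v, i). exp (m * u) *\<^sub>R (m *\<^sub>R (b *\<^sub>R g x + (v - i)) + (b *\<^sub>R (H x *v v) - (\<mu> *\<^sub>R v + g x))))"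
  define Sf :: "real \<times> (real^'d) \<times> (real^'d) \<times> (real^'d) \<Rightarrow> real" where
    "Sf = (\<lambda>(u, x, v, i). exp (m * u) * lyapunov b x v)"
  define df :: "real \<times> (real^'d) \<times> (real^'d) \<times> (real^'d) \<Rightarrow> real" where
    "df = (\<lambda>(u, x, v, i). exp (m * u) * (m * lyapunov b x v + drift b x v))"
  note cc = continuous_on_compose2[OF g_cont] continuous_on_compose2[OF H_cont] continuous_on_compose2[OF \<Sigma>_cont]
    continuous_on_compose2[OF f_cont]
  have Zf: "continuous_on UNIV Zf" unfolding Zf_def split_beta' by (intro continuous_intros cc) auto
  have zf: "continuous_on UNIV zf" unfolding zf_def split_beta' by (intro continuous_intros cc) auto
  have Sf: "continuous_on UNIV Sf"
    unfolding Sf_def lyapunov_def split_beta' by (intro continuous_intros cc) auto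
  have df: "continuous_on UNIV df"
    unfolding df_def lyapunov_def drift_def split_beta' by (intro continuous_intros cc) auto
  have \<Sigma>f: "continuous_on UNIV (\<lambda>(u::real, x, v::real^'d, i::real^'d). (norm (\<Sigma> x))\<^sup>2)"
    unfolding split_beta' by (intro continuous_intros cc) auto
  define st where "st u \<omega> = (u, X u \<omega>, V u \<omega>, I u \<omega>)" for u \<omega>
  obtain BZ where BZ: "0 \<le> BZ" "\<And>\<omega> u. \<omega> \<in> space M \<Longrightarrow> 0 < \<rho> \<omega> \<Longrightarrow> u \<in> {0..\<rho> \<omega>} \<Longrightarrow> norm (Zf (st u \<omega>)) \<le> BZ"
    unfolding st_def by (rule stopped_state_bounded[OF Zf \<rho> R]) blast+
  obtain Bz where Bz: "0 \<le> Bz" "\<And>\<omega> u. \<omega> \<in> space M \<Longrightarrow> 0 < \<rho> \<omega> \<Longrightarrow> u \<in> {0..\<rho> \<omega>} \<Longrightarrow> norm (zf (st u \<omega>)) \<le> Bz"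
    unfolding st_def by (rule stopped_state_bounded[OF zf \<rho> R]) blast+
  obtain BS where BS: "0 \<le> BS" "\<And>\<omega> u. \<omega> \<in> space M \<Longrightarrow> 0 < \<rho> \<omega> \<Longrightarrow> u \<in> {0..\<rho> \<omega>} \<Longrightarrow> norm (Sf (st u \<omega>)) \<le> BS"
    unfolding st_def by (rule stopped_state_bounded[OF Sf \<rho> R]) blast+
  obtain B\<Sigma> where B\<Sigma>: "0 \<le> B\<Sigma>" "\<And>\<omega> u. \<omega> \<in> space M \<Longrightarrow> 0 < \<rho> \<omega> \<Longrightarrow> u \<in> {0..\<rho> \<omega>} \<Longrightarrow>
      (norm (\<Sigma> (X u \<omega>)))\<^sup>2 \<le> B\<Sigma>"
    by (rule stopped_state_bounded[OF \<Sigma>f \<rho> R]) auto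
  have S_st: "S u \<omega> = Sf (st u \<omega>)" for u \<omega> by (simp add: S_def Sf_def st_def)
  have \<rho>T: "0 \<le> \<rho> \<omega>" "\<rho> \<omega> \<le> T" if "\<omega> \<in> space M" for \<omega>
    using bounded_stopping_bounds[OF \<rho> that] by auto
  have QB: "\<bar>Q u \<omega>\<bar> \<le> B\<Sigma> * T" if w: "\<omega> \<in> space M" and u: "0 < \<rho> \<omega>" "u \<in> {0..\<rho> \<omega>}" for u \<omega>
  proof -
    have "norm (integral {0..u} (\<lambda>s. (norm (\<Sigma> (X s \<omega>)))\<^sup>2)) \<le> B\<Sigma> * (u - 0)"
    proof (rule integral_bound)
      show "continuous_on {0..u} (\<lambda>s. (norm (\<Sigma> (X s \<omega>)))\<^sup>2)"
        by (rule continuous_on_subset[OF \<Sigma>X_cont[OF w]]) auto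
      show "norm ((norm (\<Sigma> (X t \<omega>)))\<^sup>2) \<le> B\<Sigma>" if "t \<in> {0..u}" for t
        using B\<Sigma>(2)[OF w u(1), of t] that u(2) by auto
    qed (use u in simp)
    also have "\<dots> \<le> B\<Sigma> * T" using u \<rho>T[OF w] B\<Sigma>(1) by (intro mult_left_mono) auto
    finally show ?thesis by (simp add: Q_def)
  qed
  define K where "K = \<bar>R\<bar> + B\<Sigma> * T"
  have IQ: "norm (I u \<omega>) \<le> K \<and> \<bar>Q u \<omega>\<bar> \<le> K" if "\<omega> \<in> space M" "0 < \<rho> \<omega>" "u \<in> {0..\<rho> \<omega>}" for u \<omega>
    using R[OF that] QB[OF that] B\<Sigma>(1) T by (auto simp: K_def intro: order_trans add_increasing add_increasing2)
  note cp = centered_processes[OF T \<rho> IQ]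
  have IM: "I u \<in> borel_measurable M" if "0 \<le> u" for u by (rule measurable_F_M[OF that I_adapted[OF that]])
  have sub: "{0..r} \<subseteq> {0..}" for r :: real by auto
  have dZ: "((\<lambda>u. Zf (st u \<omega>)) has_vector_derivative zf (st u \<omega>)) (at u within {0..r})"
    if w: "\<omega> \<in> space M" and u: "u \<in> {0..r}" for \<omega> u r
  proof -
    have G: "((\<lambda>u. g (X u \<omega>)) has_vector_derivative H (X u \<omega>) *v V u \<omega>) (at u within {0..r})"
      by (rule has_vector_derivative_chain[OF derivatives(1)[OF w u] g_deriv])
    have "((\<lambda>u. b *\<^sub>R g (X u \<omega>) + (V u \<omega> - I u \<omega>)) has_vector_derivative
        b *\<^sub>R (H (X u \<omega>) *v V u \<omega>) + - (\<mu> *\<^sub>R V u \<omega> + g (X u \<omega>))) (at u within {0..r})"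
      by (intro has_vector_derivative_add derivatives(2)[OF w u]
          bounded_linear.has_vector_derivative[OF bounded_linear_scaleR_right G])
    from bounded_bilinear.has_vector_derivative[OF bounded_bilinear_scaleR exp_has_vector_derivative[of m u] this]
    show ?thesis by (simp add: Zf_def zf_def st_def algebra_simps)
  qed
  \<comment> \<open>The \<open>C\<^sup>1\<close> part: the weighted Lyapunov function with
    \<open>V\<close> replaced by \<open>U = V - I\<close>, plus \<open>Q / 2\<close>. It arises from
    \<open><g, V> = <g, U> + <g, I>\<close> and
    \<open>|V|^2 = |U|^2 + 2 <U, I> + (|I|^2 - Q) + Q\<close>.\<close>
  define P where "P u \<omega> = exp (m * u) * ((1 + b * \<mu>) * f (X u \<omega>) + b * (g (X u \<omega>) \<bullet> (V u \<omega> - I u \<omega>))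
      + ((V u \<omega> - I u \<omega>) \<bullet> (V u \<omega> - I u \<omega>)) / 2 + Q u \<omega> / 2)" for u \<omega>
  \<comment> \<open>The time derivative of \<open>P\<close>. It is the drift without the time
    integrands that integration by parts assigns to \<open><Zf, I>\<close> and to
    \<open>exp (m * u) * ?N / 2\<close>.\<close>
  define p where "p u \<omega> = df (st u \<omega>) - (\<Sum>j\<in>UNIV. zf (st u \<omega>) $ j * I u \<omega> $ j) - exp (m * u) * m * ?N u \<omega> / 2" for u \<omega>
  have dP: "((\<lambda>u. P u \<omega>) has_vector_derivative p u \<omega>) (at u within {0..r})"
    if w: "\<omega> \<in> space M" and u: "u \<in> {0..r}" for \<omega> u r
  proof -
    let ?U = "V u \<omega> - I u \<omega>" and ?g = "g (X u \<omega>)" and ?h = "H (X u \<omega>) *v V u \<omega>"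
    let ?A = "- (\<mu> *\<^sub>R V u \<omega> + g (X u \<omega>))"
    have dG: "((\<lambda>u. g (X u \<omega>)) has_vector_derivative ?h) (at u within {0..r})"
      by (rule has_vector_derivative_chain[OF derivatives(1)[OF w u] g_deriv])
    have dF: "((\<lambda>u. f (X u \<omega>)) has_vector_derivative V u \<omega> \<bullet> ?g) (at u within {0..r})"
      by (rule has_vector_derivative_chain[OF derivatives(1)[OF w u] f_deriv])
    note dU = derivatives(2)[OF w u]
    have dGU: "((\<lambda>u. g (X u \<omega>) \<bullet> (V u \<omega> - I u \<omega>)) has_vector_derivative ?g \<bullet> ?A + ?h \<bullet> ?U) (at u within {0..r})"
      by (rule bounded_bilinear.has_vector_derivative[OF bounded_bilinear_inner dG dU])
    have dUU: "((\<lambda>u. (V u \<omega> - I u \<omega>) \<bullet> (V u \<omega> - I u \<omega>)) has_vector_derivative ?U \<bullet> ?A + ?A \<bullet> ?U) (at u within {0..r})"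
      by (rule bounded_bilinear.has_vector_derivative[OF bounded_bilinear_inner dU dU])
    have "((\<lambda>u. (1 + b * \<mu>) * f (X u \<omega>) + b * (g (X u \<omega>) \<bullet> (V u \<omega> - I u \<omega>))
        + ((V u \<omega> - I u \<omega>) \<bullet> (V u \<omega> - I u \<omega>)) / 2 + Q u \<omega> / 2) has_vector_derivative
        (1 + b * \<mu>) * (V u \<omega> \<bullet> ?g) + b * (?g \<bullet> ?A + ?h \<bullet> ?U) + (?U \<bullet> ?A + ?A \<bullet> ?U) / 2 + (norm (\<Sigma> (X u \<omega>)))\<^sup>2 / 2)
        (at u within {0..r})"
      by (intro has_vector_derivative_add bounded_linear.has_vector_derivative[OF bounded_linear_mult_right]
          bounded_linear.has_vector_derivative[OF bounded_linear_divide] dF dGU dUU derivatives(3)[OF w u])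
    from bounded_bilinear.has_vector_derivative[OF bounded_bilinear_mult exp_has_vector_derivative[of m u] this]
    have "((\<lambda>u. P u \<omega>) has_vector_derivative exp (m * u) *
        ((1 + b * \<mu>) * (V u \<omega> \<bullet> ?g) + b * (?g \<bullet> ?A + ?h \<bullet> ?U) + (?U \<bullet> ?A + ?A \<bullet> ?U) / 2 + (norm (\<Sigma> (X u \<omega>)))\<^sup>2 / 2)
        + exp (m * u) * m * ((1 + b * \<mu>) * f (X u \<omega>) + b * (?g \<bullet> ?U) + (?U \<bullet> ?U) / 2 + Q u \<omega> / 2))
        (at u within {0..r})"
      by (simp add: P_def)
    moreover have "exp (m * u) *
        ((1 + b * \<mu>) * (V u \<omega> \<bullet> ?g) + b * (?g \<bullet> ?A + ?h \<bullet> ?U) + (?U \<bullet> ?A + ?A \<bullet> ?U) / 2 + (norm (\<Sigma> (X u \<omega>)))\<^sup>2 / 2)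
        + exp (m * u) * m * ((1 + b * \<mu>) * f (X u \<omega>) + b * (?g \<bullet> ?U) + (?U \<bullet> ?U) / 2 + Q u \<omega> / 2) = p u \<omega>"
    proof -
      have zI: "(\<Sum>j\<in>UNIV. zf (st u \<omega>) $ j * I u \<omega> $ j)
          = exp (m * u) * (m * (b * (?g \<bullet> I u \<omega>) + ?U \<bullet> I u \<omega>) + (b * (?h \<bullet> I u \<omega>) + ?A \<bullet> I u \<omega>))"
      proof -
        have sum_inner: "(\<Sum>j\<in>UNIV. zf (st u \<omega>) $ j * I u \<omega> $ j) = zf (st u \<omega>) \<bullet> I u \<omega>"
          by (simp add: inner_vec_def)
        have zfu: "zf (st u \<omega>) = exp (m * u) *\<^sub>R (m *\<^sub>R (b *\<^sub>R ?g + ?U) + (b *\<^sub>R ?h + ?A))"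
          by (simp add: zf_def st_def)
        show ?thesis unfolding sum_inner unfolding zfu by (simp only: inner_scaleR_left inner_add_left)
      qed
      have V: "V u \<omega> = ?U + I u \<omega>" by simp
      have gv: "?g \<bullet> V u \<omega> = ?g \<bullet> ?U + ?g \<bullet> I u \<omega>" "?h \<bullet> V u \<omega> = ?h \<bullet> ?U + ?h \<bullet> I u \<omega>"
          "V u \<omega> \<bullet> ?A = ?U \<bullet> ?A + ?A \<bullet> I u \<omega>" "?A \<bullet> ?U = ?U \<bullet> ?A" "V u \<omega> \<bullet> ?g = ?g \<bullet> V u \<omega>"
        by (simp_all add: inner_diff_right inner_diff_left inner_commute)
      have nv: "(norm (V u \<omega>))\<^sup>2 = ?U \<bullet> ?U + 2 * (?U \<bullet> I u \<omega>) + (norm (I u \<omega>))\<^sup>2"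
        by (simp add: power2_norm_eq_inner inner_diff_left inner_diff_right inner_commute)
      have fr: "(b *\<^sub>R ?g + V u \<omega>) \<bullet> (\<mu> *\<^sub>R V u \<omega> + ?g) = - (b * (?g \<bullet> ?A) + V u \<omega> \<bullet> ?A)"
        unfolding inner_minus_right inner_add_left inner_scaleR_left by simp
      have dfu: "df (st u \<omega>) = exp (m * u) * (m * ((1 + b * \<mu>) * f (X u \<omega>) + b * (?g \<bullet> V u \<omega>) + (norm (V u \<omega>))\<^sup>2 / 2)
          + ((1 + b * \<mu>) * (?g \<bullet> V u \<omega>) + b * (?h \<bullet> V u \<omega>) + (b * (?g \<bullet> ?A) + V u \<omega> \<bullet> ?A) + (norm (\<Sigma> (X u \<omega>)))\<^sup>2 / 2))"
        unfolding df_def st_def prod.case lyapunov_def drift_def fr by simp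
      show ?thesis
        unfolding p_def dfu zI nv gv by (simp add: algebra_simps add_divide_distrib diff_divide_distrib)
    qed
    ultimately show ?thesis by simp
  qed
  \<comment> \<open>\<open>Rj\<close> and \<open>RN\<close> are the remainders of
    \<open>stopped_integration_by_parts\<close>, one per coordinate of \<open>I\<close> and one for
    the compensated square. They have mean \<open>0\<close>, and together with the integral of
    \<open>df\<close> they make up the whole increment of \<open>S\<close>.\<close>
  define Rj where "Rj j \<omega> = indicator {\<omega>. 0 < \<rho> \<omega>} \<omega> * (Zf (st (\<rho> \<omega>) \<omega>) $ j * I (\<rho> \<omega>) \<omega> $ j - Zf (st 0 \<omega>) $ j * I 0 \<omega> $ j
      - integral {0..\<rho> \<omega>} (\<lambda>u. zf (st u \<omega>) $ j * I u \<omega> $ j))" for j \<omega>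
  define RN where "RN \<omega> = indicator {\<omega>. 0 < \<rho> \<omega>} \<omega> * (exp (m * \<rho> \<omega>) * ?N (\<rho> \<omega>) \<omega> - exp (m * 0) * ?N 0 \<omega>
      - integral {0..\<rho> \<omega>} (\<lambda>u. exp (m * u) * m * ?N u \<omega>))" for \<omega>
  have Rj: "integrable M (Rj j) \<and> (\<integral>\<omega>. Rj j \<omega> \<partial>M) = 0" for j
  proof -
    show ?thesis unfolding Rj_def
    proof (rule stopped_integration_by_parts[OF T \<rho> cp(1)[of j],
        where Z = "\<lambda>u \<omega>. Zf (st u \<omega>) $ j" and z = "\<lambda>u \<omega>. zf (st u \<omega>) $ j" and B = "max BZ Bz" and K = K])
      show "(\<lambda>\<omega>. I u \<omega> $ j) \<in> borel_measurable M" if "0 \<le> u" for u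
        using IM[OF that] by measurable
      show "continuous_on {0..} (\<lambda>u. I u \<omega> $ j)" if "\<omega> \<in> space M" for \<omega>
        by (intro continuous_intros I_cont that)
      show "(\<lambda>\<omega>. zf (st u \<omega>) $ j) \<in> borel_measurable (F u)" if "0 \<le> u" for u
        using state_function_adapted[OF zf that] unfolding st_def by measurable
      show "continuous_on {0..} (\<lambda>u. zf (st u \<omega>) $ j)" if "\<omega> \<in> space M" for \<omega>
        unfolding st_def by (intro continuous_on_component state_function_continuous zf that)
      show "(\<lambda>\<omega>. Zf (st 0 \<omega>) $ j) \<in> borel_measurable (F 0)"
        using state_function_adapted[OF Zf, of 0] unfolding st_def by measurable
    next
      fix \<omega> assume w: "\<omega> \<in> space M" "0 < \<rho> \<omega>"
      have "((\<lambda>u. zf (st u \<omega>) $ j) has_integral Zf (st (\<rho> \<omega>) \<omega>) $ j - Zf (st 0 \<omega>) $ j) {0..\<rho> \<omega>}"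
        using w(2) by (intro fundamental_theorem_of_calculus
            bounded_linear.has_vector_derivative[OF bounded_linear_vec_nth dZ[OF w(1)]]) auto
      then show "Zf (st (\<rho> \<omega>) \<omega>) $ j = Zf (st 0 \<omega>) $ j + integral {0..\<rho> \<omega>} (\<lambda>u. zf (st u \<omega>) $ j)"
        by (simp add: integral_unique)
      show "\<bar>Zf (st 0 \<omega>) $ j\<bar> \<le> max BZ Bz"
        using BZ(2)[OF w, of 0] component_le_norm_cart[of "Zf (st 0 \<omega>)" j] w(2) by auto
      fix u assume u: "u \<in> {0..\<rho> \<omega>}"
      show "\<bar>zf (st u \<omega>) $ j\<bar> \<le> max BZ Bz"
        using Bz(2)[OF w u] component_le_norm_cart[of "zf (st u \<omega>)" j] by auto
      show "\<bar>I u \<omega> $ j\<bar> \<le> K"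
        using IQ[OF w u] component_le_norm_cart[of "I u \<omega>" j] by auto
    qed
  qed
  have RN: "integrable M RN \<and> (\<integral>\<omega>. RN \<omega> \<partial>M) = 0"
  proof -
    show ?thesis unfolding RN_def
    proof (rule stopped_integration_by_parts[OF T \<rho> cp(2),
        where Z = "\<lambda>u \<omega>. exp (m * u)" and z = "\<lambda>u \<omega>. exp (m * u) * m"
          and B = "exp (\<bar>m\<bar> * T) * (\<bar>m\<bar> + 1)" and K = "K\<^sup>2 + K"])
      show "?N u \<in> borel_measurable M" if "0 \<le> u" for u
        using IM[OF that] Q_measurable[OF that] by measurable
      show "continuous_on {0..} (\<lambda>u. ?N u \<omega>)" if "\<omega> \<in> space M" for \<omega>
        by (intro continuous_intros I_cont Q_cont that)
    next
      fix \<omega> assume w: "\<omega> \<in> space M" "0 < \<rho> \<omega>"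
      have hi: "((\<lambda>u. exp (m * u) * m) has_integral exp (m * \<rho> \<omega>) - exp (m * 0)) {0..\<rho> \<omega>}"
        using w(2) by (intro fundamental_theorem_of_calculus exp_has_vector_derivative) auto
      show "exp (m * \<rho> \<omega>) = exp (m * 0) + integral {0..\<rho> \<omega>} (\<lambda>u. exp (m * u) * m)"
        unfolding integral_unique[OF hi] by simp
      have "1 * 1 \<le> exp (\<bar>m\<bar> * T) * (\<bar>m\<bar> + 1)" using T by (intro mult_mono) auto
      then show "\<bar>exp (m * 0)\<bar> \<le> exp (\<bar>m\<bar> * T) * (\<bar>m\<bar> + 1)" by simp
      fix u assume u: "u \<in> {0..\<rho> \<omega>}"
      have "m * u \<le> \<bar>m\<bar> * T" using u \<rho>T[OF w(1)] by (intro mult_mono) auto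
      then show "\<bar>exp (m * u) * m\<bar> \<le> exp (\<bar>m\<bar> * T) * (\<bar>m\<bar> + 1)"
        unfolding abs_mult by (intro mult_mono) auto
      have "(norm (I u \<omega>))\<^sup>2 \<le> K\<^sup>2" using IQ[OF w u] by (intro power_mono) auto
      then show "\<bar>?N u \<omega>\<bar> \<le> K\<^sup>2 + K"
        using IQ[OF w u] zero_le_power2[of "norm (I u \<omega>)"] by linarith
    qed (auto intro!: continuous_intros)
  qed
  have le: "S (\<rho> \<omega>) \<omega> - S 0 \<omega> \<le> (\<Sum>j\<in>UNIV. Rj j \<omega>) + RN \<omega> / 2" if w: "\<omega> \<in> space M" for \<omega>
  proof (cases "0 < \<rho> \<omega>")
    case False
    then have "\<rho> \<omega> = 0" using \<rho>T[OF w] by simp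
    then show ?thesis by (simp add: Rj_def RN_def)
  next
    case pos: True
    let ?r = "\<rho> \<omega>"
    have cst: "continuous_on {0..?r} (\<lambda>u. \<Phi> (st u \<omega>))" if "continuous_on UNIV \<Phi>"
      for \<Phi> :: "_ \<Rightarrow> 'b::topological_space"
      unfolding st_def by (rule continuous_on_subset[OF state_function_continuous[OF that w] sub])
    have cI: "continuous_on {0..?r} (\<lambda>u. I u \<omega>)" "continuous_on {0..?r} (\<lambda>u. Q u \<omega>)"
      using continuous_on_subset[OF I_cont[OF w] sub] continuous_on_subset[OF Q_cont[OF w] sub] by auto
    have cN: "continuous_on {0..?r} (\<lambda>u. exp (m * u) * m * ?N u \<omega>)"
      by (intro continuous_intros cI)
    have cz: "continuous_on {0..?r} (\<lambda>u. zf (st u \<omega>) $ j * I u \<omega> $ j)" for j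
      by (intro continuous_intros cI cst[OF zf])
    have cd: "continuous_on {0..?r} (\<lambda>u. df (st u \<omega>))" by (rule cst[OF df])
    have split: "S u \<omega> = P u \<omega> + (\<Sum>j\<in>UNIV. Zf (st u \<omega>) $ j * I u \<omega> $ j) + exp (m * u) * ?N u \<omega> / 2" for u
    proof -
      let ?U = "V u \<omega> - I u \<omega>"
      have "(\<Sum>j\<in>UNIV. Zf (st u \<omega>) $ j * I u \<omega> $ j) = Zf (st u \<omega>) \<bullet> I u \<omega>"
        by (simp add: inner_vec_def)
      also have "\<dots> = exp (m * u) * (b * (g (X u \<omega>) \<bullet> I u \<omega>) + ?U \<bullet> I u \<omega>)"
        by (simp only: Zf_def st_def prod.case inner_scaleR_left inner_add_left)
      finally have ZI: "(\<Sum>j\<in>UNIV. Zf (st u \<omega>) $ j * I u \<omega> $ j) = \<dots>" .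
      have gv: "g (X u \<omega>) \<bullet> V u \<omega> = g (X u \<omega>) \<bullet> ?U + g (X u \<omega>) \<bullet> I u \<omega>"
        by (simp add: inner_diff_right)
      have nv: "(norm (V u \<omega>))\<^sup>2 = ?U \<bullet> ?U + 2 * (?U \<bullet> I u \<omega>) + (norm (I u \<omega>))\<^sup>2"
        by (simp add: power2_norm_eq_inner inner_diff_left inner_diff_right inner_commute)
      show ?thesis
        unfolding ZI S_def lyapunov_def P_def gv nv by (simp add: algebra_simps add_divide_distrib diff_divide_distrib)
    qed
    have "(p' has_integral P ?r \<omega> - P 0 \<omega>) {0..?r}" if "p' = (\<lambda>u. p u \<omega>)" for p'
      unfolding that using pos by (intro fundamental_theorem_of_calculus dP[OF w]) auto
    then have Pint: "P ?r \<omega> - P 0 \<omega> = integral {0..?r} (\<lambda>u. p u \<omega>)" by (simp add: integral_unique)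
    have "integral {0..?r} (\<lambda>u. p u \<omega>) = integral {0..?r} (\<lambda>u. df (st u \<omega>))
        - (\<Sum>j\<in>UNIV. integral {0..?r} (\<lambda>u. zf (st u \<omega>) $ j * I u \<omega> $ j))
        - integral {0..?r} (\<lambda>u. exp (m * u) * m * ?N u \<omega>) / 2"
    proof (rule integral_unique)
      show "((\<lambda>u. p u \<omega>) has_integral integral {0..?r} (\<lambda>u. df (st u \<omega>))
        - (\<Sum>j\<in>UNIV. integral {0..?r} (\<lambda>u. zf (st u \<omega>) $ j * I u \<omega> $ j))
        - integral {0..?r} (\<lambda>u. exp (m * u) * m * ?N u \<omega>) / 2) {0..?r}"
        unfolding p_def
        by (intro has_integral_diff has_integral_sum has_integral_divide integrable_integral
            integrable_continuous_interval cN cz cd finite)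
    qed
    then have diff: "S ?r \<omega> - S 0 \<omega> = integral {0..?r} (\<lambda>u. df (st u \<omega>)) + (\<Sum>j\<in>UNIV. Rj j \<omega>) + RN \<omega> / 2"
      using Pint pos unfolding split Rj_def RN_def
      by (simp add: sum_subtractf diff_divide_distrib)
    \<comment> \<open>The drift inequality is assumed only strictly before \<open>\<rho>\<close>,
      since at \<open>\<rho>\<close> the path may already have left \<open>D\<close>; continuity
      gives it at the end point.\<close>
    have dle: "df (st u \<omega>) \<le> 0" if u: "u \<in> {0..?r}" for u
    proof (rule continuous_le_on_closure[of "{0..<?r}" "\<lambda>u. df (st u \<omega>)"])
      show "continuous_on (closure {0..<?r}) (\<lambda>u. df (st u \<omega>))" using pos cd by simp
      show "u \<in> closure {0..<?r}" using pos u by simp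
      show "df (st u \<omega>) \<le> 0" if "u \<in> {0..<?r}" for u
        using dr[OF w that] by (simp add: df_def st_def mult_nonneg_nonpos)
    qed
    have "integral {0..?r} (\<lambda>u. df (st u \<omega>)) \<le> integral {0..?r} (\<lambda>u. 0)"
      by (rule integral_le[OF integrable_continuous_interval[OF cd]]) (auto simp: dle)
    then show ?thesis using diff by simp
  qed
  have \<rho>m: "\<rho> \<in> borel_measurable M" by (rule bounded_stopping_measurable[OF \<rho>])
  have Sm: "S u \<in> borel_measurable M" if "0 \<le> u" for u
  proof -
    have "(\<lambda>\<omega>. S u \<omega>) \<in> borel_measurable M"
      unfolding S_st st_def by (rule measurable_F_M[OF that state_function_adapted[OF Sf that]])
    then show ?thesis by simp
  qed
  have Sc: "continuous_on {0..} (\<lambda>u. S u \<omega>)" if "\<omega> \<in> space M" for \<omega>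
    unfolding S_st st_def by (rule state_function_continuous[OF Sf that])
  have [measurable]: "(\<lambda>\<omega>. S (\<rho> \<omega>) \<omega>) \<in> borel_measurable M" "S 0 \<in> borel_measurable M"
    by (rule measurable_process_at_time[OF Sm Sc \<rho>m \<rho>T(1)]) (auto intro: Sm)
  \<comment> \<open>Only the difference is bounded: where \<open>\<rho> = 0\<close> the initial
    value is uncontrolled, but there the difference vanishes.\<close>
  show int: "integrable M (\<lambda>\<omega>. S (\<rho> \<omega>) \<omega> - S 0 \<omega>)"
  proof (rule integrable_const_bound[of _ "2 * BS"])
    show "AE \<omega> in M. norm (S (\<rho> \<omega>) \<omega> - S 0 \<omega>) \<le> 2 * BS"
    proof (rule AE_I2)
      fix \<omega> assume w: "\<omega> \<in> space M"
      show "norm (S (\<rho> \<omega>) \<omega> - S 0 \<omega>) \<le> 2 * BS"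
      proof (cases "0 < \<rho> \<omega>")
        case True
        then show ?thesis using BS(2)[OF w True, of 0] BS(2)[OF w True, of "\<rho> \<omega>"] unfolding S_st by auto
      next
        case False
        then have "\<rho> \<omega> = 0" using \<rho>T[OF w] by simp
        then show ?thesis using BS(1) by simp
      qed
    qed
  qed measurable
  have "(\<integral>\<omega>. S (\<rho> \<omega>) \<omega> - S 0 \<omega> \<partial>M) \<le> (\<integral>\<omega>. (\<Sum>j\<in>UNIV. Rj j \<omega>) + RN \<omega> / 2 \<partial>M)"
    using Rj RN le by (intro integral_mono int) auto
  also have "\<dots> = 0" using Rj RN by simp
  finally show "(\<integral>\<omega>. S (\<rho> \<omega>) \<omega> - S 0 \<omega> \<partial>M) \<le> 0" .
qed


definition weighted :: "real \<Rightarrow> real \<Rightarrow> real \<Rightarrow> 'w \<Rightarrow> real" where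
  "weighted m b u \<omega> = exp (m * u) * lyapunov b (X u \<omega>) (V u \<omega>)"

lemma weighted_adapted: "0 \<le> u \<Longrightarrow> weighted m b u \<in> borel_measurable (F u)"
proof -
  assume u: "0 \<le> u"
  have c: "continuous_on UNIV (\<lambda>(u, x, v, i::real^'d). exp (m * u) * lyapunov b x v)"
    unfolding split_beta' lyapunov_def
    by (intro continuous_intros continuous_on_compose2[OF g_cont] continuous_on_compose2[OF f_cont]) auto
  have "(\<lambda>\<omega>. weighted m b u \<omega>) \<in> borel_measurable (F u)"
    using state_function_adapted[OF c u] by (simp add: weighted_def)
  then show ?thesis by simp
qed

lemma weighted_cont: "\<omega> \<in> space M \<Longrightarrow> continuous_on {0..} (\<lambda>u. weighted m b u \<omega>)"
proof -
  assume w: "\<omega> \<in> space M"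
  have c: "continuous_on UNIV (\<lambda>(u, x, v, i::real^'d). exp (m * u) * lyapunov b x v)"
    unfolding split_beta' lyapunov_def
    by (intro continuous_intros continuous_on_compose2[OF g_cont] continuous_on_compose2[OF f_cont]) auto
  show ?thesis
    using state_function_continuous[OF c w] by (simp add: weighted_def)
qed

end

section \<open>Decay and convergence\<close>

text \<open>\<open>infdist\<close> to the empty set is \<open>0\<close>, so \<open>D = UNIV\<close>
  needs a positive value of its own for the sign to characterize membership in
  \<open>D\<close>.\<close>

definition inner_distance :: "'a::metric_space set \<Rightarrow> 'a \<Rightarrow> real" where
  "inner_distance D x = (if D = UNIV then 1 else infdist x (- D))"

lemma inner_distance_pos_iff: "open D \<Longrightarrow> 0 < inner_distance D x \<longleftrightarrow> x \<in> D"
  using in_closed_iff_infdist_zero[of "- D" x] infdist_nonneg[of x "- D"]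
  by (auto simp: inner_distance_def closed_Compl less_le)

lemma inner_distance_cont: "continuous_on UNIV (inner_distance D)"
  unfolding inner_distance_def by (cases "D = UNIV") (auto intro!: continuous_intros)

text \<open>An interface between analysis and probability: the decay argument uses the Lyapunov
  estimates only in the form of these assumptions, whatever the origin of \<open>b\<close>,
  \<open>m\<close> and \<open>\<kappa>\<close>.\<close>

locale kinetic_lyapunov = kinetic M F W X V I X0 I0 f g H \<Sigma> \<mu>
  for M :: "'w measure" and F and W :: "real \<Rightarrow> 'w \<Rightarrow> real^'k" and X V I X0 I0 :: "real \<Rightarrow> 'w \<Rightarrow> real^'d"
    and f g H and \<Sigma> :: "real^'d \<Rightarrow> real^'k^'d" and \<mu> +
  fixes D :: "(real^'d) set" and m b \<kappa> :: real
  assumes D: "open D" and m: "0 < m" and \<kappa>: "0 < \<kappa>"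
    and f_nonneg: "\<And>x. 0 \<le> f x"
    and lower: "\<And>x v. f x / 2 + \<kappa> * (norm v)\<^sup>2 \<le> lyapunov b x v"
    and drift_le: "\<And>x v. x \<in> D \<Longrightarrow> m * lyapunov b x v + drift b x v \<le> 0"
    and initial: "integrable M (\<lambda>\<omega>. lyapunov b (X 0 \<omega>) (V 0 \<omega>))"
begin

abbreviation "S \<equiv> weighted m b"

lemma lyapunov_nonneg: "0 \<le> lyapunov b x v"
  using lower[of x v] f_nonneg[of x] \<kappa> by (smt (verit) divide_nonneg_pos mult_nonneg_nonneg zero_le_power2)

lemma S_nonneg: "0 \<le> S u \<omega>"
  by (simp add: weighted_def lyapunov_nonneg)

lemma S_lower: "exp (m * u) * f (X u \<omega>) \<le> 2 * S u \<omega>" "exp (m * u) * (\<kappa> * (norm (V u \<omega>))\<^sup>2) \<le> S u \<omega>"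
proof -
  have "0 \<le> \<kappa> * (norm (V u \<omega>))\<^sup>2" using \<kappa> by simp
  then have "f (X u \<omega>) \<le> 2 * lyapunov b (X u \<omega>) (V u \<omega>)" "\<kappa> * (norm (V u \<omega>))\<^sup>2 \<le> lyapunov b (X u \<omega>) (V u \<omega>)"
    using lower[of "X u \<omega>" "V u \<omega>"] f_nonneg[of "X u \<omega>"] by linarith+
  then show "exp (m * u) * f (X u \<omega>) \<le> 2 * S u \<omega>" "exp (m * u) * (\<kappa> * (norm (V u \<omega>))\<^sup>2) \<le> S u \<omega>"
    by (simp_all add: weighted_def mult.left_commute[of 2] mult_left_mono)
qed

definition E0 :: real where "E0 = (\<integral>\<omega>. S 0 \<omega> \<partial>M)"

lemma S0_integrable: "integrable M (S 0)"
  using initial by (simp add: weighted_def[abs_def])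

lemma E0_nonneg: "0 \<le> E0"
  unfolding E0_def by (rule Bochner_Integration.integral_nonneg) (rule S_nonneg)

text \<open>A minimum of continuous functions, so that the first exit from \<open>D\<close>, from
  the balls of radius \<open>R\<close> or from below the level \<open>l\<close> is a single hitting
  time. The radius localizes; the level serves the maximal estimate.\<close>

definition barrier :: "real \<Rightarrow> real \<Rightarrow> real \<Rightarrow> 'w \<Rightarrow> real" where
  "barrier R l u \<omega> = min (inner_distance D (X u \<omega>))
     (min (min (R - norm (X u \<omega>)) (min (R - norm (V u \<omega>)) (R - norm (I u \<omega>)))) (l - S u \<omega>))"

lemma barrier_pos_iff: "0 < barrier R l u \<omega> \<longleftrightarrow>
    X u \<omega> \<in> D \<and> norm (X u \<omega>) < R \<and> norm (V u \<omega>) < R \<and> norm (I u \<omega>) < R \<and> S u \<omega> < l"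
  using inner_distance_pos_iff[OF D, of "X u \<omega>"] by (auto simp: barrier_def)

lemma barrier_adapted: "0 \<le> u \<Longrightarrow> barrier R l u \<in> borel_measurable (F u)"
proof -
  assume u: "0 \<le> u"
  note [measurable] = X_adapted[OF u] V_adapted[OF u] I_adapted[OF u] weighted_adapted[OF u, of m b]
    borel_measurable_continuous_onI[OF inner_distance_cont]
  have "(\<lambda>\<omega>. barrier R l u \<omega>) \<in> borel_measurable (F u)"
    unfolding barrier_def by measurable
  then show ?thesis by simp
qed

lemma barrier_cont: "\<omega> \<in> space M \<Longrightarrow> continuous_on {0..T} (\<lambda>u. barrier R l u \<omega>)"
  unfolding barrier_def
  by (rule continuous_on_subset[of "{0..}"])
    (auto intro!: continuous_intros continuous_on_compose2[OF inner_distance_cont] X_cont V_cont I_cont weighted_cont)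

lemma hit_barrier:
  assumes T: "0 \<le> T"
  shows "bounded_stopping T (hit T (barrier R l))"
  using barrier_cont by (intro bounded_stopping_hit[OF T barrier_adapted]) (auto intro: AE_I2)

text \<open>Before the hit the path is in \<open>D\<close> and bounded by \<open>R\<close>, so
  \<open>lyapunov_stopped\<close> gives the increment of \<open>S\<close> a nonpositive mean; the
  integrable initial value is then added back. The bound \<open>E0\<close> depends neither on
  \<open>R\<close> and \<open>l\<close> nor on the horizon.\<close>

lemma S_at_hit:
  fixes R l :: real
  assumes T: "0 \<le> T"
  defines "\<rho> \<equiv> hit T (barrier R l)"
  shows "integrable M (\<lambda>\<omega>. S (\<rho> \<omega>) \<omega>)" and "(\<integral>\<omega>. S (\<rho> \<omega>) \<omega> \<partial>M) \<le> E0"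
proof -
  have \<rho>: "bounded_stopping T \<rho>" unfolding \<rho>_def by (rule hit_barrier[OF T])
  have before: "0 < barrier R l u \<omega>" if w: "\<omega> \<in> space M" and u: "u \<in> {0..<\<rho> \<omega>}" for u \<omega>
  proof -
    have "u < hit T (barrier R l) \<omega>" "0 \<le> u" using u by (simp_all add: \<rho>_def)
    then show ?thesis using less_hit_iff[where \<phi> = "barrier R l" and \<omega> = \<omega>, OF T barrier_cont[OF w], of u] by simp
  qed
  have norms: "norm (X u \<omega>) \<le> R \<and> norm (V u \<omega>) \<le> R \<and> norm (I u \<omega>) \<le> R"
    if w: "\<omega> \<in> space M" and pos: "0 < \<rho> \<omega>" and u: "u \<in> {0..\<rho> \<omega>}" for u \<omega>
  proof -
    have clos: "closure {0..<\<rho> \<omega>} = {0..\<rho> \<omega>}" using pos by simp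
    have le: "norm (Y u) \<le> R" if Y: "continuous_on {0..} Y" and lt: "\<And>r. r \<in> {0..<\<rho> \<omega>} \<Longrightarrow> norm (Y r) < R"
      for Y :: "real \<Rightarrow> real^'d"
    proof (rule continuous_le_on_closure[of "{0..<\<rho> \<omega>}" "\<lambda>u. norm (Y u)"])
      show "continuous_on (closure {0..<\<rho> \<omega>}) (\<lambda>u. norm (Y u))"
        unfolding clos by (intro continuous_intros continuous_on_subset[OF Y]) auto
      show "u \<in> closure {0..<\<rho> \<omega>}" using u clos by simp
      show "norm (Y r) \<le> R" if "r \<in> {0..<\<rho> \<omega>}" for r using lt[OF that] by simp
    qed
    show ?thesis
      using before[OF w] by (intro conjI le X_cont V_cont I_cont w) (auto simp: barrier_pos_iff)
  qed
  have dr: "m * lyapunov b (X u \<omega>) (V u \<omega>) + drift b (X u \<omega>) (V u \<omega>) \<le> 0"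
    if "\<omega> \<in> space M" "u \<in> {0..<\<rho> \<omega>}" for u \<omega>
    using before[OF that] by (intro drift_le) (simp add: barrier_pos_iff)
  note stopped = lyapunov_stopped[OF T \<rho> norms dr, folded weighted_def]
  have int: "integrable M (\<lambda>\<omega>. S (\<rho> \<omega>) \<omega> - S 0 \<omega>)" "(\<integral>\<omega>. S (\<rho> \<omega>) \<omega> - S 0 \<omega> \<partial>M) \<le> 0"
    using stopped by blast+
  have "integrable M (\<lambda>\<omega>. (S (\<rho> \<omega>) \<omega> - S 0 \<omega>) + S 0 \<omega>)"
    by (rule Bochner_Integration.integrable_add[OF int(1) S0_integrable])
  then show i: "integrable M (\<lambda>\<omega>. S (\<rho> \<omega>) \<omega>)" by simp
  show "(\<integral>\<omega>. S (\<rho> \<omega>) \<omega> \<partial>M) \<le> E0"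
    using int(2) i S0_integrable by (simp add: E0_def)
qed

lemma nn_S_at_hit: "0 \<le> T \<Longrightarrow> (\<integral>\<^sup>+\<omega>. ennreal (S (hit T (barrier R l) \<omega>) \<omega>) \<partial>M) \<le> ennreal E0"
  using S_at_hit[of T R l] by (subst nn_integral_eq_integral) (auto simp: S_nonneg intro: ennreal_leI)

text \<open>Compactness of \<open>[0, t]\<close>. Hence on a given path the localizing radii are
  eventually not reached by time \<open>t\<close>.\<close>

lemma path_bounded:
  assumes w: "\<omega> \<in> space M"
  shows "\<exists>N::nat. \<forall>u\<in>{0..t}. \<forall>n\<ge>N.
    norm (X u \<omega>) < real n \<and> norm (V u \<omega>) < real n \<and> norm (I u \<omega>) < real n \<and> S u \<omega> < real n"
proof -
  let ?h = "\<lambda>u. norm (X u \<omega>) + norm (V u \<omega>) + norm (I u \<omega>) + S u \<omega>"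
  have "continuous_on {0..t} ?h"
    by (rule continuous_on_subset[of "{0..}"]) (auto intro!: continuous_intros X_cont V_cont I_cont weighted_cont w)
  then have "bounded (?h ` {0..t})" by (intro compact_imp_bounded compact_continuous_image) auto
  then obtain B where "\<forall>y\<in>?h ` {0..t}. norm y \<le> B" unfolding bounded_iff by blast
  then have B: "\<bar>?h u\<bar> \<le> B" if "u \<in> {0..t}" for u using that by auto
  show ?thesis
  proof (intro exI[of _ "nat \<lceil>B\<rceil> + 1"] ballI allI impI)
    fix u n assume u: "u \<in> {0..t}" and n: "nat \<lceil>B\<rceil> + 1 \<le> n"
    have "B < real n" using n by linarith
    then show "norm (X u \<omega>) < real n \<and> norm (V u \<omega>) < real n \<and> norm (I u \<omega>) < real n \<and> S u \<omega> < real n"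
      using B[OF u] S_nonneg[of u \<omega>] norm_ge_zero[of "X u \<omega>"] norm_ge_zero[of "V u \<omega>"] norm_ge_zero[of "I u \<omega>"] by linarith
  qed
qed

text \<open>For continuous paths and open \<open>D\<close>, the event that the exit time exceeds
  \<open>t\<close>.\<close>

definition inside :: "real \<Rightarrow> 'w set" where
  "inside t = {\<omega> \<in> space M. \<forall>u\<in>{0..t}. X u \<omega> \<in> D}"

lemma inside_sets: assumes t: "0 \<le> t" shows "inside t \<in> sets M"
proof -
  let ?\<phi> = "\<lambda>u \<omega>. inner_distance D (X u \<omega>)"
  have c: "continuous_on {0..t + 1} (\<lambda>u. ?\<phi> u \<omega>)" if "\<omega> \<in> space M" for \<omega>
    by (rule continuous_on_compose2[OF inner_distance_cont continuous_on_subset[OF X_cont[OF that]]]) auto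
  \<comment> \<open>A horizon beyond \<open>t\<close> is needed: with horizon \<open>t\<close> the
    cap would make \<open>t < hit\<close> impossible.\<close>
  have "bounded_stopping (t + 1) (hit (t + 1) ?\<phi>)"
  proof (rule bounded_stopping_hit)
    show "?\<phi> u \<in> borel_measurable (F u)" if "0 \<le> u" for u
      using measurable_compose[OF X_adapted[OF that] borel_measurable_continuous_onI[OF inner_distance_cont]] .
    show "AE \<omega> in M. continuous_on {0..t + 1} (\<lambda>u. ?\<phi> u \<omega>)" by (rule AE_I2) (rule c)
  qed (use t in simp)
  from bounded_stopping_sets[OF this t] have "{\<omega> \<in> space M. t < hit (t + 1) ?\<phi> \<omega>} \<in> sets M"
    using sets_F_M[OF t] by blast
  also have "{\<omega> \<in> space M. t < hit (t + 1) ?\<phi> \<omega>} = inside t"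
  proof -
    have "t < hit (t + 1) ?\<phi> \<omega> \<longleftrightarrow> (\<forall>u\<in>{0..t}. X u \<omega> \<in> D)" if "\<omega> \<in> space M" for \<omega>
      using less_hit_iff[where \<phi> = ?\<phi> and \<omega> = \<omega>, OF _ c[OF that] t] t by (simp add: inner_distance_pos_iff[OF D])
    then show ?thesis by (auto simp: inside_def)
  qed
  finally show ?thesis .
qed

text \<open>On a path inside \<open>D\<close> up to \<open>t\<close>, the localized hitting times
  equal \<open>t\<close> for all large \<open>n\<close>, so \<open>S t\<close> is the limit of the
  stopped values there. Fatou's lemma carries the bound \<open>E0\<close> over, and \<open>f\<close>
  is at most \<open>2 * exp (- m * t) * S t\<close>.\<close>

lemma expected_decay:
  assumes t: "0 \<le> t"
  shows "integrable M (\<lambda>\<omega>. indicator (inside t) \<omega> * f (X t \<omega>))"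
    and "(\<integral>\<omega>. indicator (inside t) \<omega> * f (X t \<omega>) \<partial>M) \<le> 2 * E0 * exp (- m * t)"
proof -
  let ?\<rho> = "\<lambda>n::nat. hit t (barrier (real n) (real n))"
  have [measurable]: "inside t \<in> sets M" by (rule inside_sets[OF t])
  have [measurable]: "(\<lambda>\<omega>. f (X t \<omega>)) \<in> borel_measurable M"
    using measurable_compose[OF measurable_F_M[OF t X_adapted[OF t]] borel_measurable_continuous_onI[OF f_cont]] .
  have [measurable]: "(\<lambda>\<omega>. S (?\<rho> n \<omega>) \<omega>) \<in> borel_measurable M" for n using S_at_hit(1)[OF t] by auto
  have pw: "ennreal (indicator (inside t) \<omega> * f (X t \<omega>))
      \<le> ennreal (2 * exp (- m * t)) * liminf (\<lambda>n. ennreal (S (?\<rho> n \<omega>) \<omega>))" if w: "\<omega> \<in> space M" for \<omega>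
  proof (cases "\<omega> \<in> inside t")
    case True
    obtain N :: nat where "\<forall>u\<in>{0..t}. \<forall>n\<ge>N.
        norm (X u \<omega>) < real n \<and> norm (V u \<omega>) < real n \<and> norm (I u \<omega>) < real n \<and> S u \<omega> < real n"
      using path_bounded[OF w, of t] by blast
    note N = this[rule_format]
    have "?\<rho> n \<omega> = t" if n: "N \<le> n" for n
    proof (rule ccontr)
      assume "?\<rho> n \<omega> \<noteq> t"
      then have less: "?\<rho> n \<omega> < t" using hit_bounds(2)[OF t, of "barrier (real n) (real n)" \<omega>] by simp
      have "barrier (real n) (real n) (?\<rho> n \<omega>) \<omega> \<le> 0"
        by (rule hit_attained[where \<phi> = "barrier (real n) (real n)" and \<omega> = \<omega>, OF t barrier_cont[OF w] less])
      moreover have "?\<rho> n \<omega> \<in> {0..t}" using less hit_bounds(1)[OF t, of "barrier (real n) (real n)" \<omega>] by simp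
      then have "0 < barrier (real n) (real n) (?\<rho> n \<omega>) \<omega>"
        using N[OF _ n] True by (simp add: barrier_pos_iff inside_def)
      ultimately show False by simp
    qed
    then have "\<forall>\<^sub>F n in sequentially. ennreal (S t \<omega>) = ennreal (S (?\<rho> n \<omega>) \<omega>)"
      unfolding eventually_sequentially by (intro exI[of _ N]) simp
    then have "(\<lambda>n. ennreal (S (?\<rho> n \<omega>) \<omega>)) \<longlonglongrightarrow> ennreal (S t \<omega>)"
      by (rule Lim_transform_eventually[OF tendsto_const])
    then have lim: "liminf (\<lambda>n. ennreal (S (?\<rho> n \<omega>) \<omega>)) = ennreal (S t \<omega>)"
      by (intro lim_imp_Liminf) auto
    have "f (X t \<omega>) = exp (- m * t) * (exp (m * t) * f (X t \<omega>))"
      by (simp add: mult.assoc[symmetric] exp_add[symmetric])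
    also have "\<dots> \<le> exp (- m * t) * (2 * S t \<omega>)" by (rule mult_left_mono[OF S_lower(1)]) simp
    finally have "f (X t \<omega>) \<le> 2 * exp (- m * t) * S t \<omega>" by simp
    then show ?thesis using True unfolding lim by (subst ennreal_mult[symmetric]) (auto simp: S_nonneg intro!: ennreal_leI)
  qed simp
  have "(\<integral>\<^sup>+\<omega>. ennreal (indicator (inside t) \<omega> * f (X t \<omega>)) \<partial>M)
      \<le> (\<integral>\<^sup>+\<omega>. ennreal (2 * exp (- m * t)) * liminf (\<lambda>n. ennreal (S (?\<rho> n \<omega>) \<omega>)) \<partial>M)"
    by (rule nn_integral_mono) (rule pw)
  also have "\<dots> = ennreal (2 * exp (- m * t)) * (\<integral>\<^sup>+\<omega>. liminf (\<lambda>n. ennreal (S (?\<rho> n \<omega>) \<omega>)) \<partial>M)"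
    by (rule nn_integral_cmult) measurable
  also have "\<dots> \<le> ennreal (2 * exp (- m * t)) * ennreal E0"
  proof (rule mult_left_mono)
    have "(\<integral>\<^sup>+\<omega>. liminf (\<lambda>n. ennreal (S (?\<rho> n \<omega>) \<omega>)) \<partial>M) \<le> liminf (\<lambda>n. \<integral>\<^sup>+\<omega>. ennreal (S (?\<rho> n \<omega>) \<omega>) \<partial>M)"
      by (rule nn_integral_liminf) measurable
    also have "\<dots> \<le> liminf (\<lambda>n. ennreal E0)"
      by (intro Liminf_mono always_eventually allI nn_S_at_hit[OF t])
    also have "\<dots> = ennreal E0" by (rule Liminf_const) simp
    finally show "(\<integral>\<^sup>+\<omega>. liminf (\<lambda>n. ennreal (S (?\<rho> n \<omega>) \<omega>)) \<partial>M) \<le> ennreal E0" .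
  qed simp
  also have "\<dots> = ennreal (2 * E0 * exp (- m * t))"
    by (subst ennreal_mult[symmetric]) (simp_all add: E0_nonneg mult_ac)
  finally have le: "(\<integral>\<^sup>+\<omega>. ennreal (indicator (inside t) \<omega> * f (X t \<omega>)) \<partial>M) \<le> ennreal (2 * E0 * exp (- m * t))" .
  have nn: "0 \<le> indicator (inside t) \<omega> * f (X t \<omega>)" for \<omega> by (simp add: f_nonneg)
  show int: "integrable M (\<lambda>\<omega>. indicator (inside t) \<omega> * f (X t \<omega>))"
    by (rule integrableI_nonneg) (use nn le in \<open>auto intro: le_less_trans\<close>)
  show "(\<integral>\<omega>. indicator (inside t) \<omega> * f (X t \<omega>) \<partial>M) \<le> 2 * E0 * exp (- m * t)"
    using le E0_nonneg by (subst (asm) nn_integral_eq_integral[OF int]) (auto simp: nn)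
qed

text \<open>If \<open>S\<close> is unbounded on a path that stays in \<open>D\<close>, every level
  \<open>l + 1\<close> is reached before some finite horizon, and \<open>\<Phi> l \<ge> 1\<close>.
  As \<open>\<Phi> l\<close> has mean at most \<open>E0 / (l + 1)\<close>, the infimum
  \<open>\<Psi>\<close> has integral \<open>0\<close>; it is a measurable majorant of the indicator
  of the exceptional outcomes.\<close>

lemma S_bounded:
  "AE \<omega> in M. (\<forall>u\<ge>0. X u \<omega> \<in> D) \<longrightarrow> (\<exists>B. \<forall>u\<ge>0. S u \<omega> \<le> B)"
proof -
  let ?\<rho> = "\<lambda>l n. hit (real n) (barrier (real n) (real (Suc l)))"
  define \<Phi> where "\<Phi> l \<omega> = liminf (\<lambda>n. ennreal (S (?\<rho> l n \<omega>) \<omega>)) / ennreal (real (Suc l))" for l \<omega>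
  have [measurable]: "(\<lambda>\<omega>. S (?\<rho> l n \<omega>) \<omega>) \<in> borel_measurable M" for l n
    using S_at_hit(1)[of "real n"] by auto
  have [measurable]: "\<Phi> l \<in> borel_measurable M" for l unfolding \<Phi>_def by measurable
  have \<Phi>: "(\<integral>\<^sup>+\<omega>. \<Phi> l \<omega> \<partial>M) \<le> ennreal (E0 / real (Suc l))" for l
  proof -
    have "(\<integral>\<^sup>+\<omega>. \<Phi> l \<omega> \<partial>M) = (\<integral>\<^sup>+\<omega>. liminf (\<lambda>n. ennreal (S (?\<rho> l n \<omega>) \<omega>)) \<partial>M) / ennreal (real (Suc l))"
      unfolding \<Phi>_def by (rule nn_integral_divide) measurable
    also have "\<dots> \<le> ennreal E0 / ennreal (real (Suc l))"
    proof (rule divide_right_mono_ennreal)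
      have "(\<integral>\<^sup>+\<omega>. liminf (\<lambda>n. ennreal (S (?\<rho> l n \<omega>) \<omega>)) \<partial>M) \<le> liminf (\<lambda>n. \<integral>\<^sup>+\<omega>. ennreal (S (?\<rho> l n \<omega>) \<omega>) \<partial>M)"
        by (rule nn_integral_liminf) measurable
      also have "\<dots> \<le> liminf (\<lambda>n. ennreal E0)"
        by (intro Liminf_mono always_eventually allI nn_S_at_hit) simp
      also have "\<dots> = ennreal E0" by (rule Liminf_const) simp
      finally show "(\<integral>\<^sup>+\<omega>. liminf (\<lambda>n. ennreal (S (?\<rho> l n \<omega>) \<omega>)) \<partial>M) \<le> ennreal E0" .
    qed
    also have "\<dots> = ennreal (E0 / real (Suc l))" by (rule divide_ennreal) (auto simp: E0_nonneg)
    finally show ?thesis .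
  qed
  define \<Psi> where "\<Psi> \<omega> = (INF l. \<Phi> l \<omega>)" for \<omega>
  have [measurable]: "\<Psi> \<in> borel_measurable M" unfolding \<Psi>_def by measurable
  have "(\<integral>\<^sup>+\<omega>. \<Psi> \<omega> \<partial>M) \<le> 0"
  proof (rule LIMSEQ_le_const)
    have "(\<lambda>l. E0 * inverse (real (Suc l))) \<longlonglongrightarrow> E0 * 0"
      by (intro tendsto_mult tendsto_const LIMSEQ_inverse_real_of_nat)
    then have "(\<lambda>l. ennreal (E0 / real (Suc l))) \<longlonglongrightarrow> ennreal 0"
      by (intro tendsto_ennrealI) (simp add: divide_inverse)
    then show "(\<lambda>l. ennreal (E0 / real (Suc l))) \<longlonglongrightarrow> 0" by simp
    have "(\<integral>\<^sup>+\<omega>. \<Psi> \<omega> \<partial>M) \<le> ennreal (E0 / real (Suc l))" for l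
    proof -
      have "(\<integral>\<^sup>+\<omega>. \<Psi> \<omega> \<partial>M) \<le> (\<integral>\<^sup>+\<omega>. \<Phi> l \<omega> \<partial>M)"
        unfolding \<Psi>_def by (intro nn_integral_mono INF_lower) simp
      then show ?thesis using \<Phi>[of l] by (rule order_trans)
    qed
    then show "\<exists>N. \<forall>l\<ge>N. (\<integral>\<^sup>+\<omega>. \<Psi> \<omega> \<partial>M) \<le> ennreal (E0 / real (Suc l))" by blast
  qed
  then have "(\<integral>\<^sup>+\<omega>. \<Psi> \<omega> \<partial>M) = 0" by simp
  then have "AE \<omega> in M. \<Psi> \<omega> = 0" by (subst (asm) nn_integral_0_iff_AE) simp_all
  then show ?thesis
    using AE_space[of M]
  proof eventually_elim
    case (elim \<omega>)
    show ?case
    proof (rule impI, rule ccontr)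
      assume inD: "\<forall>u\<ge>0. X u \<omega> \<in> D" and unb: "\<nexists>B. \<forall>u\<ge>0. S u \<omega> \<le> B"
      have "1 \<le> \<Phi> l \<omega>" for l
      proof -
        obtain u where u: "0 \<le> u" "real (Suc l) < S u \<omega>" using unb by (auto simp: not_le)
        obtain N :: nat where "\<forall>r\<in>{0..u}. \<forall>n\<ge>N.
            norm (X r \<omega>) < real n \<and> norm (V r \<omega>) < real n \<and> norm (I r \<omega>) < real n \<and> S r \<omega> < real n"
          using path_bounded[OF elim(2), of u] by blast
        note N = this[rule_format]
        \<comment> \<open>The lower bound on \<open>n\<close> puts the horizon beyond
          \<open>u\<close>, where the level has been passed, and the radius beyond the path on
          \<open>[0, u]\<close>. The path stays in \<open>D\<close> as well, so the barrier can only
          have been hit through the level.\<close>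
        have "ennreal (real (Suc l)) \<le> ennreal (S (?\<rho> l n \<omega>) \<omega>)" if n: "N + nat \<lceil>u\<rceil> + 1 \<le> n" for n
        proof -
          let ?b = "barrier (real n) (real (Suc l))"
          have un: "u < real n" using n by linarith
          have n0: "0 \<le> real n" by simp
          have "\<not> 0 < ?b u \<omega>" using u by (simp add: barrier_pos_iff)
          then have "\<not> u < hit (real n) ?b \<omega>"
            using less_hit_iff[where \<phi> = ?b and \<omega> = \<omega>, OF n0 barrier_cont[OF elim(2)] u(1)] u(1) by auto
          then have le: "?\<rho> l n \<omega> \<in> {0..u}" using hit_bounds(1)[OF n0, of ?b \<omega>] by simp
          then have "?b (?\<rho> l n \<omega>) \<omega> \<le> 0"
            using un by (intro hit_attained[where \<phi> = ?b and \<omega> = \<omega>, OF n0 barrier_cont[OF elim(2)]]) simp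
          then have "\<not> 0 < ?b (?\<rho> l n \<omega>) \<omega>" by simp
          then have "real (Suc l) \<le> S (?\<rho> l n \<omega>) \<omega>"
            unfolding barrier_pos_iff using N[OF le, of n] n inD le by auto
          then show ?thesis by (rule ennreal_leI)
        qed
        then have "ennreal (real (Suc l)) \<le> liminf (\<lambda>n. ennreal (S (?\<rho> l n \<omega>) \<omega>))"
          by (intro Liminf_bounded) (auto simp: eventually_sequentially)
        then have "ennreal (real (Suc l)) / ennreal (real (Suc l)) \<le> \<Phi> l \<omega>"
          unfolding \<Phi>_def by (rule divide_right_mono_ennreal)
        then show ?thesis by (simp add: ennreal_divide_self del: of_nat_Suc)
      qed
      then have "1 \<le> \<Psi> \<omega>" unfolding \<Psi>_def by (intro INF_greatest)
      then show False using elim(1) by simp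
    qed
  qed
qed

lemma path_decay:
  assumes B: "\<forall>u\<ge>0. S u \<omega> \<le> B" and m': "m' < m"
  shows "((\<lambda>t. exp (m' * t) * f (X t \<omega>)) \<longlongrightarrow> 0) at_top"
proof (rule tendsto_sandwich)
  show "\<forall>\<^sub>F t in at_top. 0 \<le> exp (m' * t) * f (X t \<omega>)" by (simp add: f_nonneg)
  show "\<forall>\<^sub>F t in at_top. exp (m' * t) * f (X t \<omega>) \<le> exp (- (m - m') * t) * (2 * B)"
    using eventually_ge_at_top[of 0]
  proof eventually_elim
    case (elim t)
    have "exp (m' * t) * f (X t \<omega>) = exp (- (m - m') * t) * (exp (m * t) * f (X t \<omega>))"
      by (simp add: mult.assoc[symmetric] exp_add[symmetric] algebra_simps)
    also have "\<dots> \<le> exp (- (m - m') * t) * (2 * B)"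
      using S_lower(1)[of t \<omega>] B elim by (intro mult_left_mono) (auto intro: order_trans)
    finally show ?case .
  qed
  have "LIM t at_top. (m - m') * t :> at_top"
    using m' by (intro filterlim_tendsto_pos_mult_at_top[OF tendsto_const _ filterlim_ident]) simp
  then have "((\<lambda>t. exp (- ((m - m') * t))) \<longlongrightarrow> 0) at_top"
    by (intro filterlim_compose[OF exp_at_bot]) (simp add: filterlim_uminus_at_bot)
  from tendsto_mult_left_zero[OF this, of "2 * B"]
  show "((\<lambda>t. exp (- (m - m') * t) * (2 * B)) \<longlongrightarrow> 0) at_top" unfolding mult_minus_left .
qed simp

lemma path_convergent:
  assumes w: "\<omega> \<in> space M" and B: "\<forall>u\<ge>0. S u \<omega> \<le> B"
  shows "\<exists>x. ((\<lambda>t. X t \<omega>) \<longlongrightarrow> x) at_top"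
proof -
  have B0: "0 \<le> B" using B S_nonneg[of 0 \<omega>] by (auto intro: order_trans)
  define c where "c = sqrt (B / \<kappa>)"
  have c0: "0 \<le> c" using B0 \<kappa> by (simp add: c_def)
  have V_le: "norm (V u \<omega>) \<le> c * exp (- (m / 2) * u)" if u: "0 \<le> u" for u
  proof (rule power2_le_imp_le)
    have "exp (m * u) * (\<kappa> * (norm (V u \<omega>))\<^sup>2) \<le> B" using S_lower(2)[of u \<omega>] B u by (auto intro: order_trans)
    then have "(norm (V u \<omega>))\<^sup>2 \<le> B / \<kappa> * exp (- (m * u))"
      using \<kappa> by (simp add: exp_minus field_simps)
    also have "\<dots> = (c * exp (- (m / 2) * u))\<^sup>2"
      using B0 \<kappa> by (simp add: c_def power_mult_distrib exp_double[symmetric])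
    finally show "(norm (V u \<omega>))\<^sup>2 \<le> (c * exp (- (m / 2) * u))\<^sup>2" .
  qed (simp add: c0)
  \<comment> \<open>The integral over \<open>[t, \<infinity>)\<close> of the exponential bound on
    \<open>|V|\<close>; it controls every displacement of \<open>X\<close> after time
    \<open>t\<close>.\<close>
  define e where "e t = 2 * c / m * exp (- (m / 2) * t)" for t
  have incr: "norm (X t \<omega> - X s \<omega>) \<le> e s" if st: "0 \<le> s" "s \<le> t" for s t
  proof -
    have Vc: "continuous_on {s..t} (\<lambda>u. V u \<omega>)" by (rule continuous_on_subset[OF V_cont[OF w]]) (use st in auto)
    have "((\<lambda>u. V u \<omega>) has_integral X t \<omega> - X s \<omega>) {s..t}"
    proof (rule fundamental_theorem_of_calculus[OF st(2)])
      fix u assume "u \<in> {s..t}"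
      then have "((\<lambda>u. X u \<omega>) has_vector_derivative V u \<omega>) (at u within {0..t})"
        using st by (intro derivatives(1)[OF w]) simp
      then show "((\<lambda>u. X u \<omega>) has_vector_derivative V u \<omega>) (at u within {s..t})"
        by (rule has_vector_derivative_within_subset) (use st in auto)
    qed
    then have X_int: "X t \<omega> - X s \<omega> = integral {s..t} (\<lambda>u. V u \<omega>)" by (simp add: integral_unique)
    have e_int: "((\<lambda>u. c * exp (- (m / 2) * u)) has_integral (- e t) - (- e s)) {s..t}"
    proof (rule fundamental_theorem_of_calculus[OF st(2)])
      fix u
      have "((\<lambda>t. - e t) has_real_derivative c * exp (- (m / 2) * u)) (at u within {s..t})"
        unfolding e_def using m by (auto intro!: derivative_eq_intros)
      then show "((\<lambda>t. - e t) has_vector_derivative c * exp (- (m / 2) * u)) (at u within {s..t})"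
        by (simp add: has_real_derivative_iff_has_vector_derivative)
    qed
    have "norm (X t \<omega> - X s \<omega>) \<le> integral {s..t} (\<lambda>u. c * exp (- (m / 2) * u))"
      unfolding X_int
      by (rule integral_norm_bound_integral[OF integrable_continuous_interval[OF Vc] has_integral_integrable[OF e_int]])
        (use V_le st in auto)
    also have "\<dots> = e s - e t" using integral_unique[OF e_int] by simp
    also have "\<dots> \<le> e s" using c0 m by (simp add: e_def)
    finally show ?thesis .
  qed
  have e_lim: "(e \<longlongrightarrow> 0) at_top"
  proof -
    have "LIM t at_top. (m / 2) * t :> at_top"
      using m by (intro filterlim_tendsto_pos_mult_at_top[OF tendsto_const _ filterlim_ident]) simp
    then have "((\<lambda>t. exp (- ((m / 2) * t))) \<longlongrightarrow> 0) at_top"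
      by (intro filterlim_compose[OF exp_at_bot]) (simp add: filterlim_uminus_at_bot)
    from tendsto_mult_right_zero[OF this, of "2 * c / m"] show ?thesis by (simp add: e_def[abs_def])
  qed
  have "Cauchy (\<lambda>n. X (real n) \<omega>)"
  proof (rule CauchyI')
    fix \<epsilon> :: real assume "0 < \<epsilon>"
    have "((\<lambda>n. e (real n)) \<longlongrightarrow> 0) sequentially" by (rule filterlim_compose[OF e_lim filterlim_real_sequentially])
    then have "\<forall>\<^sub>F n in sequentially. e (real n) < \<epsilon>" using \<open>0 < \<epsilon>\<close> by (rule order_tendstoD(2))
    then obtain N where N: "\<And>n. N \<le> n \<Longrightarrow> e (real n) < \<epsilon>" by (auto simp: eventually_sequentially)
    show "\<exists>N. \<forall>k\<ge>N. \<forall>n>k. dist (X (real k) \<omega>) (X (real n) \<omega>) < \<epsilon>"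
    proof (intro exI allI impI)
      fix k n assume "N \<le> k" "k < n"
      then show "dist (X (real k) \<omega>) (X (real n) \<omega>) < \<epsilon>"
        using incr[of "real k" "real n"] N[of k] by (simp add: dist_norm norm_minus_commute)
    qed
  qed
  then obtain x where x: "(\<lambda>n. X (real n) \<omega>) \<longlonglongrightarrow> x" using Cauchy_convergent convergent_def by blast
  \<comment> \<open>The limit was found along integer times; letting the later time run through the
    integers in \<open>incr\<close> yields a rate valid at all real times.\<close>
  have close: "norm (x - X t \<omega>) \<le> e t" if t: "0 \<le> t" for t
  proof (rule tendsto_upperbound[OF tendsto_norm[OF tendsto_diff[OF x tendsto_const]]])
    show "\<forall>\<^sub>F n in sequentially. norm (X (real n) \<omega> - X t \<omega>) \<le> e t"
      using eventually_ge_at_top[of "nat \<lceil>t\<rceil>"]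
    proof eventually_elim
      case (elim n)
      then have "t \<le> real n" by linarith
      then show ?case by (rule incr[OF t])
    qed
  qed simp
  have "((\<lambda>t. X t \<omega> - x) \<longlongrightarrow> 0) at_top"
  proof (rule Lim_null_comparison[OF _ e_lim])
    show "\<forall>\<^sub>F t in at_top. norm (X t \<omega> - x) \<le> e t"
      using eventually_ge_at_top[of 0] by eventually_elim (use close in \<open>simp add: norm_minus_commute\<close>)
  qed
  then show ?thesis by (auto simp: LIM_zero_iff)
qed

end

section \<open>The exit time in terms of the path\<close>

lemma exit_time_infinite_inside:
  assumes "exit_time D X \<omega> = \<infinity>" "0 \<le> t"
  shows "X t \<omega> \<in> D"
proof (rule ccontr)
  assume "X t \<omega> \<notin> D"
  then have "exit_time D X \<omega> \<le> ereal t" unfolding exit_time_def using assms(2) by (intro INF_lower) simp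
  then show False using assms(1) by simp
qed

text \<open>A path in \<open>D\<close> on \<open>[0, t]\<close> gives at once only that the exit
  time is at least \<open>t\<close>. Strictness comes from the hitting time with horizon
  \<open>t + 1\<close>: it is attained, hence exceeds \<open>t\<close>, and it is a lower bound for
  the exit time.\<close>

lemma less_exit_time_iff:
  fixes X :: "real \<Rightarrow> 'w \<Rightarrow> 'b::metric_space"
  assumes D: "open D" and c: "continuous_on {0..} (\<lambda>u. X u \<omega>)" and t: "0 \<le> t"
  shows "ereal t < exit_time D X \<omega> \<longleftrightarrow> (\<forall>u\<in>{0..t}. X u \<omega> \<in> D)"
proof
  assume less: "ereal t < exit_time D X \<omega>"
  show "\<forall>u\<in>{0..t}. X u \<omega> \<in> D"
  proof (rule ballI, rule ccontr)
    fix u assume u: "u \<in> {0..t}" and "X u \<omega> \<notin> D"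
    then have "exit_time D X \<omega> \<le> ereal u" unfolding exit_time_def by (intro INF_lower) simp
    also have "\<dots> \<le> ereal t" using u by simp
    finally show False using less by simp
  qed
next
  assume inD: "\<forall>u\<in>{0..t}. X u \<omega> \<in> D"
  let ?\<phi> = "\<lambda>u \<omega>. inner_distance D (X u \<omega>)"
  have t1: "0 \<le> t + 1" using t by simp
  have c1: "continuous_on {0..t + 1} (\<lambda>u. ?\<phi> u \<omega>)"
    by (rule continuous_on_compose2[OF inner_distance_cont continuous_on_subset[OF c]]) auto
  let ?h = "hit (t + 1) ?\<phi> \<omega>"
  have "t < ?h"
    using less_hit_iff[where \<phi> = ?\<phi> and \<omega> = \<omega>, OF t1 c1 t] inD by (simp add: inner_distance_pos_iff[OF D])
  moreover have "ereal ?h \<le> exit_time D X \<omega>"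
    unfolding exit_time_def
  proof (rule INF_greatest)
    fix u assume u: "u \<in> {u. 0 \<le> u \<and> X u \<omega> \<notin> D}"
    have "\<not> u < ?h"
    proof
      assume "u < ?h"
      then have "0 < ?\<phi> u \<omega>" using u less_hit_iff[where \<phi> = ?\<phi> and \<omega> = \<omega>, OF t1 c1, of u] by auto
      then show False using u by (simp add: inner_distance_pos_iff[OF D])
    qed
    then show "ereal ?h \<le> ereal u" by simp
  qed
  ultimately show "ereal t < exit_time D X \<omega>" by (metis ereal_less_eq(3) less_ereal.simps(1) order_less_le_trans)
qed

section \<open>Choice of constants and passage from the given processes to everywhere continuous
  versions\<close>

theorem theorem4p1:
  fixes f :: "real^'d \<Rightarrow> real"
    and \<Sigma> :: "real^'d \<Rightarrow> real^'k^'d"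
    and M :: "'w measure"
    and F :: "real \<Rightarrow> 'w measure"
    and W :: "real \<Rightarrow> 'w \<Rightarrow> real^'k"
    and X V :: "real \<Rightarrow> 'w \<Rightarrow> real^'d"
    and D :: "(real^'d) set"
    and C\<^sub>L \<mu> L \<sigma> :: real
  assumes "twice_continuously_differentiable f"
    and "C\<^sub>L \<ge> 0" and "C\<^sub>L-lipschitz_on UNIV (gradient f)"
    and "bdd_below (range f)" and "(INF x. f x) = 0"
    and "\<exists>K. K-lipschitz_on UNIV \<Sigma>"
    and "filtered_prob_space M F" and "usual_conditions M F"
    and "brownian_motion M F W"
    and "X 0 \<in> borel_measurable (F 0)" and "integrable M (\<lambda>\<omega>. norm (X 0 \<omega>) ^ 4)"
    and "V 0 \<in> borel_measurable (F 0)" and "integrable M (\<lambda>\<omega>. norm (V 0 \<omega>) ^ 4)"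
    and "\<mu> > 0"
    and "kinetic_solution M F W \<mu> f \<Sigma> X V"
    and "L > 0" and "\<sigma> > 0" and "open D"
    and "\<And>x. x \<in> D \<Longrightarrow> (norm (gradient f x))\<^sup>2 \<ge> 2 * L * f x"
    and "\<And>x. x \<in> D \<Longrightarrow> (frobenius_norm (\<Sigma> x))\<^sup>2 \<le> \<sigma> * f x"
    and "\<mu> > C\<^sub>L * \<sigma> / (4 * L)"
  shows "(\<exists>C>0. \<exists>m>0.
      (\<forall>t\<ge>0. integrable M (\<lambda>\<omega>. indicator {\<omega>. exit_time D X \<omega> > ereal t} \<omega> * f (X t \<omega>)) \<and>
             (\<integral>\<omega>. indicator {\<omega>. exit_time D X \<omega> > ereal t} \<omega> * f (X t \<omega>) \<partial>M) \<le> C * exp (- m * t)) \<and>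
      (\<forall>m'<m. AE \<omega> in M. exit_time D X \<omega> = \<infinity> \<longrightarrow>
             ((\<lambda>t. exp (m' * t) * f (X t \<omega>)) \<longlongrightarrow> 0) at_top)) \<and>
    (AE \<omega> in M. exit_time D X \<omega> = \<infinity> \<longrightarrow> (\<exists>x. ((\<lambda>t. X t \<omega>) \<longlongrightarrow> x) at_top))"
proof -
  interpret P: prob_space M using assms(7) by (simp add: filtered_prob_space_def)
  interpret B: brownian M F W
    by unfold_locales (use assms(7-9) in auto)
  define g where "g = gradient f"
  have f_deriv: "(f has_derivative (\<lambda>h. h \<bullet> g x)) (at x)" for x
    using GDERIV_gradient[OF assms(1), of x] by (simp add: g_def gderiv_def)
  obtain H :: "real^'d \<Rightarrow> real^'d^'d" where H: "\<And>x. (g has_derivative (\<lambda>h. H x *v h)) (at x)" "continuous_on UNIV H"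
    using assms(1) unfolding twice_continuously_differentiable_def g_def by blast
  obtain K\<^sub>\<Sigma> where "K\<^sub>\<Sigma>-lipschitz_on UNIV \<Sigma>" using assms(6) by blast
  then have \<Sigma>_cont: "continuous_on UNIV \<Sigma>" by (rule lipschitz_on_continuous_on)
  from assms(15) obtain I where X_ad: "adapted F X" and X_c: "continuous_paths M X"
    and V_ad: "adapted F V" and V_c: "continuous_paths M V"
    and Ito: "is_Ito_integral M F W (\<lambda>t \<omega>. \<Sigma> (X t \<omega>)) I"
    and eqs: "AE \<omega> in M. \<forall>t\<ge>0. X t \<omega> = X 0 \<omega> + integral {0..t} (\<lambda>s. V s \<omega>) \<and>
      V t \<omega> = V 0 \<omega> - integral {0..t} (\<lambda>s. \<mu> *\<^sub>R V s \<omega> + g (X s \<omega>)) + I t \<omega>"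
    unfolding kinetic_solution_def g_def by blast
  have I_ad: "adapted F I" and I_c: "continuous_paths M I" using Ito unfolding is_Ito_integral_def by blast+
  define good where "good \<omega> \<longleftrightarrow> continuous_on {0..} (\<lambda>t. X t \<omega>) \<and> continuous_on {0..} (\<lambda>t. V t \<omega>) \<and>
    continuous_on {0..} (\<lambda>t. I t \<omega>) \<and> (\<forall>t\<ge>0. X t \<omega> = X 0 \<omega> + integral {0..t} (\<lambda>s. V s \<omega>) \<and>
      V t \<omega> = V 0 \<omega> - integral {0..t} (\<lambda>s. \<mu> *\<^sub>R V s \<omega> + g (X s \<omega>)) + I t \<omega>)" for \<omega>
  have good: "AE \<omega> in M. good \<omega>"
    using X_c[unfolded continuous_paths_def] V_c[unfolded continuous_paths_def] I_c[unfolded continuous_paths_def] eqs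
    by eventually_elim (unfold good_def, blast)
  have good_cont: "continuous_on {0..} (\<lambda>t. X t \<omega>)" "continuous_on {0..} (\<lambda>t. V t \<omega>)"
      "continuous_on {0..} (\<lambda>t. I t \<omega>)" if "good \<omega>" for \<omega>
    using that unfolding good_def by blast+
  define X' where "X' t \<omega> = (if good \<omega> then X t \<omega> else 0)" for t \<omega>
  define V' where "V' t \<omega> = (if good \<omega> then V t \<omega> else 0)" for t \<omega>
  \<comment> \<open>On the exceptional paths \<open>X'\<close> and \<open>V'\<close> are
    \<open>0\<close>, and the velocity equation then forces \<open>I'\<close> to be
    \<open>t *\<^sub>R g 0\<close>.\<close>
  define I' where "I' t \<omega> = (if good \<omega> then I t \<omega> else t *\<^sub>R g 0)" for t \<omega>
  have modified: "AE \<omega> in M. X t \<omega> = X' t \<omega>" "AE \<omega> in M. V t \<omega> = V' t \<omega>" "AE \<omega> in M. I t \<omega> = I' t \<omega>" for t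
    using good by (eventually_elim, simp add: X'_def V'_def I'_def)+
  interpret K: kinetic M F W X' V' I' X I f g H \<Sigma> \<mu>
  proof unfold_locales
    fix t :: real assume t: "0 \<le> t"
    show "X' t \<in> borel_measurable (F t)"
      using X_ad t by (intro B.measurable_F_AE[OF t _ modified(1)]) (simp add: adapted_def)
    show "V' t \<in> borel_measurable (F t)"
      using V_ad t by (intro B.measurable_F_AE[OF t _ modified(2)]) (simp add: adapted_def)
    show "I' t \<in> borel_measurable (F t)"
      using I_ad t by (intro B.measurable_F_AE[OF t _ modified(3)]) (simp add: adapted_def)
  next
    fix \<omega> assume "\<omega> \<in> space M"
    show "continuous_on {0..} (\<lambda>t. X' t \<omega>)" by (cases "good \<omega>") (simp_all add: X'_def good_cont)
    show "continuous_on {0..} (\<lambda>t. V' t \<omega>)" by (cases "good \<omega>") (simp_all add: V'_def good_cont)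
    show "continuous_on {0..} (\<lambda>t. I' t \<omega>)"
      by (cases "good \<omega>") (auto simp: I'_def good_cont intro!: continuous_intros)
    fix t :: real assume t: "0 \<le> t"
    show "X' t \<omega> = X' 0 \<omega> + integral {0..t} (\<lambda>s. V' s \<omega>)"
    proof (cases "good \<omega>")
      case True
      then have "X t \<omega> = X 0 \<omega> + integral {0..t} (\<lambda>s. V s \<omega>)" using t unfolding good_def by blast
      then show ?thesis using True by (simp only: X'_def V'_def if_True)
    qed (simp add: X'_def V'_def)
    show "V' t \<omega> = V' 0 \<omega> - integral {0..t} (\<lambda>s. \<mu> *\<^sub>R V' s \<omega> + g (X' s \<omega>)) + I' t \<omega>"
    proof (cases "good \<omega>")
      case True
      then have "V t \<omega> = V 0 \<omega> - integral {0..t} (\<lambda>s. \<mu> *\<^sub>R V s \<omega> + g (X s \<omega>)) + I t \<omega>"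
        using t unfolding good_def by blast
      then show ?thesis using True by (simp only: X'_def V'_def I'_def if_True)
    qed (use t in \<open>simp add: X'_def V'_def I'_def\<close>)
  next
    show "AE \<omega> in M. \<forall>t\<ge>0. X' t \<omega> = X t \<omega> \<and> I' t \<omega> = I t \<omega>"
      using good by eventually_elim (simp add: X'_def I'_def)
  qed (rule Ito f_deriv H \<Sigma>_cont)+
  have f_nonneg: "0 \<le> f x" for x
    using cINF_lower[OF assms(4), of x] assms(5) by simp
  \<comment> \<open>Half of the slack in the assumption on \<open>\<mu>\<close>, rescaled so that
    \<open>C * \<sigma> / (4 * L)\<close> is the midpoint of
    \<open>C\<^sub>L * \<sigma> / (4 * L)\<close> and \<open>\<mu>\<close>.\<close>
  define \<delta> where "\<delta> = (\<mu> - C\<^sub>L * \<sigma> / (4 * L)) * (4 * L / \<sigma>) / 2"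
  define C where "C = C\<^sub>L + \<delta>"
  have \<delta>: "0 < \<delta>" using assms(16,17,21) by (simp add: \<delta>_def)
  have C: "0 < C" "C\<^sub>L \<le> C" using \<delta> assms(2) by (simp_all add: C_def)
  have lip: "C-lipschitz_on UNIV g" unfolding g_def by (rule lipschitz_on_le[OF assms(3) C(2)])
  have "C * \<sigma> / (4 * L) = (\<mu> + C\<^sub>L * \<sigma> / (4 * L)) / 2"
    using assms(16,17) by (simp add: C_def \<delta>_def field_simps)
  moreover have "(\<mu> + q) / 2 < \<mu>" if "q < \<mu>" for q using that by simp
  ultimately have "C * \<sigma> / (4 * L) < \<mu>" using assms(21) by presburger
  then have "\<sigma> / (4 * L) < \<mu> / C" using C(1) by (simp add: pos_less_divide_eq mult.commute)
  then obtain b where b: "\<sigma> / (4 * L) < b" "b < \<mu> / C" using dense by blast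
  have b2: "b * C < \<mu>" using b(2) C(1) by (simp add: pos_less_divide_eq)
  have b0: "0 < b" using b(1) assms(16,17) by (smt (verit) divide_pos_pos)
  have g_le: "(norm (g x))\<^sup>2 \<le> 2 * C * f x" for x
    by (rule gradient_norm_le[OF f_deriv lip C(1) f_nonneg])
  obtain \<kappa> where \<kappa>: "0 < \<kappa>" "\<And>F (g :: real^'d) v. (norm g)\<^sup>2 \<le> 2 * C * F \<Longrightarrow>
      F / 2 + \<kappa> * (norm v)\<^sup>2 \<le> (1 + b * \<mu>) * F + b * (g \<bullet> v) + (norm v)\<^sup>2 / 2"
    using lyapunov_lower_bound[OF C(1) b0 b2] by blast
  obtain m where m: "0 < m" "\<And>F (g :: real^'d) v h S. 2 * L * F \<le> (norm g)\<^sup>2 \<Longrightarrow> S \<le> \<sigma> * F \<Longrightarrow> norm h \<le> C * norm v \<Longrightarrow>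
      m * ((1 + b * \<mu>) * F + b * (g \<bullet> v) + (norm v)\<^sup>2 / 2)
       + ((1 + b * \<mu>) * (g \<bullet> v) + b * (h \<bullet> v) - (b *\<^sub>R g + v) \<bullet> (\<mu> *\<^sub>R v + g) + S / 2) \<le> 0"
    using lyapunov_drift_bound[OF C(1) b(1) b2 assms(16,17)] by blast
  have lower: "f x / 2 + \<kappa> * (norm v)\<^sup>2 \<le> K.lyapunov b x v" for x v
    unfolding K.lyapunov_def by (rule \<kappa>(2)[OF g_le])
  have lyap_nonneg: "0 \<le> K.lyapunov b x v" for x v
  proof -
    have "0 \<le> f x / 2 + \<kappa> * (norm v)\<^sup>2" using f_nonneg[of x] \<kappa>(1) by simp
    then show ?thesis using lower[of x v] by linarith
  qed
  have le4: "(norm y)\<^sup>2 \<le> 1 + norm y ^ 4" for y :: "real^'d"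
  proof -
    have "2 * (norm y)\<^sup>2 \<le> 1 + norm y ^ 4" using sum_squares_bound[of 1 "(norm y)\<^sup>2"] by simp
    then show ?thesis using zero_le_power2[of "norm y"] by linarith
  qed
  \<comment> \<open>The Lyapunov function grows at most quadratically because the gradient is
    Lipschitz: \<open>descent_lemma\<close> at \<open>0\<close> bounds \<open>f x\<close>, and
    \<open>g_le\<close> bounds the gradient. By \<open>le4\<close> the squares are replaced by
    fourth powers, whose integrability at time \<open>0\<close> is assumed.\<close>
  define bound where "bound x v = (1 + b * \<mu> + b * C) * (f 0 + (norm (g 0))\<^sup>2 / 2 + (1 + C) / 2 * (1 + norm x ^ 4))
      + (b + 1) / 2 * (1 + norm v ^ 4)" for x v :: "real^'d"
  have upper: "K.lyapunov b x v \<le> bound x v" for x v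
  proof -
    have "x \<bullet> g 0 \<le> ((norm x)\<^sup>2 + (norm (g 0))\<^sup>2) / 2"
      using norm_cauchy_schwarz[of x "g 0"] sum_squares_bound[of "norm x" "norm (g 0)"] by simp
    then have "f x \<le> f 0 + (norm (g 0))\<^sup>2 / 2 + (1 + C) / 2 * (norm x)\<^sup>2"
      using descent_lemma[OF f_deriv lip, of 0 x] by (simp add: algebra_simps add_divide_distrib)
    also have "\<dots> \<le> f 0 + (norm (g 0))\<^sup>2 / 2 + (1 + C) / 2 * (1 + norm x ^ 4)"
      using C(1) le4[of x] by (intro add_left_mono mult_left_mono) auto
    finally have fx: "f x \<le> \<dots>" .
    have "g x \<bullet> v \<le> ((norm (g x))\<^sup>2 + (norm v)\<^sup>2) / 2"
      using norm_cauchy_schwarz[of "g x" v] sum_squares_bound[of "norm (g x)" "norm v"] by simp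
    also have "\<dots> \<le> C * f x + (norm v)\<^sup>2 / 2" using g_le[of x] by (simp add: add_divide_distrib)
    finally have "b * (g x \<bullet> v) \<le> b * (C * f x + (norm v)\<^sup>2 / 2)" using b0 by (intro mult_left_mono) auto
    then have "K.lyapunov b x v \<le> (1 + b * \<mu> + b * C) * f x + (b + 1) / 2 * (norm v)\<^sup>2"
      unfolding K.lyapunov_def by (simp add: algebra_simps add_divide_distrib)
    also have "\<dots> \<le> bound x v"
      unfolding bound_def using b0 C(1) assms(14) fx le4[of v] by (intro add_mono mult_left_mono) auto
    finally show ?thesis .
  qed
  have initial: "integrable M (\<lambda>\<omega>. K.lyapunov b (X' 0 \<omega>) (V' 0 \<omega>))"
  proof (rule Bochner_Integration.integrable_bound)
    show "integrable M (\<lambda>\<omega>. bound (X 0 \<omega>) (V 0 \<omega>))"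
      unfolding bound_def using assms(11,13) by simp
    show "(\<lambda>\<omega>. K.lyapunov b (X' 0 \<omega>) (V' 0 \<omega>)) \<in> borel_measurable M"
      \<comment> \<open>With rate \<open>0\<close> the weighted process at time \<open>0\<close> is
        the Lyapunov function itself.\<close>
      using B.measurable_F_M[OF order_refl K.weighted_adapted[OF order_refl, of 0 b]]
      by (simp add: K.weighted_def[abs_def])
    show "AE \<omega> in M. norm (K.lyapunov b (X' 0 \<omega>) (V' 0 \<omega>)) \<le> norm (bound (X 0 \<omega>) (V 0 \<omega>))"
      using good
    proof eventually_elim
      case (elim \<omega>)
      then show ?case
        using upper[of "X 0 \<omega>" "V 0 \<omega>"] lyap_nonneg[of "X 0 \<omega>" "V 0 \<omega>"] by (simp add: X'_def V'_def)
    qed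
  qed
  interpret L: kinetic_lyapunov M F W X' V' I' X I f g H \<Sigma> \<mu> D m b \<kappa>
  proof unfold_locales
    show "m * K.lyapunov b x v + K.drift b x v \<le> 0" if x: "x \<in> D" for x v
      unfolding K.lyapunov_def K.drift_def
    proof (rule m(2))
      show "2 * L * f x \<le> (norm (g x))\<^sup>2" using assms(19)[OF x] by (simp add: g_def)
      show "(norm (\<Sigma> x))\<^sup>2 \<le> \<sigma> * f x" using assms(20)[OF x] by (simp add: norm_eq_frobenius_norm)
      show "norm (H x *v v) \<le> C * norm v" by (rule lipschitz_derivative_bound[OF lip H(1)])
    qed
  qed (rule assms(18) m(1) \<kappa>(1) f_nonneg lower initial)+
  have X'_inside: "AE \<omega> in M. exit_time D X \<omega> = \<infinity> \<longrightarrow> (\<forall>u\<ge>0. X' u \<omega> \<in> D)"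
    using good
  proof eventually_elim
    case (elim \<omega>)
    then show ?case using exit_time_infinite_inside[of D X \<omega>] by (simp add: X'_def)
  qed
  have decay: "integrable M (\<lambda>\<omega>. indicator {\<omega>. exit_time D X \<omega> > ereal t} \<omega> * f (X t \<omega>)) \<and>
      (\<integral>\<omega>. indicator {\<omega>. exit_time D X \<omega> > ereal t} \<omega> * f (X t \<omega>) \<partial>M) \<le> (2 * L.E0 + 1) * exp (- m * t)"
    if t: "0 \<le> t" for t
  proof -
    let ?Y = "\<lambda>\<omega>. indicator {\<omega>. exit_time D X \<omega> > ereal t} \<omega> * f (X t \<omega>)"
    let ?Y' = "\<lambda>\<omega>. indicator (L.inside t) \<omega> * f (X' t \<omega>)"
    have eq: "AE \<omega> in M. ?Y' \<omega> = ?Y \<omega>"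
      using good AE_space[of M]
    proof eventually_elim
      case (elim \<omega>)
      have "ereal t < exit_time D X \<omega> \<longleftrightarrow> (\<forall>u\<in>{0..t}. X u \<omega> \<in> D)"
        using elim(1) by (intro less_exit_time_iff[OF assms(18) _ t] good_cont(1))
      then show ?case using elim by (simp add: L.inside_def X'_def indicator_def)
    qed
    have i: "integrable M ?Y'" by (rule L.expected_decay(1)[OF t])
    then have m1: "?Y' \<in> borel_measurable M" by (rule borel_measurable_integrable)
    have m2: "?Y \<in> borel_measurable M" by (rule B.measurable_M_AE[OF m1 eq])
    have "integrable M ?Y" using i integrable_cong_AE[OF m1 m2 eq] by blast
    moreover have "(\<integral>\<omega>. ?Y \<omega> \<partial>M) = (\<integral>\<omega>. ?Y' \<omega> \<partial>M)" by (rule integral_cong_AE[OF m1 m2 eq, symmetric])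
    then have "(\<integral>\<omega>. ?Y \<omega> \<partial>M) \<le> 2 * L.E0 * exp (- m * t)" using L.expected_decay(2)[OF t] by simp
    then have "(\<integral>\<omega>. ?Y \<omega> \<partial>M) \<le> (2 * L.E0 + 1) * exp (- m * t)"
      using exp_gt_zero[of "- m * t"] by (simp only: distrib_right mult_1)
    ultimately show ?thesis by blast
  qed
  have path: "AE \<omega> in M. exit_time D X \<omega> = \<infinity> \<longrightarrow> ((\<lambda>t. exp (m' * t) * f (X t \<omega>)) \<longlongrightarrow> 0) at_top" if "m' < m" for m'
    using good L.S_bounded X'_inside
  proof eventually_elim
    case (elim \<omega>)
    show ?case
    proof
      assume "exit_time D X \<omega> = \<infinity>"
      then obtain B where "\<forall>u\<ge>0. L.S u \<omega> \<le> B" using elim(2,3) by blast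
      from L.path_decay[OF this that] show "((\<lambda>t. exp (m' * t) * f (X t \<omega>)) \<longlongrightarrow> 0) at_top"
        using elim(1) by (simp add: X'_def)
    qed
  qed
  have conv: "AE \<omega> in M. exit_time D X \<omega> = \<infinity> \<longrightarrow> (\<exists>x. ((\<lambda>t. X t \<omega>) \<longlongrightarrow> x) at_top)"
    using good L.S_bounded X'_inside AE_space[of M]
  proof eventually_elim
    case (elim \<omega>)
    show ?case
    proof
      assume "exit_time D X \<omega> = \<infinity>"
      then obtain B where "\<forall>u\<ge>0. L.S u \<omega> \<le> B" using elim(2,3) by blast
      from L.path_convergent[OF elim(4) this] show "\<exists>x. ((\<lambda>t. X t \<omega>) \<longlongrightarrow> x) at_top"
        using elim(1) by (simp add: X'_def)
    qed
  qed
  \<comment> \<open>\<open>E0\<close> may be \<open>0\<close>, whereas the constant of the theorem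
    has to be positive.\<close>
  have "0 < 2 * L.E0 + 1" using L.E0_nonneg by simp
  with m(1) decay path conv show ?thesis by blast
qed

end
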